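(* Consider the discrete passenger-taxicab setting. For any profile $P$ and supply $s$ there exist surge prices $r$, demand $d(r)$ and new supply $s'$ such that: (1) supply $s$, new supply $s'$, demand $d(r)$, and surge prices $r$ are in passenger-taxicab equilibrium; (2) $s'$ is social welfare maximizing with respect to supply $s$, profile $P$, and demand $d$; (3) the surge prices $r$ can be computed in polynomial time; (4) it is a dominant strategy for passengers to report their true valuations to the surge-price computation.
   Context: $V$ is the vertex set of a finite metric space with distances $\ell_{u,v}\ge 0$. $B=\{b_1,\dots,b_m\}$ is a set of passengers and $T=\{t_1,\dots,t_n\}$ a set of taxicabs; passenger $b$ has value $\mathrm{value}(b)\ge 0$ for service. A supply $s=\langle s_v\rangle_{v\in V}$ consists of pairwise disjoint sets $s_v\subseteq T$ (the taxicabs at $v$) with union $T$. A profile $P=\langle P_v\rangle_{v\in V}$ is a partition of $B$, where $P_v$ is the set of passengers at $v$. $\mathrm{loc}(\cdot)$ denotes the location of a passenger or taxicab. Surge prices are $r=\langle r_v\rangle_{v\in V}$ with $r_v\ge 0$. The demand is $d=\langle d_v\rangle_{v\in V}$ with $d_v(r_v)=\{b\in P_v:\mathrm{value}(b)\ge r_v\}$. A flow from $s$ to $s'$ is a function $f:V\times V\to\mathbb{Z}_{\ge 0}$ with $\sum_v f(u,v)=|s_u|$ for all $u$ and $\sum_u f(u,v)=|s'_v|$ for all $v$; its cost is $\sum_{u,v} f(u,v)\ell_{u,v}$, and $em(s,s')$ is the minimum cost of a flow from $s$ to $s'$. Demand served: if $|d_v(r_v)|\le|s'_v|$, the passengers served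 at $v$ are all of $d_v(r_v)$; if $|s'_v|<|d_v(r_v)|$ they are the $|s'_v|$ highest valued passengers of $d_v(r_v)$, ties broken arbitrarily. $\mathrm{dsv}(s',d,r)$ is the sum of the values of all passengers served. The social welfare is $SW(s,s',r,d)=\mathrm{dsv}(s',d,r)-em(s,s')$. The utility of a taxicab $t_j\in s_u$ moving from $u$ to $v$, given $s'$, $r$, $d$, is $\mu_{t_j}(u\mapsto v\mid s',r,d)=\frac{\min(|d_v(r_v)|,|s'_v|)}{|s'_v|}\cdot r_v-\ell_{u,v}$ (no separate convention is specified for $|s'_v|=0$). The utility of a passenger $b$ is $\mathrm{value}(b)-r_{\mathrm{loc}(b)}$ if served and $0$ otherwise. Given demand $d$, current supply $s$ and new supply $s'$, surge prices $r$ are in passenger-taxicab equilibrium if for every min cost flow $f$ from $s$ to $s'$ and any $u,v$ with $f(u,v)>0$: (i) taxicabs choose a best response, i.e. $\mu_{t_j}(u\mapsto v\mid s',r,d)=\max_{w\in V}\mu_{t_j}(u\mapsto w\mid s',r,d)$; and (ii) all passengers $b\in B$ with $\mathrm{value}(b)>r_{\mathrm{loc}(b)}$ are served, and no passengers $b\in B$ with $\mathrm{value}(b)<r_{\mathrm{loc}(b)}$ are served. The surge-price computation is the following. Form the unit demand market with buyers $B$ and items $T$, in which buyer $b_i$ values item $t_j$ at $\mathrm{value}(b_i)-\ell_{\mathrm{loc}(b_i),\mathrm{loc}(t_j)}$. Take a social welfare maximizing allocation of this market and its minimal Walrasian prices $p_{t_j}$, and set $r_v=\min_{t_j\in T}(\ell_{\mathrm{loc}(t_j),v}+p_{t_j})$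 for all $v\in V$. The new supply $s'$ is obtained by moving each allocated taxicab to the location of the passenger who is allocated it, and leaving unallocated taxicabs in place. The passengers' values used are the ones they report. Polynomial time means polynomial in the number of passengers and taxicabs. *)

theory Defs
  imports
    "HOL-Analysis.Abstract_Metric_Spaces"
    "HOL-Library.Disjoint_Sets"
    "HOL-Computational_Algebra.Polynomial"
begin

section \<open>The passenger-taxicab setting\<close>

text \<open>
  A family of sets indexed by the locations that splits up \<open>X\<close>; parts may be empty.
  Profiles are distributions of the passengers \<open>B\<close>, supplies are distributions of the taxicabs \<open>T\<close>.
\<close>

definition distribution :: "'v set \<Rightarrow> 'a set \<Rightarrow> ('v \<Rightarrow> 'a set) \<Rightarrow> bool" where
  "distribution V X A \<longleftrightarrow> disjoint_family_on A V \<and> (\<Union>v\<in>V. A v) = X"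

definition loc :: "'v set \<Rightarrow> ('v \<Rightarrow> 'a set) \<Rightarrow> 'a \<Rightarrow> 'v" where
  "loc V A x = (THE v. v \<in> V \<and> x \<in> A v)"

text \<open>There has to be a taxicab, since surge prices are minima over the set of taxicabs.\<close>

definition taxi_setting ::
  "'v set \<Rightarrow> ('v \<Rightarrow> 'v \<Rightarrow> real) \<Rightarrow> 'b set \<Rightarrow> 't set \<Rightarrow> ('b \<Rightarrow> real) \<Rightarrow>
   ('v \<Rightarrow> 'b set) \<Rightarrow> ('v \<Rightarrow> 't set) \<Rightarrow> bool" where
  "taxi_setting V l B T value P s \<longleftrightarrow>
     finite V \<and> Metric_space V l \<and> finite B \<and> finite T \<and> T \<noteq> {} \<and>
     (\<forall>b\<in>B. 0 \<le> value b) \<and> distribution V B P \<and> distribution V T s"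

definition demand :: "('v \<Rightarrow> 'b set) \<Rightarrow> ('b \<Rightarrow> real) \<Rightarrow> 'v \<Rightarrow> real \<Rightarrow> 'b set" where
  "demand P value v x = {b \<in> P v. x \<le> value b}"

subsection \<open>Flows and social welfare\<close>

definition is_flow ::
  "'v set \<Rightarrow> ('v \<Rightarrow> 't set) \<Rightarrow> ('v \<Rightarrow> 't set) \<Rightarrow> ('v \<Rightarrow> 'v \<Rightarrow> nat) \<Rightarrow> bool" where
  "is_flow V s s' f \<longleftrightarrow>
     (\<forall>u\<in>V. (\<Sum>v\<in>V. f u v) = card (s u)) \<and> (\<forall>v\<in>V. (\<Sum>u\<in>V. f u v) = card (s' v))"

definition flow_cost :: "'v set \<Rightarrow> ('v \<Rightarrow> 'v \<Rightarrow> real) \<Rightarrow> ('v \<Rightarrow> 'v \<Rightarrow> nat) \<Rightarrow> real" where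
  "flow_cost V l f = (\<Sum>u\<in>V. \<Sum>v\<in>V. real (f u v) * l u v)"

definition min_cost_flow ::
  "'v set \<Rightarrow> ('v \<Rightarrow> 'v \<Rightarrow> real) \<Rightarrow> ('v \<Rightarrow> 't set) \<Rightarrow> ('v \<Rightarrow> 't set) \<Rightarrow> ('v \<Rightarrow> 'v \<Rightarrow> nat) \<Rightarrow> bool"
where
  "min_cost_flow V l s s' f \<longleftrightarrow>
     is_flow V s s' f \<and> (\<forall>g. is_flow V s s' g \<longrightarrow> flow_cost V l f \<le> flow_cost V l g)"

definition em ::
  "'v set \<Rightarrow> ('v \<Rightarrow> 'v \<Rightarrow> real) \<Rightarrow> ('v \<Rightarrow> 't set) \<Rightarrow> ('v \<Rightarrow> 't set) \<Rightarrow> real" where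
  "em V l s s' = Inf {flow_cost V l f | f. is_flow V s s' f}"

definition served_at ::
  "('v \<Rightarrow> 't set) \<Rightarrow> ('v \<Rightarrow> real \<Rightarrow> 'b set) \<Rightarrow> ('v \<Rightarrow> real) \<Rightarrow> ('b \<Rightarrow> real) \<Rightarrow> 'v \<Rightarrow> 'b set \<Rightarrow> bool"
where
  "served_at s' d r value v S \<longleftrightarrow>
     (if card (d v (r v)) \<le> card (s' v) then S = d v (r v)
      else S \<subseteq> d v (r v) \<and> card S = card (s' v) \<and>
           (\<forall>b\<in>S. \<forall>b'\<in>d v (r v) - S. value b' \<le> value b))"

text \<open>
  \<open>S\<close> is a possible set of served passengers; different \<open>S\<close> correspond to different ways of
  breaking ties.
\<close>

definition demand_served ::
  "'v set \<Rightarrow> ('v \<Rightarrow> 't set) \<Rightarrow> ('v \<Rightarrow> real \<Rightarrow> 'b set) \<Rightarrow> ('v \<Rightarrow> real) \<Rightarrow> ('b \<Rightarrow> real) \<Rightarrow> 'b set \<Rightarrow> bool"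
where
  "demand_served V s' d r value S \<longleftrightarrow>
     (\<exists>S'. (\<forall>v\<in>V. served_at s' d r value v (S' v)) \<and> S = (\<Union>v\<in>V. S' v))"

text \<open>The total value does not depend on the choice of the set of served passengers.\<close>

definition dsv ::
  "'v set \<Rightarrow> ('b \<Rightarrow> real) \<Rightarrow> ('v \<Rightarrow> 't set) \<Rightarrow> ('v \<Rightarrow> real \<Rightarrow> 'b set) \<Rightarrow> ('v \<Rightarrow> real) \<Rightarrow> real" where
  "dsv V value s' d r = (\<Sum>b\<in>(SOME S. demand_served V s' d r value S). value b)"

definition social_welfare ::
  "'v set \<Rightarrow> ('v \<Rightarrow> 'v \<Rightarrow> real) \<Rightarrow> ('b \<Rightarrow> real) \<Rightarrow>
   ('v \<Rightarrow> 't set) \<Rightarrow> ('v \<Rightarrow> 't set) \<Rightarrow> ('v \<Rightarrow> real) \<Rightarrow> ('v \<Rightarrow> real \<Rightarrow> 'b set) \<Rightarrow> real" where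
  "social_welfare V l value s s' r d = dsv V value s' d r - em V l s s'"

definition welfare_maximizing_supply ::
  "'v set \<Rightarrow> ('v \<Rightarrow> 'v \<Rightarrow> real) \<Rightarrow> 't set \<Rightarrow> ('b \<Rightarrow> real) \<Rightarrow>
   ('v \<Rightarrow> 't set) \<Rightarrow> ('v \<Rightarrow> 't set) \<Rightarrow> ('v \<Rightarrow> real) \<Rightarrow> ('v \<Rightarrow> real \<Rightarrow> 'b set) \<Rightarrow> bool" where
  "welfare_maximizing_supply V l T value s s' r d \<longleftrightarrow>
     distribution V T s' \<and>
     (\<forall>s''. distribution V T s'' \<longrightarrow>
        social_welfare V l value s s'' r d \<le> social_welfare V l value s s' r d)"

subsection \<open>Utilities and equilibria\<close>

text \<open>
  The quotient \<open>min \<bar>d\<bar> \<bar>s'\<bar> / \<bar>s'\<bar>\<close> is the chance of a taxicab to get a passenger. At a location without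
  supply it reads 0/0; there the parameter \<open>\<kappa>\<close> takes its place.
\<close>

definition service_ratio ::
  "('v \<Rightarrow> real) \<Rightarrow> ('v \<Rightarrow> 't set) \<Rightarrow> ('v \<Rightarrow> real \<Rightarrow> 'b set) \<Rightarrow> ('v \<Rightarrow> real) \<Rightarrow> 'v \<Rightarrow> real" where
  "service_ratio \<kappa> s' d r v =
     (if card (s' v) = 0 then \<kappa> v
      else real (min (card (d v (r v))) (card (s' v))) / real (card (s' v)))"

text \<open>The utility of a move from \<open>u\<close> to \<open>v\<close> is the same for all taxicabs at \<open>u\<close>.\<close>

definition taxi_utility ::
  "('v \<Rightarrow> real) \<Rightarrow> ('v \<Rightarrow> 'v \<Rightarrow> real) \<Rightarrow> ('v \<Rightarrow> 't set) \<Rightarrow> ('v \<Rightarrow> real) \<Rightarrow>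
   ('v \<Rightarrow> real \<Rightarrow> 'b set) \<Rightarrow> 'v \<Rightarrow> 'v \<Rightarrow> real" where
  "taxi_utility \<kappa> l s' r d u v = service_ratio \<kappa> s' d r v * r v - l u v"

definition passenger_utility ::
  "'v set \<Rightarrow> ('v \<Rightarrow> 'b set) \<Rightarrow> ('b \<Rightarrow> real) \<Rightarrow> ('v \<Rightarrow> real) \<Rightarrow> 'b set \<Rightarrow> 'b \<Rightarrow> real" where
  "passenger_utility V P value r S b = (if b \<in> S then value b - r (loc V P b) else 0)"

text \<open>The condition on passengers is required for every way of breaking ties.\<close>

definition passenger_taxi_equilibrium ::
  "('v \<Rightarrow> real) \<Rightarrow> 'v set \<Rightarrow> ('v \<Rightarrow> 'v \<Rightarrow> real) \<Rightarrow> 'b set \<Rightarrow> ('b \<Rightarrow> real) \<Rightarrow> ('v \<Rightarrow> 'b set) \<Rightarrow>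
   ('v \<Rightarrow> 't set) \<Rightarrow> ('v \<Rightarrow> 't set) \<Rightarrow> ('v \<Rightarrow> real \<Rightarrow> 'b set) \<Rightarrow> ('v \<Rightarrow> real) \<Rightarrow> bool" where
  "passenger_taxi_equilibrium \<kappa> V l B value P s s' d r \<longleftrightarrow>
     (\<forall>f. min_cost_flow V l s s' f \<longrightarrow>
        (\<forall>u\<in>V. \<forall>v\<in>V. 0 < f u v \<longrightarrow>
           taxi_utility \<kappa> l s' r d u v = (MAX w\<in>V. taxi_utility \<kappa> l s' r d u w) \<and>
           (\<forall>S. demand_served V s' d r value S \<longrightarrow>
              (\<forall>b\<in>B. (r (loc V P b) < value b \<longrightarrow> b \<in> S) \<and>
                     (value b < r (loc V P b) \<longrightarrow> b \<notin> S)))))"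

section \<open>The surge-price computation\<close>

subsection \<open>Unit demand markets\<close>

definition allocation :: "'b set \<Rightarrow> 't set \<Rightarrow> ('b \<Rightarrow> 't option) \<Rightarrow> bool" where
  "allocation B T a \<longleftrightarrow>
     (\<forall>b\<in>B. \<forall>t. a b = Some t \<longrightarrow> t \<in> T) \<and>
     (\<forall>b\<in>B. \<forall>b'\<in>B. \<forall>t. a b = Some t \<and> a b' = Some t \<longrightarrow> b = b')"

definition allocation_welfare ::
  "'b set \<Rightarrow> ('b \<Rightarrow> 't \<Rightarrow> real) \<Rightarrow> ('b \<Rightarrow> 't option) \<Rightarrow> real" where
  "allocation_welfare B val a = (\<Sum>b\<in>B. case a b of None \<Rightarrow> 0 | Some t \<Rightarrow> val b t)"

definition welfare_maximizing_allocation ::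
  "'b set \<Rightarrow> 't set \<Rightarrow> ('b \<Rightarrow> 't \<Rightarrow> real) \<Rightarrow> ('b \<Rightarrow> 't option) \<Rightarrow> bool" where
  "welfare_maximizing_allocation B T val a \<longleftrightarrow>
     allocation B T a \<and>
     (\<forall>a'. allocation B T a' \<longrightarrow> allocation_welfare B val a' \<le> allocation_welfare B val a)"

definition buyer_utility ::
  "('b \<Rightarrow> 't \<Rightarrow> real) \<Rightarrow> ('t \<Rightarrow> real) \<Rightarrow> 'b \<Rightarrow> 't option \<Rightarrow> real" where
  "buyer_utility val p b x = (case x of None \<Rightarrow> 0 | Some t \<Rightarrow> val b t - p t)"

definition walrasian_prices ::
  "'b set \<Rightarrow> 't set \<Rightarrow> ('b \<Rightarrow> 't \<Rightarrow> real) \<Rightarrow> ('b \<Rightarrow> 't option) \<Rightarrow> ('t \<Rightarrow> real) \<Rightarrow> bool" where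
  "walrasian_prices B T val a p \<longleftrightarrow>
     allocation B T a \<and> (\<forall>t\<in>T. 0 \<le> p t) \<and>
     (\<forall>b\<in>B. \<forall>x\<in>insert None (Some ` T). buyer_utility val p b x \<le> buyer_utility val p b (a b)) \<and>
     (\<forall>t\<in>T. (\<forall>b\<in>B. a b \<noteq> Some t) \<longrightarrow> p t = 0)"

definition minimal_walrasian_prices ::
  "'b set \<Rightarrow> 't set \<Rightarrow> ('b \<Rightarrow> 't \<Rightarrow> real) \<Rightarrow> ('b \<Rightarrow> 't option) \<Rightarrow> ('t \<Rightarrow> real) \<Rightarrow> bool" where
  "minimal_walrasian_prices B T val a p \<longleftrightarrow>
     walrasian_prices B T val a p \<and>
     (\<forall>q. walrasian_prices B T val a q \<longrightarrow> (\<forall>t\<in>T. p t \<le> q t))"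

subsection \<open>Surge prices and new supply\<close>

definition taxi_market_value ::
  "'v set \<Rightarrow> ('v \<Rightarrow> 'v \<Rightarrow> real) \<Rightarrow> ('b \<Rightarrow> real) \<Rightarrow> ('v \<Rightarrow> 'b set) \<Rightarrow> ('v \<Rightarrow> 't set) \<Rightarrow> 'b \<Rightarrow> 't \<Rightarrow> real"
where
  "taxi_market_value V l value P s b t = value b - l (loc V P b) (loc V s t)"

definition moved_supply ::
  "'b set \<Rightarrow> 't set \<Rightarrow> ('v \<Rightarrow> 'b set) \<Rightarrow> ('v \<Rightarrow> 't set) \<Rightarrow> ('b \<Rightarrow> 't option) \<Rightarrow> 'v \<Rightarrow> 't set" where
  "moved_supply B T P s a v =
     {t\<in>T. (\<exists>b\<in>B. a b = Some t \<and> b \<in> P v) \<or> ((\<forall>b\<in>B. a b \<noteq> Some t) \<and> t \<in> s v)}"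

text \<open>
  \<open>r\<close> and \<open>s'\<close> are a possible outcome of the computation on the reported values \<open>value\<close>.
  It is a relation because the welfare maximizing allocation need not be unique.
\<close>

definition surge_outcome ::
  "'v set \<Rightarrow> ('v \<Rightarrow> 'v \<Rightarrow> real) \<Rightarrow> 'b set \<Rightarrow> 't set \<Rightarrow> ('b \<Rightarrow> real) \<Rightarrow> ('v \<Rightarrow> 'b set) \<Rightarrow> ('v \<Rightarrow> 't set) \<Rightarrow>
   ('v \<Rightarrow> real) \<Rightarrow> ('v \<Rightarrow> 't set) \<Rightarrow> bool" where
  "surge_outcome V l B T value P s r s' \<longleftrightarrow>
     (\<exists>a p. welfare_maximizing_allocation B T (taxi_market_value V l value P s) a \<and>
            minimal_walrasian_prices B T (taxi_market_value V l value P s) a p \<and>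
            (\<forall>v\<in>V. r v = (MIN t\<in>T. l (loc V s t) v + p t)) \<and>
            (\<forall>v\<in>V. s' v = moved_supply B T P s a v))"

text \<open>
  Whatever the other passengers report, no report of \<open>b\<close> gives it more utility than its true value,
  however ties are broken in either case. The utility is always taken with respect to the true
  values.
\<close>

definition truthful_dominant ::
  "'v set \<Rightarrow> ('v \<Rightarrow> 'v \<Rightarrow> real) \<Rightarrow> 'b set \<Rightarrow> 't set \<Rightarrow> ('b \<Rightarrow> real) \<Rightarrow> ('v \<Rightarrow> 'b set) \<Rightarrow> ('v \<Rightarrow> 't set) \<Rightarrow> bool"
where
  "truthful_dominant V l B T value P s \<longleftrightarrow>
     (\<forall>b\<in>B. \<forall>report. (\<forall>b'\<in>B. 0 \<le> report b') \<longrightarrow>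
        (let truth = report(b := value b) in
         \<forall>r s' S r' s'' S'.
           surge_outcome V l B T truth P s r s' \<and>
           demand_served V s' (demand P truth) r truth S \<and>
           surge_outcome V l B T report P s r' s'' \<and>
           demand_served V s'' (demand P report) r' report S' \<longrightarrow>
           passenger_utility V P value r' S' b \<le> passenger_utility V P value r S b))"

section \<open>Polynomial time\<close>

text \<open>
  While programs over two-dimensional arrays of natural numbers and of real numbers, at unit cost
  per assignment and test (expressions have a fixed size within a program). Arithmetic is restricted
  to addition, subtraction and comparison, and the only real constants are 0 and 1: with
  multiplication, or arbitrary real constants, unit cost would not be a realistic measure. On rational
  inputs the bit length of all numbers is at most linear in that of the input and the number of
  steps, so polynomially many steps mean strongly polynomial time. Variables are array
  cells with index (0, 0).
\<close>

datatype nexp = NConst nat | NGet string nexp nexp | NAdd nexp nexp | NSub nexp nexp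

datatype rexp = RZero | ROne | RGet string nexp nexp | RAdd rexp rexp | RSub rexp rexp

datatype bexp = NLess nexp nexp | RLess rexp rexp | BNot bexp | BAnd bexp bexp

datatype com =
    Skip
  | NSet string nexp nexp nexp
  | RSet string nexp nexp rexp
  | Seq com com
  | Cond bexp com com
  | While bexp com

type_synonym state = "(string \<times> nat \<times> nat \<Rightarrow> nat) \<times> (string \<times> nat \<times> nat \<Rightarrow> real)"

primrec nval :: "state \<Rightarrow> nexp \<Rightarrow> nat" where
  "nval \<sigma> (NConst k) = k"
| "nval \<sigma> (NGet x i j) = fst \<sigma> (x, nval \<sigma> i, nval \<sigma> j)"
| "nval \<sigma> (NAdd e e') = nval \<sigma> e + nval \<sigma> e'"
| "nval \<sigma> (NSub e e') = nval \<sigma> e - nval \<sigma> e'"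

primrec rval :: "state \<Rightarrow> rexp \<Rightarrow> real" where
  "rval \<sigma> RZero = 0"
| "rval \<sigma> ROne = 1"
| "rval \<sigma> (RGet x i j) = snd \<sigma> (x, nval \<sigma> i, nval \<sigma> j)"
| "rval \<sigma> (RAdd e e') = rval \<sigma> e + rval \<sigma> e'"
| "rval \<sigma> (RSub e e') = rval \<sigma> e - rval \<sigma> e'"

primrec bval :: "state \<Rightarrow> bexp \<Rightarrow> bool" where
  "bval \<sigma> (NLess e e') \<longleftrightarrow> nval \<sigma> e < nval \<sigma> e'"
| "bval \<sigma> (RLess e e') \<longleftrightarrow> rval \<sigma> e < rval \<sigma> e'"
| "bval \<sigma> (BNot g) \<longleftrightarrow> \<not> bval \<sigma> g"
| "bval \<sigma> (BAnd g g') \<longleftrightarrow> bval \<sigma> g \<and> bval \<sigma> g'"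

text \<open>\<open>exec c \<sigma> k \<sigma>'\<close>: started in \<open>\<sigma>\<close>, the program \<open>c\<close> halts in \<open>\<sigma>'\<close> after \<open>k\<close> steps.\<close>

inductive exec :: "com \<Rightarrow> state \<Rightarrow> nat \<Rightarrow> state \<Rightarrow> bool" where
  Skip: "exec Skip \<sigma> 1 \<sigma>"
| NSet: "exec (NSet x i j e) \<sigma> 1 ((fst \<sigma>)((x, nval \<sigma> i, nval \<sigma> j) := nval \<sigma> e), snd \<sigma>)"
| RSet: "exec (RSet x i j e) \<sigma> 1 (fst \<sigma>, (snd \<sigma>)((x, nval \<sigma> i, nval \<sigma> j) := rval \<sigma> e))"
| Seq: "exec c \<sigma> k \<sigma>' \<Longrightarrow> exec c' \<sigma>' k' \<sigma>'' \<Longrightarrow> exec (Seq c c') \<sigma> (k + k') \<sigma>''"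
| CondTrue: "bval \<sigma> g \<Longrightarrow> exec c \<sigma> k \<sigma>' \<Longrightarrow> exec (Cond g c c') \<sigma> (Suc k) \<sigma>'"
| CondFalse: "\<not> bval \<sigma> g \<Longrightarrow> exec c' \<sigma> k \<sigma>' \<Longrightarrow> exec (Cond g c c') \<sigma> (Suc k) \<sigma>'"
| WhileFalse: "\<not> bval \<sigma> g \<Longrightarrow> exec (While g c) \<sigma> 1 \<sigma>"
| WhileTrue: "bval \<sigma> g \<Longrightarrow> exec c \<sigma> k \<sigma>' \<Longrightarrow> exec (While g c) \<sigma>' k' \<sigma>'' \<Longrightarrow>
    exec (While g c) \<sigma> (Suc (k + k')) \<sigma>''"

text \<open>
  The input of a program: locations, passengers and taxicabs are represented by their numbers with
  respect to the enumerations \<open>eV\<close>, \<open>eB\<close>, \<open>eT\<close>; \<open>v\<close> is the location whose surge price is requested.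
  All cells that do not hold input are 0.
\<close>

definition input_state ::
  "(nat \<Rightarrow> 'v) \<Rightarrow> (nat \<Rightarrow> 'b) \<Rightarrow> (nat \<Rightarrow> 't) \<Rightarrow> 'v set \<Rightarrow> ('v \<Rightarrow> 'v \<Rightarrow> real) \<Rightarrow> 'b set \<Rightarrow> 't set \<Rightarrow>
   ('b \<Rightarrow> real) \<Rightarrow> ('v \<Rightarrow> 'b set) \<Rightarrow> ('v \<Rightarrow> 't set) \<Rightarrow> 'v \<Rightarrow> state" where
  "input_state eV eB eT V l B T value P s v =
     (let number = inv_into {..<card V} eV in
      (\<lambda>(x, i, j).
         if x = ''locations'' \<and> i = 0 \<and> j = 0 then card V
         else if x = ''passengers'' \<and> i = 0 \<and> j = 0 then card B
         else if x = ''taxis'' \<and> i = 0 \<and> j = 0 then card T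
         else if x = ''request'' \<and> i = 0 \<and> j = 0 then number v
         else if x = ''passenger_loc'' \<and> i < card B \<and> j = 0 then number (loc V P (eB i))
         else if x = ''taxi_loc'' \<and> i < card T \<and> j = 0 then number (loc V s (eT i))
         else 0,
       \<lambda>(x, i, j).
         if x = ''value'' \<and> i < card B \<and> j = 0 then value (eB i)
         else if x = ''distance'' \<and> i < card V \<and> j < card V then l (eV i) (eV j)
         else 0))"

text \<open>
  The number of locations does not enter into the time bound, so there is no time to
  write down the prices of all locations. The bound is on the time to find the price of any one
  location.
\<close>

definition computes_prices ::
  "com \<Rightarrow> nat poly \<Rightarrow> 'v set \<Rightarrow> ('v \<Rightarrow> 'v \<Rightarrow> real) \<Rightarrow> 'b set \<Rightarrow> 't set \<Rightarrow>
   ('b \<Rightarrow> real) \<Rightarrow> ('v \<Rightarrow> 'b set) \<Rightarrow> ('v \<Rightarrow> 't set) \<Rightarrow> ('v \<Rightarrow> real) \<Rightarrow> bool" where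
  "computes_prices prog q V l B T value P s r \<longleftrightarrow>
     (\<forall>eV eB eT. bij_betw eV {..<card V} V \<and> bij_betw eB {..<card B} B \<and> bij_betw eT {..<card T} T \<longrightarrow>
        (\<forall>v\<in>V. \<exists>k \<sigma>. exec prog (input_state eV eB eT V l B T value P s v) k \<sigma> \<and>
                     k \<le> poly q (card B + card T) \<and> snd \<sigma> (''price'', 0, 0) = r v))"

end

theory Submission
  imports Defs
begin

text \<open>
  Let \<open>p\<close> be minimal Walrasian prices. The surge prices \<open>r\<close> are 1-Lipschitz, and a taxicab that
  moves from \<open>u\<close> to \<open>v\<close> satisfies \<open>r v = r u + l u v\<close>. Hence \<open>r\<close> is an optimal dual solution of the
  flow problem, and complementary slackness makes every minimum cost flow tight, which gives the
  equilibrium. The same duality bounds the social welfare of any supply by that of \<open>s'\<close>.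

  A passenger who gains from a taxicab under a false report still demands it under the truth at
  the prices of the false report. Those prices are therefore Walrasian for the true market as well,
  and minimality shows that the truthful surge price is no higher.

  The prices are computed by inserting the taxicabs one at a time. Prices are lowered, in the manner
  of Dijkstra's algorithm, until every item is anchored: its price is held up by an indifferent buyer
  whose own item was anchored before. A new item displaces matches along a chain of anchors. When all
  items are anchored, the prices are minimal.
\<close>

section \<open>Walrasian prices\<close>

text \<open>The definitions leave three freedoms that shape the proof. Optimal allocations are not
  unique; but Walrasian prices support every optimal allocation, so minimal prices do not depend on
  the choice. Served passengers need not be the allocated ones, since ties at value
  \<open>r v\<close> are broken arbitrarily; an exchange among passengers with utility 0 repairs
  this before the truthfulness argument. A minimum cost flow need not be the one carried out, so its
  tightness has to follow from its cost alone.

  The existence of minimal Walrasian prices is read off from a run of the program. Taxicabs are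
  inserted rather than passengers because, once all old items are anchored, the highest bid for the
  new one starts a chain of indifferent buyers along falling levels. Such a chain must end at item
  0, that is, at an unmatched buyer or at the dummy, so the augmenting path is known without a
  further search. Sums, differences and comparisons of input numbers suffice throughout, which is
  all that the program language offers.\<close>

definition sold :: "'b set \<Rightarrow> ('b \<Rightarrow> 't option) \<Rightarrow> 't set" where
  "sold B a = {t. \<exists>b\<in>B. a b = Some t}"

text \<open>Payments cancel between the buyers and the sold items, whatever the prices are.\<close>

lemma allocation_welfare_eq:
  assumes "finite B" "allocation B T a"
  shows "allocation_welfare B val a = (\<Sum>b\<in>B. buyer_utility val p b (a b)) + (\<Sum>t\<in>sold B a. p t)"
proof -
  let ?A = "{b\<in>B. a b \<noteq> None}"
  have "inj_on (\<lambda>b. the (a b)) ?A"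
    using assms(2) unfolding allocation_def inj_on_def by force
  moreover have "(\<lambda>b. the (a b)) ` ?A = sold B a"
    unfolding sold_def by force
  ultimately have "(\<Sum>t\<in>sold B a. p t) = (\<Sum>b\<in>?A. p (the (a b)))"
    using sum.reindex[of "\<lambda>b. the (a b)" ?A p] by simp
  also have "\<dots> = (\<Sum>b\<in>B. if a b \<noteq> None then p (the (a b)) else 0)"
    using assms(1) by (rule sum.inter_filter)
  also have "(\<Sum>b\<in>B. buyer_utility val p b (a b)) + \<dots> = allocation_welfare B val a"
    unfolding allocation_welfare_def sum.distrib[symmetric]
    by (rule sum.cong) (auto simp: buyer_utility_def split: option.split)
  finally show ?thesis by simp
qed

text \<open>Items unsold under \<open>a\<close> cost 0, so the revenue of \<open>a\<close> is the
  total price of \<open>T\<close>. The gap thereby becomes a sum of terms that are nonnegative one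
  by one. Their sign shows that \<open>a\<close> is optimal; their vanishing, when \<open>a'\<close>
  is optimal too, is complementary slackness.\<close>

lemma walrasian_welfare_gap:
  assumes fin: "finite B" "finite T" and wal: "walrasian_prices B T val a p" and al: "allocation B T a'"
  shows "allocation_welfare B val a - allocation_welfare B val a' =
    (\<Sum>b\<in>B. buyer_utility val p b (a b) - buyer_utility val p b (a' b)) + (\<Sum>t\<in>T - sold B a'. p t)"
proof -
  have sub: "sold B a \<subseteq> T" "sold B a' \<subseteq> T"
    using wal al by (auto simp: sold_def walrasian_prices_def allocation_def)
  have "(\<Sum>t\<in>sold B a. p t) = (\<Sum>t\<in>T. p t)"
    using wal sub fin by (intro sum.mono_neutral_left) (auto simp: sold_def walrasian_prices_def)
  also have "\<dots> = (\<Sum>t\<in>T - sold B a'. p t) + (\<Sum>t\<in>sold B a'. p t)"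
    using sub(2) fin(2) by (rule sum.subset_diff)
  finally show ?thesis
    using allocation_welfare_eq[OF fin(1) al, of val p] wal
      allocation_welfare_eq[OF fin(1), of T a val p]
    by (simp add: walrasian_prices_def sum_subtractf)
qed

lemma walrasian_gap_nonneg:
  assumes "walrasian_prices B T val a p" "allocation B T a'"
  shows "b \<in> B \<Longrightarrow> 0 \<le> buyer_utility val p b (a b) - buyer_utility val p b (a' b)"
    "t \<in> T - sold B a' \<Longrightarrow> 0 \<le> p t"
proof -
  show "0 \<le> buyer_utility val p b (a b) - buyer_utility val p b (a' b)" if "b \<in> B"
  proof -
    have "a' b \<in> insert None (Some ` T)"
      using assms(2) that by (cases "a' b") (auto simp: allocation_def)
    then show ?thesis
      using assms(1) that by (auto simp: walrasian_prices_def)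
  qed
qed (use assms in \<open>auto simp: walrasian_prices_def\<close>)

lemma walrasian_welfare_maximizing:
  assumes "finite B" "finite T" "walrasian_prices B T val a p"
  shows "welfare_maximizing_allocation B T val a"
  unfolding welfare_maximizing_allocation_def
proof (intro conjI allI impI)
  show "allocation B T a"
    using assms(3) by (simp add: walrasian_prices_def)
  fix a' assume "allocation B T a'"
  note walrasian_welfare_gap[OF assms this] walrasian_gap_nonneg[OF assms(3) this]
  then show "allocation_welfare B val a' \<le> allocation_welfare B val a"
    using sum_nonneg[of B "\<lambda>b. buyer_utility val p b (a b) - buyer_utility val p b (a' b)"]
      sum_nonneg[of "T - sold B a'" p] by simp
qed

text \<open>A gap of 0 makes every term in it vanish: each buyer is as well off under
  \<open>a'\<close>, and whatever \<open>a'\<close> leaves unsold is free. Consequently minimal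
  prices for different optimal allocations agree.\<close>

lemma walrasian_change_allocation:
  assumes fin: "finite B" "finite T" and wal: "walrasian_prices B T val a p"
    and opt: "welfare_maximizing_allocation B T val a'"
  shows "walrasian_prices B T val a' p"
proof -
  have al: "allocation B T a'" "allocation B T a"
    using opt wal by (auto simp: welfare_maximizing_allocation_def walrasian_prices_def)
  let ?gap = "\<lambda>b. buyer_utility val p b (a b) - buyer_utility val p b (a' b)"
  note nonneg = walrasian_gap_nonneg[OF wal al(1)]
  have "(\<Sum>b\<in>B. ?gap b) + (\<Sum>t\<in>T - sold B a'. p t) \<le> 0"
    using walrasian_welfare_gap[OF fin wal al(1)] opt al(2)
    by (auto simp: welfare_maximizing_allocation_def)
  moreover have "0 \<le> (\<Sum>b\<in>B. ?gap b)" "0 \<le> (\<Sum>t\<in>T - sold B a'. p t)"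
    using nonneg by (auto intro!: sum_nonneg)
  ultimately have "(\<Sum>b\<in>B. ?gap b) = 0" "(\<Sum>t\<in>T - sold B a'. p t) = 0"
    by linarith+
  then have gap: "?gap b = 0" if "b \<in> B" for b
    using sum_nonneg_eq_0_iff[OF fin(1), of ?gap] nonneg(1) that by blast
  have unsold: "p t = 0" if "t \<in> T - sold B a'" for t
    using sum_nonneg_eq_0_iff[of "T - sold B a'" p] fin(2) nonneg(2) that
      \<open>(\<Sum>t\<in>T - sold B a'. p t) = 0\<close> by blast
  show ?thesis
    using wal al(1) gap unsold unfolding walrasian_prices_def sold_def by auto
qed

section \<open>Locations, flows and sets of served passengers\<close>

lemma loc_props:
  assumes "distribution V X A"
  shows "x \<in> X \<Longrightarrow> loc V A x \<in> V" "x \<in> X \<Longrightarrow> x \<in> A (loc V A x)"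
    "v \<in> V \<Longrightarrow> x \<in> A v \<Longrightarrow> loc V A x = v" "v \<in> V \<Longrightarrow> A v \<subseteq> X"
proof -
  have unique: "u = v" if "u \<in> V" "v \<in> V" "x \<in> A u" "x \<in> A v" for u v x
    using assms that unfolding distribution_def disjoint_family_on_def by blast
  then show loc: "loc V A x = v" if "v \<in> V" "x \<in> A v" for v x
    unfolding loc_def using that by (intro the_equality) auto
  show "v \<in> V \<Longrightarrow> A v \<subseteq> X"
    using assms unfolding distribution_def by auto
  assume "x \<in> X"
  then obtain v where "v \<in> V" "x \<in> A v"
    using assms unfolding distribution_def by auto
  then show "loc V A x \<in> V" "x \<in> A (loc V A x)"
    using loc by auto
qed

lemma distribution_sum_card:
  assumes "distribution V X A" "finite V" "finite X" "S \<subseteq> X"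
  shows "(\<Sum>v\<in>V. card (S \<inter> A v)) = card S"
proof -
  have "card (\<Union>v\<in>V. S \<inter> A v) = (\<Sum>v\<in>V. card (S \<inter> A v))"
    using assms unfolding distribution_def disjoint_family_on_def
    by (intro card_UN_disjoint) (auto intro: finite_subset[of _ X])
  moreover have "(\<Union>v\<in>V. S \<inter> A v) = S"
    using assms unfolding distribution_def by auto
  ultimately show ?thesis by simp
qed

text \<open>Counting the taxicabs that go from \<open>u\<close> to \<open>v\<close> gives a flow, so
  the infimum in \<open>em\<close> is over a nonempty set. For the moved supply this flow turns out
  to be optimal.\<close>

lemma overlap_flow:
  assumes "distribution V T s" "distribution V T s'" "finite V" "finite T"
  shows "is_flow V s s' (\<lambda>u v. card (s u \<inter> s' v))"
  unfolding is_flow_def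
proof (intro conjI ballI)
  show "(\<Sum>v\<in>V. card (s u \<inter> s' v)) = card (s u)" if "u \<in> V" for u
    using assms loc_props(4)[OF assms(1) that] by (intro distribution_sum_card)
  have "(\<Sum>u\<in>V. card (s' v \<inter> s u)) = card (s' v)" if "v \<in> V" for v
    using assms loc_props(4)[OF assms(2) that] by (intro distribution_sum_card)
  then show "(\<Sum>u\<in>V. card (s u \<inter> s' v)) = card (s' v)" if "v \<in> V" for v
    using that by (simp add: Int_commute)
qed

lemma top_subset_exists:
  fixes f :: "'b \<Rightarrow> real"
  assumes "finite D" "k \<le> card D"
  shows "\<exists>S\<subseteq>D. card S = k \<and> (\<forall>b\<in>S. \<forall>b'\<in>D - S. f b' \<le> f b)"
  using assms(2)
proof (induction k)
  case (Suc k)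
  then obtain S where S: "S \<subseteq> D" "card S = k" "\<forall>b\<in>S. \<forall>b'\<in>D - S. f b' \<le> f b"
    by auto
  have fin: "finite (D - S)" "finite S"
    using assms(1) S(1) by (auto intro: finite_subset)
  have "D - S \<noteq> {}"
    using S Suc.prems card_mono[OF fin(2), of D] by auto
  then have "Max (f ` (D - S)) \<in> f ` (D - S)"
    using fin(1) by (intro Max_in) auto
  then obtain b where b: "b \<in> D - S" "f b = Max (f ` (D - S))"
    by auto
  then have "\<forall>b'\<in>D - S. f b' \<le> f b"
    using fin(1) by simp
  then show ?case
    using S b(1) fin by (intro exI[of _ "insert b S"]) auto
qed auto

text \<open>\<open>dsv\<close> selects a served set with \<open>SOME\<close>, so bounding it
  requires that such a set exists for every competing supply.\<close>

lemma demand_served_exists: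
  assumes "\<And>v. v \<in> V \<Longrightarrow> finite (d v (r v))"
  shows "\<exists>S. demand_served V s' d r value S"
proof -
  have "\<exists>S. served_at s' d r value v S" if "v \<in> V" for v
  proof (cases "card (d v (r v)) \<le> card (s' v)")
    case False
    then show ?thesis
      using top_subset_exists[OF assms[OF that], of "card (s' v)" "value"]
      unfolding served_at_def by auto
  qed (auto simp: served_at_def)
  then show ?thesis
    unfolding demand_served_def by metis
qed

lemma served_at_subset: "served_at s' d r value v S \<Longrightarrow> S \<subseteq> d v (r v)"
  by (auto simp: served_at_def split: if_splits)

lemma served_at_card: "served_at s' d r value v S \<Longrightarrow> card S = min (card (d v (r v))) (card (s' v))"
  by (auto simp: served_at_def split: if_splits)

section \<open>Equilibrium and social welfare\<close>

text \<open>Stated for arbitrary Walrasian prices, because it is instantiated for the true report,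
  for a false one, and with a second allocation at the same prices.\<close>

locale priced_taxi_market =
  fixes V :: "'v set" and l :: "'v \<Rightarrow> 'v \<Rightarrow> real" and B :: "'b set" and T :: "'t set"
    and val :: "'b \<Rightarrow> real" and P :: "'v \<Rightarrow> 'b set" and s :: "'v \<Rightarrow> 't set"
    and a :: "'b \<Rightarrow> 't option" and p :: "'t \<Rightarrow> real" and r :: "'v \<Rightarrow> real" and s' :: "'v \<Rightarrow> 't set"
  assumes setting: "taxi_setting V l B T val P s"
    and walrasian: "walrasian_prices B T (taxi_market_value V l val P s) a p"
    and surge: "\<And>v. v \<in> V \<Longrightarrow> r v = (MIN t\<in>T. l (loc V s t) v + p t)"
    and moved: "\<And>v. v \<in> V \<Longrightarrow> s' v = moved_supply B T P s a v"
begin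

lemma finite_sets: "finite V" "finite B" "finite T" and taxis: "T \<noteq> {}"
  and metric: "Metric_space V l" and profile: "distribution V B P" and taxis_at: "distribution V T s"
  using setting by (auto simp: taxi_setting_def)

lemmas passenger_loc = loc_props[OF profile] and taxi_loc = loc_props[OF taxis_at]

lemma triangle: "u \<in> V \<Longrightarrow> v \<in> V \<Longrightarrow> w \<in> V \<Longrightarrow> l u w \<le> l u v + l v w"
  and dist_self: "v \<in> V \<Longrightarrow> l v v = 0"
  using Metric_space.triangle[OF metric] Metric_space.mdist_zero[OF metric] by auto

lemma dist_nonneg: "0 \<le> l u v"
  and dist_sym: "l u v = l v u"
  using metric by (auto simp: Metric_space_def)

lemma price_nonneg: "t \<in> T \<Longrightarrow> 0 \<le> p t"
  and allocated_taxi: "b \<in> B \<Longrightarrow> a b = Some t \<Longrightarrow> t \<in> T"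
  and allocated_unique: "b \<in> B \<Longrightarrow> b' \<in> B \<Longrightarrow> a b = Some t \<Longrightarrow> a b' = Some t \<Longrightarrow> b = b'"
  and unsold_price: "t \<in> T \<Longrightarrow> (\<And>b. b \<in> B \<Longrightarrow> a b \<noteq> Some t) \<Longrightarrow> p t = 0"
  using walrasian unfolding walrasian_prices_def allocation_def by blast+

section \<open>Surge prices as a lower envelope of distances\<close>

lemma surge_le: "t \<in> T \<Longrightarrow> v \<in> V \<Longrightarrow> r v \<le> l (loc V s t) v + p t"
  using surge finite_sets(3) by simp

lemma surge_attained:
  assumes "v \<in> V"
  obtains t where "t \<in> T" "r v = l (loc V s t) v + p t"
proof -
  have "(MIN t\<in>T. l (loc V s t) v + p t) \<in> (\<lambda>t. l (loc V s t) v + p t) ` T"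
    using finite_sets(3) taxis by (intro Min_in) auto
  then show thesis
    using that surge[OF assms] by auto
qed

lemma surge_nonneg:
  assumes "v \<in> V"
  shows "0 \<le> r v"
  using surge_attained[OF assms] price_nonneg dist_nonneg by (metis add_nonneg_nonneg)

text \<open>As functions of \<open>v\<close>, the offers \<open>l (loc V s t) v + p t\<close> are
  1-Lipschitz by the triangle inequality, and so is their minimum: the taxicab that attains
  \<open>r u\<close> is available at \<open>v\<close> as well.\<close>

lemma surge_lipschitz:
  assumes "u \<in> V" "v \<in> V"
  shows "r v \<le> r u + l u v"
proof -
  obtain t where t: "t \<in> T" "r u = l (loc V s t) u + p t"
    using surge_attained[OF assms(1)] .
  then show ?thesis
    using surge_le[OF t(1) assms(2)] triangle[of "loc V s t" u v] taxi_loc(1) assms by fastforce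
qed

lemma surge_le_price:
  assumes "t \<in> T"
  shows "r (loc V s t) \<le> p t"
  using surge_le[OF assms taxi_loc(1)[OF assms]] dist_self taxi_loc(1)[OF assms] by simp

lemma buyer_utility_Some:
  "buyer_utility (taxi_market_value V l val P s) p b (Some t) =
     val b - (l (loc V s t) (loc V P b) + p t)"
  using dist_sym[of "loc V P b"] by (simp add: buyer_utility_def taxi_market_value_def)

lemma utility_optimal:
  assumes "b \<in> B"
  shows "0 \<le> buyer_utility (taxi_market_value V l val P s) p b (a b)"
    "t \<in> T \<Longrightarrow> val b - (l (loc V s t) (loc V P b) + p t) \<le>
      buyer_utility (taxi_market_value V l val P s) p b (a b)"
proof -
  let ?u = "buyer_utility (taxi_market_value V l val P s) p b"
  have "?u x \<le> ?u (a b)" if "x \<in> insert None (Some ` T)" for x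
    using walrasian assms that unfolding walrasian_prices_def by blast
  from this[of None] this[of "Some t" for t]
  show "0 \<le> ?u (a b)" "t \<in> T \<Longrightarrow> val b - (l (loc V s t) (loc V P b) + p t) \<le> ?u (a b)"
    by (auto simp: buyer_utility_Some) (simp add: buyer_utility_def)
qed

text \<open>The value of a passenger enters its utility from every taxicab as the same additive
  term, so its favourite taxicab minimizes distance plus price. This is the minimum that defines
  \<open>r\<close> at its location.\<close>

lemma allocated_surge:
  assumes "b \<in> B" "a b = Some t"
  shows "r (loc V P b) = l (loc V s t) (loc V P b) + p t" "r (loc V P b) \<le> val b"
proof -
  have t: "t \<in> T" and v: "loc V P b \<in> V"
    using allocated_taxi[OF assms] passenger_loc(1)[OF assms(1)] .
  note u = utility_optimal[OF assms(1), unfolded assms(2) buyer_utility_Some]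
  obtain t' where t': "t' \<in> T" "r (loc V P b) = l (loc V s t') (loc V P b) + p t'"
    using surge_attained[OF v] .
  show "r (loc V P b) = l (loc V s t) (loc V P b) + p t"
    using u(2)[OF t'(1)] t'(2) surge_le[OF t v] by simp
  then show "r (loc V P b) \<le> val b"
    using u(1) by simp
qed

lemma unallocated_surge:
  assumes "b \<in> B" "a b = None"
  shows "val b \<le> r (loc V P b)"
proof -
  obtain t' where t': "t' \<in> T" "r (loc V P b) = l (loc V s t') (loc V P b) + p t'"
    using surge_attained[OF passenger_loc(1)[OF assms(1)]] .
  then show ?thesis
    using utility_optimal(2)[OF assms(1) t'(1)] assms(2) by (simp add: buyer_utility_def)
qed

text \<open>Presents \<open>moved_supply\<close> as the fibres of a function on taxicabs, which
  makes disjointness and coverage immediate.\<close>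

definition destination :: "'t \<Rightarrow> 'v" where
  "destination t =
     (if \<exists>b\<in>B. a b = Some t then loc V P (THE b. b \<in> B \<and> a b = Some t) else loc V s t)"

lemma destination_sold: "b \<in> B \<Longrightarrow> a b = Some t \<Longrightarrow> destination t = loc V P b"
proof -
  assume b: "b \<in> B" "a b = Some t"
  then have "(THE b. b \<in> B \<and> a b = Some t) = b"
    using allocated_unique by (intro the_equality) auto
  then show ?thesis
    using b by (auto simp: destination_def)
qed

lemma destination_unsold: "(\<And>b. b \<in> B \<Longrightarrow> a b \<noteq> Some t) \<Longrightarrow> destination t = loc V s t"
  by (auto simp: destination_def)

lemma destination_in: "t \<in> T \<Longrightarrow> destination t \<in> V"
  by (metis destination_sold destination_unsold passenger_loc(1) taxi_loc(1))

lemma moved_iff: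
  assumes "v \<in> V"
  shows "t \<in> s' v \<longleftrightarrow> t \<in> T \<and> destination t = v"
proof (cases "\<exists>b\<in>B. a b = Some t")
  case True
  then obtain b where b: "b \<in> B" "a b = Some t" by auto
  then have "(\<exists>b\<in>B. a b = Some t \<and> b \<in> P v) \<longleftrightarrow> b \<in> P v"
    using allocated_unique by blast
  then show ?thesis
    using b destination_sold[OF b] passenger_loc(2)[OF b(1)] passenger_loc(3)[OF assms]
    by (auto simp: moved[OF assms] moved_supply_def)
next
  case False
  then have "destination t = loc V s t"
    by (intro destination_unsold) auto
  then show ?thesis
    using False taxi_loc(2) taxi_loc(3)[OF assms] by (auto simp: moved[OF assms] moved_supply_def)
qed

lemma distribution_moved: "distribution V T s'"
  using destination_in unfolding distribution_def disjoint_family_on_def by (auto simp: moved_iff)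

text \<open>For a sold taxicab, the surge at the destination is the distance plus its own price, and
  that price is at least the surge where it starts; an unsold one stays. With the Lipschitz bound
  every move is tight.\<close>

lemma destination_tight:
  assumes "t \<in> T"
  shows "r (loc V s t) + l (loc V s t) (destination t) \<le> r (destination t)"
proof (cases "\<exists>b\<in>B. a b = Some t")
  case True
  then obtain b where b: "b \<in> B" "a b = Some t" by auto
  then show ?thesis
    using allocated_surge(1)[OF b] destination_sold[OF b] surge_le_price[OF assms] by simp
next
  case False
  then have "destination t = loc V s t"
    by (intro destination_unsold) auto
  then show ?thesis
    using dist_self[OF taxi_loc(1)[OF assms]] by simp
qed

text \<open>The dual objective of the transport problem from \<open>s\<close> to \<open>s''\<close>,
  with \<open>r\<close> as node potentials.\<close>

definition potential :: "('v \<Rightarrow> 't set) \<Rightarrow> real" where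
  "potential s'' = (\<Sum>v\<in>V. real (card (s'' v)) * r v) - (\<Sum>u\<in>V. real (card (s u)) * r u)"

text \<open>Flow conservation turns both sums over locations into sums over edges. The duality gap
  is then the total reduced cost, which the Lipschitz bound keeps nonnegative edge by edge.\<close>

lemma flow_cost_potential:
  assumes "is_flow V s s'' f"
  shows "flow_cost V l f - potential s'' = (\<Sum>u\<in>V. \<Sum>v\<in>V. real (f u v) * (l u v - (r v - r u)))"
proof -
  have in_flow: "real (card (s'' v)) = (\<Sum>u\<in>V. real (f u v))" if "v \<in> V" for v
    using assms that unfolding is_flow_def by (metis of_nat_sum)
  have out_flow: "real (card (s u)) = (\<Sum>v\<in>V. real (f u v))" if "u \<in> V" for u
    using assms that unfolding is_flow_def by (metis of_nat_sum)
  have "(\<Sum>v\<in>V. real (card (s'' v)) * r v) = (\<Sum>v\<in>V. \<Sum>u\<in>V. real (f u v) * r v)"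
    by (intro sum.cong) (simp_all add: in_flow sum_distrib_right)
  also have "\<dots> = (\<Sum>u\<in>V. \<Sum>v\<in>V. real (f u v) * r v)"
    by (rule sum.swap)
  finally have a: "(\<Sum>v\<in>V. real (card (s'' v)) * r v) = (\<Sum>u\<in>V. \<Sum>v\<in>V. real (f u v) * r v)" .
  have b: "(\<Sum>u\<in>V. real (card (s u)) * r u) = (\<Sum>u\<in>V. \<Sum>v\<in>V. real (f u v) * r u)"
    by (intro sum.cong) (simp_all add: out_flow sum_distrib_right)
  show ?thesis
    unfolding potential_def a b flow_cost_def sum_subtractf[symmetric]
    by (intro sum.cong refl) (simp add: algebra_simps)
qed

lemma reduced_cost_nonneg: "u \<in> V \<Longrightarrow> v \<in> V \<Longrightarrow> 0 \<le> real (f u v) * (l u v - (r v - r u))"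
  using surge_lipschitz[of u v] by simp

lemma total_reduced_cost_nonneg: "0 \<le> (\<Sum>u\<in>V. \<Sum>v\<in>V. real (f u v) * (l u v - (r v - r u)))"
  by (intro sum_nonneg reduced_cost_nonneg)

lemma potential_le_flow_cost: "is_flow V s s'' f \<Longrightarrow> potential s'' \<le> flow_cost V l f"
  using flow_cost_potential[of s'' f] total_reduced_cost_nonneg[of f]
  by simp

lemma moved_flow_cost: "flow_cost V l (\<lambda>u v. card (s u \<inter> s' v)) \<le> potential s'"
proof -
  have "real (card (s u \<inter> s' v)) * (l u v - (r v - r u)) \<le> 0" if uv: "u \<in> V" "v \<in> V" for u v
  proof (cases "s u \<inter> s' v = {}")
    case False
    then obtain t where "t \<in> s u" "t \<in> T" "destination t = v"
      using moved_iff[OF uv(2)] by auto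
    then have "l u v - (r v - r u) \<le> 0"
      using destination_tight[of t] taxi_loc(3)[OF uv(1)] by simp
    then show ?thesis
      by (simp add: mult_nonneg_nonpos)
  qed simp
  then have "(\<Sum>u\<in>V. \<Sum>v\<in>V. real (card (s u \<inter> s' v)) * (l u v - (r v - r u))) \<le> 0"
    by (intro sum_nonpos) auto
  then show ?thesis
    using flow_cost_potential[OF overlap_flow[OF taxis_at distribution_moved finite_sets(1,3)]] by simp
qed

text \<open>The moves carried out attain the dual bound, hence an arbitrary optimal flow attains it
  too and has reduced cost 0 on every edge that it uses.\<close>

lemma min_cost_flow_tight:
  assumes f: "min_cost_flow V l s s' f" and uv: "u \<in> V" "v \<in> V" "0 < f u v"
  shows "r v = r u + l u v"
proof -
  have flow: "is_flow V s s' f"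
    using f by (simp add: min_cost_flow_def)
  have "flow_cost V l f \<le> potential s'"
    using f moved_flow_cost overlap_flow[OF taxis_at distribution_moved finite_sets(1,3)]
    unfolding min_cost_flow_def by force
  then have "(\<Sum>u\<in>V. \<Sum>v\<in>V. real (f u v) * (l u v - (r v - r u))) = 0"
    using flow_cost_potential[OF flow] total_reduced_cost_nonneg[of f] by simp
  moreover have row: "0 \<le> (\<Sum>v\<in>V. real (f u v) * (l u v - (r v - r u)))" if "u \<in> V" for u
    using that by (intro sum_nonneg reduced_cost_nonneg)
  ultimately have "(\<Sum>v\<in>V. real (f u v) * (l u v - (r v - r u))) = 0"
    using sum_nonneg_eq_0_iff[OF finite_sets(1), of "\<lambda>u. \<Sum>v\<in>V. real (f u v) * (l u v - (r v - r u))"]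
      row uv(1) by blast
  then have "real (f u v) * (l u v - (r v - r u)) = 0"
    using sum_nonneg_eq_0_iff[OF finite_sets(1), of "\<lambda>v. real (f u v) * (l u v - (r v - r u))"]
      reduced_cost_nonneg[OF uv(1)] uv(2) by blast
  then show ?thesis
    using uv(3) by simp
qed

text \<open>The bounds point in the directions of the welfare comparison: the cost of
  \<open>s'\<close> from above, the cost of a competitor from below.\<close>

lemma em_bounds:
  shows "em V l s s' \<le> potential s'"
    "distribution V T s'' \<Longrightarrow> potential s'' \<le> em V l s s''"
proof -
  let ?costs = "\<lambda>s''. {flow_cost V l f | f. is_flow V s s'' f}"
  have "bdd_below (?costs s')"
    using potential_le_flow_cost by (intro bdd_belowI[of _ "potential s'"]) auto
  then have "Inf (?costs s') \<le> flow_cost V l (\<lambda>u v. card (s u \<inter> s' v))"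
    using overlap_flow[OF taxis_at distribution_moved finite_sets(1,3)] by (intro cInf_lower) auto
  then show "em V l s s' \<le> potential s'"
    using moved_flow_cost by (simp add: em_def)
  show "potential s'' \<le> em V l s s''" if "distribution V T s''"
    unfolding em_def
    using overlap_flow[OF taxis_at that finite_sets(1,3)] potential_le_flow_cost
    by (intro cInf_greatest) auto
qed

section \<open>Supply, demand and served passengers at one location\<close>

abbreviation d :: "'v \<Rightarrow> real \<Rightarrow> 'b set" where
  "d \<equiv> demand P val"

text \<open>Need not be a served set: at value \<open>r v\<close> a tie may favour passengers that
  the allocation leaves out.\<close>

definition winners :: "'v \<Rightarrow> 'b set" where
  "winners v = {b \<in> P v. a b \<noteq> None}"

lemma finite_profile: "v \<in> V \<Longrightarrow> finite (P v)"
  using passenger_loc(4) finite_sets(2) by (auto intro: finite_subset)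

lemma finite_supply: "v \<in> V \<Longrightarrow> finite (s' v)"
  using loc_props(4)[OF distribution_moved] finite_sets(3) by (auto intro: finite_subset)

lemma finite_demand: "v \<in> V \<Longrightarrow> finite (d v x)"
  using finite_profile by (simp add: demand_def)

lemma winners_subset_demand:
  assumes "v \<in> V"
  shows "winners v \<subseteq> d v (r v)"
proof
  fix b assume b: "b \<in> winners v"
  then obtain t where "b \<in> B" "loc V P b = v" "a b = Some t"
    using passenger_loc(3,4)[OF assms] by (auto simp: winners_def)
  then show "b \<in> d v (r v)"
    using allocated_surge(2) b by (auto simp: demand_def winners_def)
qed

lemma eager_winners:
  assumes "v \<in> V"
  shows "{b \<in> P v. r v < val b} \<subseteq> winners v"
  using unallocated_surge passenger_loc(3,4)[OF assms] by (fastforce simp: winners_def)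

text \<open>A taxicab at \<open>v\<close> that belongs to no winner there is unsold and has never
  moved. Its price 0 then forces the surge at \<open>v\<close> down to 0.\<close>

lemma winners_taxis:
  assumes "v \<in> V"
  shows "inj_on (\<lambda>b. the (a b)) (winners v)" "(\<lambda>b. the (a b)) ` winners v \<subseteq> s' v"
    "t \<in> s' v - (\<lambda>b. the (a b)) ` winners v \<Longrightarrow>
      t \<in> T \<and> (\<forall>b\<in>B. a b \<noteq> Some t) \<and> loc V s t = v \<and> p t = 0 \<and> r v = 0"
proof -
  have P: "b \<in> B" "loc V P b = v" if "b \<in> P v" for b
    using passenger_loc(3,4)[OF assms] that by auto
  show "inj_on (\<lambda>b. the (a b)) (winners v)"
    unfolding inj_on_def winners_def using allocated_unique P(1) by force
  show "(\<lambda>b. the (a b)) ` winners v \<subseteq> s' v"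
    using allocated_taxi destination_sold P by (fastforce simp: winners_def moved_iff[OF assms])
  assume t: "t \<in> s' v - (\<lambda>b. the (a b)) ` winners v"
  have T: "t \<in> T" "destination t = v"
    using t by (auto simp: moved_iff[OF assms])
  have unsold: "a b \<noteq> Some t" if "b \<in> B" for b
  proof
    assume ab: "a b = Some t"
    then have "b \<in> winners v"
      using destination_sold[OF that ab] T(2) passenger_loc(2)[OF that] by (auto simp: winners_def)
    then have "t \<in> (\<lambda>b. the (a b)) ` winners v"
      using ab by (intro image_eqI[of _ _ b]) auto
    then show False
      using t by simp
  qed
  then have "loc V s t = v" "p t = 0"
    using destination_unsold[of t] T unsold_price[OF T(1)] by auto
  then show "t \<in> T \<and> (\<forall>b\<in>B. a b \<noteq> Some t) \<and> loc V s t = v \<and> p t = 0 \<and> r v = 0"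
    using surge_le_price[OF T(1)] surge_nonneg[OF assms] unsold T(1) by auto
qed

lemma card_winners:
  assumes "v \<in> V"
  shows "card (winners v) \<le> card (s' v)"
  using card_inj_on_le[OF winners_taxis(1,2)[OF assms] finite_supply[OF assms]] .

text \<open>Market clearing: where the surge is not 0, a taxicab is sure to find a passenger. Where
  it is 0, the service ratio is multiplied by 0, so the ratio never lowers the revenue at a location
  with supply.\<close>

lemma card_supply:
  assumes "v \<in> V" "r v \<noteq> 0"
  shows "card (s' v) \<le> card (d v (r v))"
proof -
  have "s' v \<subseteq> (\<lambda>b. the (a b)) ` winners v"
    using winners_taxis(3)[OF assms(1)] assms(2) by blast
  then have "card (s' v) \<le> card (winners v)"
    using surj_card_le finite_subset[OF winners_subset_demand[OF assms(1)] finite_demand[OF assms(1)]] by blast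
  also have "\<dots> \<le> card (d v (r v))"
    using winners_subset_demand[OF assms(1)] finite_demand[OF assms(1)] by (rule card_mono[rotated])
  finally show ?thesis .
qed

text \<open>If such a \<open>b\<close> were rejected, all served passengers would be valued at least
  as high and hence be winners too. Together with \<open>b\<close> there would be more winners than
  taxicabs.\<close>

lemma eager_served_at:
  assumes v: "v \<in> V" and S: "served_at s' d r val v S" and b: "b \<in> P v" "r v < val b"
  shows "b \<in> S"
proof (rule ccontr)
  assume "b \<notin> S"
  have bd: "b \<in> d v (r v)"
    using b by (simp add: demand_def)
  have "\<not> card (d v (r v)) \<le> card (s' v)"
    using S \<open>b \<notin> S\<close> bd by (auto simp: served_at_def)
  then have S': "S \<subseteq> d v (r v)" "card S = card (s' v)" "\<forall>b'\<in>S. val b \<le> val b'"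
    using S \<open>b \<notin> S\<close> bd unfolding served_at_def by auto
  have "insert b S \<subseteq> winners v"
    using S'(1,3) b eager_winners[OF v] by (fastforce simp: demand_def)
  moreover have "finite (winners v)"
    using finite_profile[OF v] by (simp add: winners_def)
  ultimately have "card (insert b S) \<le> card (winners v)"
    by (rule card_mono[rotated])
  moreover have "finite S"
    using S'(1) finite_demand[OF v] by (rule finite_subset)
  ultimately show False
    using \<open>b \<notin> S\<close> S'(2) card_winners[OF v] by simp
qed

lemma demand_servedE:
  assumes "demand_served V s'' d r val S" "b \<in> B"
  obtains S' where "served_at s'' d r val (loc V P b) S'" "b \<in> S \<longleftrightarrow> b \<in> S'"
proof -
  obtain S' where S': "\<And>v. v \<in> V \<Longrightarrow> served_at s'' d r val v (S' v)" "S = (\<Union>v\<in>V. S' v)"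
    using assms(1) by (auto simp: demand_served_def)
  have "b \<in> S' (loc V P b)" if "b \<in> S' v" "v \<in> V" for v
    using served_at_subset[OF S'(1)[OF that(2)]] passenger_loc(3)[OF that(2), of b] that
    by (auto simp: demand_def)
  then show thesis
    using that[of "S' (loc V P b)"] S' passenger_loc(1)[OF assms(2)] by blast
qed

lemma served_iff:
  assumes "demand_served V s' d r val S" "b \<in> B"
  shows "r (loc V P b) < val b \<Longrightarrow> b \<in> S" "b \<in> S \<Longrightarrow> r (loc V P b) \<le> val b"
proof -
  obtain S' where S': "served_at s' d r val (loc V P b) S'" "b \<in> S \<longleftrightarrow> b \<in> S'"
    using demand_servedE[OF assms] .
  show "b \<in> S" if "r (loc V P b) < val b"
    using eager_served_at[OF passenger_loc(1)[OF assms(2)] S'(1) passenger_loc(2)[OF assms(2)] that] S'(2) by simp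
  show "r (loc V P b) \<le> val b" if "b \<in> S"
    using served_at_subset[OF S'(1)] S'(2) that by (auto simp: demand_def)
qed

text \<open>A tight move leaves a taxicab from \<open>u\<close> exactly \<open>r u\<close>. An
  alternative \<open>w\<close> yields at most \<open>r w - l u w\<close>, also without supply at
  \<open>w\<close> since \<open>\<kappa> w \<le> 1\<close>, and the Lipschitz bound keeps this below
  \<open>r u\<close>.\<close>

lemma equilibrium:
  assumes \<kappa>: "\<And>v. v \<in> V \<Longrightarrow> \<kappa> v \<le> 1"
  shows "passenger_taxi_equilibrium \<kappa> V l B val P s s' d r"
proof -
  have ratio_le: "service_ratio \<kappa> s' d r w * r w \<le> r w" if "w \<in> V" for w
  proof -
    have "service_ratio \<kappa> s' d r w \<le> 1"
      using \<kappa>[OF that] by (simp add: service_ratio_def divide_le_eq_1)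
    then show ?thesis
      using mult_right_mono[OF _ surge_nonneg[OF that], of _ 1] by simp
  qed
  have best: "taxi_utility \<kappa> l s' r d u v = (MAX w\<in>V. taxi_utility \<kappa> l s' r d u w)"
    if f: "min_cost_flow V l s s' f" and uv: "u \<in> V" "v \<in> V" "0 < f u v" for f u v
  proof -
    have "is_flow V s s' f"
      using f by (simp add: min_cost_flow_def)
    then have "(\<Sum>u\<in>V. f u v) = card (s' v)"
      using uv(2) by (simp add: is_flow_def)
    \<comment> \<open>Positive flow into \<open>v\<close> excludes the 0/0 case there, so the
      utility of the chosen move does not involve \<open>\<kappa>\<close>.\<close>
    then have "0 < card (s' v)"
      using uv finite_sets(1) by (metis gr0I less_numeral_extra(3) sum_eq_0_iff)
    then have ratio: "service_ratio \<kappa> s' d r v * r v = r v"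
      using card_supply[OF uv(2)] by (cases "r v = 0") (auto simp: service_ratio_def)
    have "taxi_utility \<kappa> l s' r d u w \<le> taxi_utility \<kappa> l s' r d u v" if "w \<in> V" for w
      using ratio ratio_le[OF that] min_cost_flow_tight[OF f uv] surge_lipschitz[OF uv(1) that]
      unfolding taxi_utility_def by linarith
    then show ?thesis
      using finite_sets(1) uv(2) by (intro Max_eqI[symmetric]) auto
  qed
  show ?thesis
    unfolding passenger_taxi_equilibrium_def
    using best served_iff by (meson not_le)
qed

text \<open>The passengers' part of the dual objective. It depends on \<open>r\<close> but on no
  supply, so it cancels when supplies are compared.\<close>

definition surplus :: real where
  "surplus = (\<Sum>b\<in>B. max 0 (val b - r (loc V P b)))"

lemma local_surplus:
  assumes v: "v \<in> V" and S: "served_at s'' d r val v S"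
  shows "(\<Sum>b\<in>S. val b) \<le> (\<Sum>b\<in>P v. max 0 (val b - r v)) + real (card (s'' v)) * r v"
proof -
  have S': "S \<subseteq> P v" "finite S"
    using served_at_subset[OF S] finite_profile[OF v] by (auto simp: demand_def intro: finite_subset)
  have "(\<Sum>b\<in>S. val b) = (\<Sum>b\<in>S. val b - r v) + real (card S) * r v"
    by (simp add: sum_subtractf)
  also have "(\<Sum>b\<in>S. val b - r v) \<le> (\<Sum>b\<in>S. max 0 (val b - r v))"
    by (rule sum_mono) simp
  also have "\<dots> \<le> (\<Sum>b\<in>P v. max 0 (val b - r v))"
    using S' finite_profile[OF v] by (intro sum_mono2) auto
  also have "real (card S) * r v \<le> real (card (s'' v)) * r v"
    using served_at_card[OF S] surge_nonneg[OF v] by (intro mult_right_mono) auto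
  finally show ?thesis by simp
qed

text \<open>For \<open>s'\<close> both estimates of \<open>local_surplus\<close> are equalities:
  unserved passengers have no surplus, and taxicabs stay idle only where
  \<open>r v = 0\<close>.\<close>

lemma local_surplus_moved:
  assumes v: "v \<in> V" and S: "served_at s' d r val v S"
  shows "(\<Sum>b\<in>S. val b) = (\<Sum>b\<in>P v. max 0 (val b - r v)) + real (card (s' v)) * r v"
proof -
  have sub: "S \<subseteq> d v (r v)" "S \<subseteq> P v"
    using served_at_subset[OF S] by (auto simp: demand_def)
  have "(\<Sum>b\<in>S. val b) = (\<Sum>b\<in>S. val b - r v) + real (card S) * r v"
    by (simp add: sum_subtractf)
  also have "(\<Sum>b\<in>S. val b - r v) = (\<Sum>b\<in>S. max 0 (val b - r v))"
    using sub(1) by (intro sum.cong) (auto simp: demand_def)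
  also have "\<dots> = (\<Sum>b\<in>P v. max 0 (val b - r v))"
  proof (rule sum.mono_neutral_left)
    show "\<forall>b\<in>P v - S. max 0 (val b - r v) = 0"
      using eager_served_at[OF v S] by (force simp: max_def)
  qed (use sub finite_profile[OF v] in auto)
  also have "real (card S) * r v = real (card (s' v)) * r v"
    using served_at_card[OF S] card_supply[OF v] by (cases "r v = 0") auto
  finally show ?thesis .
qed

lemma sum_by_location:
  fixes g :: "'b \<Rightarrow> real"
  assumes "\<And>v. v \<in> V \<Longrightarrow> A v \<subseteq> P v"
  shows "(\<Sum>b\<in>(\<Union>v\<in>V. A v). g b) = (\<Sum>v\<in>V. \<Sum>b\<in>A v. g b)"
proof (rule sum.UNION_disjoint)
  show "finite V"
    by (fact finite_sets(1))
  show "\<forall>v\<in>V. finite (A v)"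
    using assms finite_profile by (auto intro: finite_subset)
  show "\<forall>u\<in>V. \<forall>v\<in>V. u \<noteq> v \<longrightarrow> A u \<inter> A v = {}"
  proof (intro ballI impI)
    fix u v assume uv: "u \<in> V" "v \<in> V" "u \<noteq> v"
    then show "A u \<inter> A v = {}"
      using passenger_loc(3)[OF uv(1)] passenger_loc(3)[OF uv(2)] assms[OF uv(1)] assms[OF uv(2)] by fast
  qed
qed

lemma surplus_by_location: "surplus = (\<Sum>v\<in>V. \<Sum>b\<in>P v. max 0 (val b - r v))"
proof -
  have "surplus = (\<Sum>b\<in>(\<Union>v\<in>V. P v). max 0 (val b - r (loc V P b)))"
    using profile by (simp add: surplus_def distribution_def)
  also have "\<dots> = (\<Sum>v\<in>V. \<Sum>b\<in>P v. max 0 (val b - r (loc V P b)))"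
    by (rule sum_by_location) simp
  also have "\<dots> = (\<Sum>v\<in>V. \<Sum>b\<in>P v. max 0 (val b - r v))"
    using passenger_loc(3) by (intro sum.cong) auto
  finally show ?thesis .
qed

lemma demand_served_surplus:
  shows "demand_served V s'' d r val S \<Longrightarrow> sum val S \<le> surplus + (\<Sum>v\<in>V. real (card (s'' v)) * r v)"
    "demand_served V s' d r val S \<Longrightarrow> sum val S = surplus + (\<Sum>v\<in>V. real (card (s' v)) * r v)"
proof -
  have split: "sum val S = (\<Sum>v\<in>V. sum val (S' v))"
    if "\<forall>v\<in>V. served_at s'' d r val v (S' v)" "S = (\<Union>v\<in>V. S' v)" for S' s''
    unfolding that(2) using that(1) served_at_subset[of s'' d r val]
    by (intro sum_by_location) (fastforce simp: demand_def)
  show "sum val S \<le> surplus + (\<Sum>v\<in>V. real (card (s'' v)) * r v)" if served: "demand_served V s'' d r val S"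
  proof -
    obtain S' where S': "\<forall>v\<in>V. served_at s'' d r val v (S' v)" "S = (\<Union>v\<in>V. S' v)"
      using served by (auto simp: demand_served_def)
    show ?thesis
      unfolding split[OF S'] surplus_by_location sum.distrib[symmetric]
      using S'(1) local_surplus by (intro sum_mono) auto
  qed
  show "sum val S = surplus + (\<Sum>v\<in>V. real (card (s' v)) * r v)" if served: "demand_served V s' d r val S"
  proof -
    obtain S' where S': "\<forall>v\<in>V. served_at s' d r val v (S' v)" "S = (\<Union>v\<in>V. S' v)"
      using served by (auto simp: demand_served_def)
    show ?thesis
      unfolding split[OF S'] surplus_by_location sum.distrib[symmetric]
      using S'(1) local_surplus_moved by (intro sum.cong) auto
  qed
qed

text \<open>The terms \<open>real (card (s'' v)) * r v\<close> in the served value and in the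
  potential cancel. What remains, \<open>surplus + (\<Sum>u\<in>V. real (card (s u)) * r u)\<close>,
  bounds the welfare of every supply and is attained by \<open>s'\<close>.\<close>

lemma welfare_maximizing: "welfare_maximizing_supply V l T val s s' r d"
  unfolding welfare_maximizing_supply_def
proof (intro conjI allI impI)
  have served: "demand_served V s'' d r val (SOME S. demand_served V s'' d r val S)" for s''
    using demand_served_exists[where V = V and d = d and r = r] finite_demand by (metis someI_ex)
  fix s'' assume "distribution V T s''"
  then show "social_welfare V l val s s'' r d \<le> social_welfare V l val s s' r d"
    using demand_served_surplus(1)[OF served, of s''] demand_served_surplus(2)[OF served] em_bounds
    unfolding social_welfare_def dsv_def potential_def by fastforce
qed (fact distribution_moved)

text \<open>Tie-breaking may serve a passenger whom \<open>a\<close> skips. Its value then equals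
  the surge price, so giving it a taxicab changes no utility and the prices stay Walrasian.\<close>

lemma served_allocatable:
  assumes served: "demand_served V s' d r val S" and b: "b \<in> B" "b \<in> S"
  obtains a' where "walrasian_prices B T (taxi_market_value V l val P s) a' p" "a' b \<noteq> None"
proof (cases "a b = None")
  case True
  define v where "v = loc V P b"
  let ?u = "buyer_utility (taxi_market_value V l val P s) p"
  have v: "v \<in> V" "b \<in> P v"
    using passenger_loc(1,2)[OF b(1)] by (auto simp: v_def)
  obtain S' where S': "served_at s' d r val v S'" "b \<in> S'"
    using demand_servedE[OF served b(1)] b(2) unfolding v_def by metis
  have bd: "b \<in> d v (r v)"
    using served_at_subset[OF S'(1)] S'(2) by auto
  then have vb: "val b = r v"
    using unallocated_surge[OF b(1) True] by (simp add: demand_def v_def)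
  have opt: "?u b' x \<le> ?u b' (a b')" if "b' \<in> B" "x \<in> insert None (Some ` T)" for b' x
    using walrasian that unfolding walrasian_prices_def by blast
  show thesis
  \<comment> \<open>If all winners are served along with \<open>b\<close>, there are more taxicabs
    than winners at \<open>v\<close> and one of them is unsold. Otherwise some unserved winner can
    pass its taxicab on to \<open>b\<close>.\<close>
  proof (cases "winners v \<subseteq> S'")
    case sub: True
    have "b \<notin> winners v"
      using True by (simp add: winners_def)
    moreover have "finite S'"
      using served_at_subset[OF S'(1)] finite_demand[OF v(1)] by (rule finite_subset)
    ultimately have "card (winners v) < card S'"
      using sub S'(2) by (intro psubset_card_mono) auto
    also have "\<dots> \<le> card (s' v)"
      using served_at_card[OF S'(1)] by simp
    finally have "card ((\<lambda>b. the (a b)) ` winners v) \<noteq> card (s' v)"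
      using card_image[OF winners_taxis(1)[OF v(1)]] by linarith
    then have "(\<lambda>b. the (a b)) ` winners v \<noteq> s' v"
      by metis
    then obtain t where "t \<in> s' v - (\<lambda>b. the (a b)) ` winners v"
      using winners_taxis(2)[OF v(1)] by blast
    note t = winners_taxis(3)[OF v(1) this]
    have u: "?u b (Some t) = ?u b (a b)"
      using t vb True dist_self[OF v(1)] unfolding buyer_utility_Some
      by (simp add: buyer_utility_def v_def)
    have "walrasian_prices B T (taxi_market_value V l val P s) (a(b := Some t)) p"
      unfolding walrasian_prices_def
    proof (intro conjI ballI impI)
      show "allocation B T (a(b := Some t))"
        unfolding allocation_def
      proof (intro conjI ballI allI impI)
        show "t' \<in> T" if "b' \<in> B" "(a(b := Some t)) b' = Some t'" for b' t'
          using that t allocated_taxi by (auto split: if_splits)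
        show "b1 = b2" if "b1 \<in> B" "b2 \<in> B" "(a(b := Some t)) b1 = Some t' \<and> (a(b := Some t)) b2 = Some t'" for b1 b2 t'
          using that t allocated_unique[of b1 b2 t'] by (auto split: if_splits)
      qed
      show "?u b' x \<le> ?u b' ((a(b := Some t)) b')" if "b' \<in> B" "x \<in> insert None (Some ` T)" for b' x
      proof -
        have "?u b' ((a(b := Some t)) b') = ?u b' (a b')"
          using u by (cases "b' = b") simp_all
        then show ?thesis
          using opt[OF that] by (simp only:)
      qed
      show "p t' = 0" if "t' \<in> T" "\<forall>b'\<in>B. (a(b := Some t)) b' \<noteq> Some t'" for t'
      proof (rule unsold_price)
        show "a b' \<noteq> Some t'" if "b' \<in> B" for b'
          using bspec[OF \<open>\<forall>b'\<in>B. (a(b := Some t)) b' \<noteq> Some t'\<close> that] True by (cases "b' = b") simp_all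
      qed (fact that(1))
    qed (rule price_nonneg)
    then show thesis
      by (rule that) simp
  next
    case False
    then obtain c where c: "c \<in> winners v" "c \<notin> S'"
      by auto
    then obtain t where t: "a c = Some t" "c \<in> P v"
      by (auto simp: winners_def)
    have cB: "c \<in> B" "loc V P c = v"
      using passenger_loc(3,4)[OF v(1)] t(2) by auto
    have "c \<in> d v (r v) - S'"
      using winners_subset_demand[OF v(1)] c by auto
    then have "val c \<le> val b" "r v \<le> val c"
      using S' by (auto simp: served_at_def demand_def split: if_splits)
    \<comment> \<open>\<open>c\<close> is in the demand but lost against \<open>b\<close>, so its
      value is squeezed between \<open>r v\<close> and \<open>val b = r v\<close>. Both passengers
      have utility 0 with or without the taxicab.\<close>
    then have vc: "val c = r v"
      using vb by simp
    have u: "?u b (Some t) = 0" "?u c (Some t) = 0"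
      using allocated_surge(1)[OF cB(1) t(1)] cB(2) vb vc unfolding buyer_utility_Some
      by (simp_all add: v_def)
    have zero: "?u b' None = 0" for b'
      by (simp add: buyer_utility_def)
    have "b \<noteq> c"
      using True t by auto
    let ?a = "a(b := Some t, c := None)"
    have "walrasian_prices B T (taxi_market_value V l val P s) ?a p"
      unfolding walrasian_prices_def
    proof (intro conjI ballI impI)
      show "allocation B T ?a"
        unfolding allocation_def
      proof (intro conjI ballI allI impI)
        show "t' \<in> T" if "b' \<in> B" "?a b' = Some t'" for b' t'
          using that(2) allocated_taxi[OF cB(1) t(1)] allocated_taxi[OF that(1), of t']
          by (simp split: if_splits)
        have keep: "b' = b \<and> t' = t \<or> a b' = Some t' \<and> b' \<noteq> c" if "?a b' = Some t'" for b' t'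
          using that by (simp split: if_splits)
        show "b1 = b2" if b12: "b1 \<in> B" "b2 \<in> B" "?a b1 = Some t' \<and> ?a b2 = Some t'" for b1 b2 t'
          using keep[of b1 t'] keep[of b2 t'] b12 allocated_unique[OF b12(1,2), of t']
            allocated_unique[OF cB(1) b12(1) t(1)] allocated_unique[OF cB(1) b12(2) t(1)] by metis
      qed
      show "?u b' x \<le> ?u b' (?a b')" if "b' \<in> B" "x \<in> insert None (Some ` T)" for b' x
      proof -
        have "?u b' (?a b') = ?u b' (a b')"
          using u zero True t(1) \<open>b \<noteq> c\<close> by (cases "b' = c"; cases "b' = b") simp_all
        then show ?thesis
          using opt[OF that] by (simp only:)
      qed
      show "p t' = 0" if "t' \<in> T" "\<forall>b'\<in>B. ?a b' \<noteq> Some t'" for t'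
      proof (rule unsold_price)
        show "a b' \<noteq> Some t'" if "b' \<in> B" for b'
        proof (cases "b' = c")
          case True
          then show ?thesis
            using bspec[OF \<open>\<forall>b'\<in>B. ?a b' \<noteq> Some t'\<close> b(1)] \<open>b \<noteq> c\<close> t(1) by simp
        next
          case False
          then show ?thesis
            using bspec[OF \<open>\<forall>b'\<in>B. ?a b' \<noteq> Some t'\<close> that] \<open>a b = None\<close> by (cases "b' = b") simp_all
        qed
      qed (fact that(1))
    qed (rule price_nonneg)
    then show thesis
      by (rule that) (use \<open>b \<noteq> c\<close> in simp)
  qed
qed (use walrasian in \<open>auto intro: that\<close>)

text \<open>
  A report only shifts all values of a passenger by the same amount, so a passenger who gains from
  a taxicab at the given prices demands the same taxicab under any other report.
\<close>

lemma walrasian_after_report: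
  assumes wal: "walrasian_prices B T (taxi_market_value V l val P s) a' p"
    and b: "b \<in> B" "a' b \<noteq> None" and gain: "r (loc V P b) < x"
  shows "walrasian_prices B T (taxi_market_value V l (val(b := x)) P s) a' p"
proof -
  \<comment> \<open>\<open>allocated_surge\<close> is needed for \<open>a'\<close>, while the locale
    fixes \<open>a\<close>; prices and surge prices are shared.\<close>
  interpret other: priced_taxi_market V l B T val P s a' p r "moved_supply B T P s a'"
    by unfold_locales (use setting wal surge in auto)
  obtain t where t: "a' b = Some t"
    using b(2) by auto
  let ?u = "buyer_utility (taxi_market_value V l (val(b := x)) P s) p"
  have u_b: "?u b (Some t') = x - (l (loc V s t') (loc V P b) + p t')" for t'
    using dist_sym[of "loc V P b"] by (simp add: buyer_utility_def taxi_market_value_def)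
  have "?u b y \<le> ?u b (a' b)" if "y \<in> insert None (Some ` T)" for y
  proof (cases y)
    case None
    then show ?thesis
      using other.allocated_surge(1)[OF b(1) t] gain unfolding t u_b by (simp add: buyer_utility_def)
  next
    case (Some t')
    then have "t' \<in> T"
      using that by auto
    from surge_le[OF this passenger_loc(1)[OF b(1)]] show ?thesis
      using other.allocated_surge(1)[OF b(1) t] unfolding t u_b Some by simp
  qed
  moreover have "?u b' = buyer_utility (taxi_market_value V l val P s) p b'" if "b' \<noteq> b" for b'
    using that by (simp add: buyer_utility_def taxi_market_value_def fun_eq_iff split: option.split)
  ultimately have "?u b' y \<le> ?u b' (a' b')" if "b' \<in> B" "y \<in> insert None (Some ` T)" for b' y
    using wal that unfolding walrasian_prices_def by (cases "b' = b") auto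
  then show ?thesis
    using wal unfolding walrasian_prices_def by simp
qed

end

section \<open>Comparing the true report with a false one\<close>

lemma surge_outcomeE:
  assumes "taxi_setting V l B T val P s" "surge_outcome V l B T val P s r s'"
  obtains a p where "priced_taxi_market V l B T val P s a p r s'"
    "welfare_maximizing_allocation B T (taxi_market_value V l val P s) a"
    "minimal_walrasian_prices B T (taxi_market_value V l val P s) a p"
proof -
  obtain a p where ap: "welfare_maximizing_allocation B T (taxi_market_value V l val P s) a"
    "minimal_walrasian_prices B T (taxi_market_value V l val P s) a p"
    "\<forall>v\<in>V. r v = (MIN t\<in>T. l (loc V s t) v + p t)" "\<forall>v\<in>V. s' v = moved_supply B T P s a v"
    using assms(2) by (auto simp: surge_outcome_def)
  have "priced_taxi_market V l B T val P s a p r s'"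
    by unfold_locales (use assms(1) ap in \<open>auto simp: minimal_walrasian_prices_def\<close>)
  then show thesis
    using that ap by blast
qed

lemma truthful_dominant_surge:
  assumes setting: "taxi_setting V l B T val P s"
  shows "truthful_dominant V l B T val P s"
  unfolding truthful_dominant_def Let_def
proof (intro ballI allI impI; elim conjE)
  fix b report r s' S r' s'' S'
  let ?truth = "report(b := val b)"
  assume b: "b \<in> B" and report: "\<forall>b'\<in>B. 0 \<le> report b'"
    and truthful: "surge_outcome V l B T ?truth P s r s'" "demand_served V s' (demand P ?truth) r ?truth S"
    and lie: "surge_outcome V l B T report P s r' s''" "demand_served V s'' (demand P report) r' report S'"
  have settings: "taxi_setting V l B T ?truth P s" "taxi_setting V l B T report P s"
    using setting report b by (auto simp: taxi_setting_def)
  obtain a p where M: "priced_taxi_market V l B T ?truth P s a p r s'"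
    "welfare_maximizing_allocation B T (taxi_market_value V l ?truth P s) a"
    "minimal_walrasian_prices B T (taxi_market_value V l ?truth P s) a p"
    using surge_outcomeE[OF settings(1) truthful(1)] .
  obtain a' p' where M': "priced_taxi_market V l B T report P s a' p' r' s''"
    using surge_outcomeE[OF settings(2) lie(1)] by metis
  interpret truth: priced_taxi_market V l B T ?truth P s a p r s'
    by (fact M(1))
  interpret lie: priced_taxi_market V l B T report P s a' p' r' s''
    by (fact M')
  let ?v = "loc V P b"
  note truth_served = truth.served_iff[OF truthful(2) b, unfolded fun_upd_same]
  have nonneg: "0 \<le> passenger_utility V P val r S b"
    using truth_served by (simp add: passenger_utility_def)
  show "passenger_utility V P val r' S' b \<le> passenger_utility V P val r S b"
  proof (cases "b \<in> S' \<and> r' ?v < val b")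
    case True
    \<comment> \<open>Being served under the false report does not imply being allocated by
      \<open>a'\<close>, so another allocation at the same prices is taken.\<close>
    obtain a'' where "walrasian_prices B T (taxi_market_value V l report P s) a'' p'" "a'' b \<noteq> None"
      using lie.served_allocatable[OF lie(2) b] True by blast
    then have "walrasian_prices B T (taxi_market_value V l ?truth P s) a'' p'"
      using lie.walrasian_after_report b True by blast
    \<comment> \<open>\<open>minimal_walrasian_prices\<close> compares only prices that support the
      same allocation, so \<open>p'\<close> is first transferred to \<open>a\<close>.\<close>
    then have "walrasian_prices B T (taxi_market_value V l ?truth P s) a p'"
      using walrasian_change_allocation truth.finite_sets(2,3) M(2) by blast
    then have p: "p t \<le> p' t" if "t \<in> T" for t
      using M(3) that by (auto simp: minimal_walrasian_prices_def)
    obtain t where t: "t \<in> T" "r' ?v = l (loc V s t) ?v + p' t"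
      using lie.surge_attained[OF lie.passenger_loc(1)[OF b]] .
    have "r ?v \<le> r' ?v"
      using truth.surge_le[OF t(1) lie.passenger_loc(1)[OF b]] p[OF t(1)] t(2) by simp
    then show ?thesis
      using True truth_served by (simp add: passenger_utility_def)
  next
    case False
    then have "passenger_utility V P val r' S' b \<le> 0"
      by (auto simp: passenger_utility_def)
    then show ?thesis
      using nonneg by simp
  qed
qed

section \<open>Anchored prices in an indexed market\<close>

text \<open>
  Buyers and items are numbered from 1. Buyer 0 is a dummy who values everything at 0, and item 0
  stands for being unmatched, so that \<open>0 \<le> slack w item p b j\<close> covers envy-freeness
  (\<open>b, j > 0\<close>), individual rationality (\<open>j = 0\<close>) and nonnegativity of prices (\<open>b = 0\<close>).
\<close>

definition slack :: "(nat \<Rightarrow> nat \<Rightarrow> real) \<Rightarrow> (nat \<Rightarrow> nat) \<Rightarrow> (nat \<Rightarrow> real) \<Rightarrow> nat \<Rightarrow> nat \<Rightarrow> real" where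
  "slack w item p b j = (w b (item b) - p (item b)) - (w b j - p j)"

text \<open>
  \<open>h\<close> is an item that has no buyer although its price may be positive; \<open>h = 0\<close> means that there
  is none.
\<close>

definition stable ::
  "nat \<Rightarrow> nat \<Rightarrow> (nat \<Rightarrow> nat \<Rightarrow> real) \<Rightarrow> (nat \<Rightarrow> nat) \<Rightarrow> (nat \<Rightarrow> real) \<Rightarrow> nat \<Rightarrow> bool" where
  "stable m n w item p h \<longleftrightarrow>
     item 0 = 0 \<and> (\<forall>b\<le>m. item b \<le> n) \<and>
     (\<forall>b\<le>m. \<forall>b'\<le>m. item b = item b' \<and> item b \<noteq> 0 \<longrightarrow> b = b') \<and>
     (\<forall>b\<le>m. \<forall>j\<le>n. 0 \<le> slack w item p b j) \<and> p 0 = 0 \<and>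
     (\<forall>j\<le>n. (\<forall>b\<le>m. item b \<noteq> j) \<and> j \<noteq> h \<longrightarrow> p j = 0) \<and>
     (h \<noteq> 0 \<longrightarrow> (\<forall>b\<le>m. item b \<noteq> h))"

text \<open>
  The price of \<open>j\<close> is pinned from below by the buyer \<open>anchor j\<close>, who is indifferent between \<open>j\<close> and
  an item of smaller level; level 0 means not (yet) pinned.
\<close>

definition anchored ::
  "nat \<Rightarrow> nat \<Rightarrow> (nat \<Rightarrow> nat \<Rightarrow> real) \<Rightarrow> (nat \<Rightarrow> nat) \<Rightarrow> (nat \<Rightarrow> real) \<Rightarrow> (nat \<Rightarrow> nat) \<Rightarrow>
   (nat \<Rightarrow> nat) \<Rightarrow> nat \<Rightarrow> bool" where
  "anchored m n w item p anchor level R \<longleftrightarrow>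
     0 < level 0 \<and>
     (\<forall>j\<le>n. 0 < j \<and> 0 < level j \<and> level j \<le> R \<longrightarrow>
        anchor j \<le> m \<and> slack w item p (anchor j) j = 0 \<and>
        0 < level (item (anchor j)) \<and> level (item (anchor j)) < level j)"

text \<open>The extraction step of Dijkstra's algorithm: a cheapest edge from the anchored side to
  an item that is not yet anchored.\<close>

definition least_slack ::
  "nat \<Rightarrow> nat \<Rightarrow> (nat \<Rightarrow> nat \<Rightarrow> real) \<Rightarrow> (nat \<Rightarrow> nat) \<Rightarrow> (nat \<Rightarrow> real) \<Rightarrow> (nat \<Rightarrow> nat) \<Rightarrow>
   nat \<Rightarrow> nat \<Rightarrow> bool" where
  "least_slack m n w item p level x y \<longleftrightarrow>
     x \<le> m \<and> y \<le> n \<and> level y = 0 \<and> 0 < level (item x) \<and>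
     (\<forall>b\<le>m. \<forall>j\<le>n. level j = 0 \<and> 0 < level (item b) \<longrightarrow> slack w item p x y \<le> slack w item p b j)"

text \<open>When existing items are anchored, \<open>\<delta>\<close> is nonnegative. For a new item
  it may be negative, and then the stored price is raised to the highest bid.\<close>

definition lower_prices :: "nat \<Rightarrow> (nat \<Rightarrow> nat) \<Rightarrow> real \<Rightarrow> (nat \<Rightarrow> real) \<Rightarrow> nat \<Rightarrow> real" where
  "lower_prices n level \<delta> p j = (if j \<le> n \<and> level j = 0 then p j - \<delta> else p j)"

section \<open>Lowering prices and moving the hole\<close>

lemma stableD:
  assumes "stable m n w item p h"
  shows "item 0 = 0" "p 0 = 0" "b \<le> m \<Longrightarrow> item b \<le> n"
    "b \<le> m \<Longrightarrow> j \<le> n \<Longrightarrow> 0 \<le> slack w item p b j"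
    "b \<le> m \<Longrightarrow> b' \<le> m \<Longrightarrow> item b = item b' \<Longrightarrow> item b \<noteq> 0 \<Longrightarrow> b = b'"
    "j \<le> n \<Longrightarrow> (\<And>b. b \<le> m \<Longrightarrow> item b \<noteq> j) \<Longrightarrow> j \<noteq> h \<Longrightarrow> p j = 0"
    "h \<noteq> 0 \<Longrightarrow> b \<le> m \<Longrightarrow> item b \<noteq> h"
  using assms unfolding stable_def by blast+

lemma stableI:
  assumes "item 0 = 0" "p 0 = 0" "\<And>b. b \<le> m \<Longrightarrow> item b \<le> n"
    "\<And>b j. b \<le> m \<Longrightarrow> j \<le> n \<Longrightarrow> 0 \<le> slack w item p b j"
    "\<And>b b'. b \<le> m \<Longrightarrow> b' \<le> m \<Longrightarrow> item b = item b' \<Longrightarrow> item b \<noteq> 0 \<Longrightarrow> b = b'"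
    "\<And>j. j \<le> n \<Longrightarrow> (\<And>b. b \<le> m \<Longrightarrow> item b \<noteq> j) \<Longrightarrow> j \<noteq> h \<Longrightarrow> p j = 0"
    "\<And>b. h \<noteq> 0 \<Longrightarrow> b \<le> m \<Longrightarrow> item b \<noteq> h"
  shows "stable m n w item p h"
  using assms unfolding stable_def by blast

lemma slack_dummy_buyer:
  assumes "\<And>j. w 0 j = 0" "item 0 = 0" "p 0 = 0"
  shows "slack w item p 0 j = p j"
  using assms by (simp add: slack_def)

text \<open>Both items in an old anchoring equation have positive level, so their prices stay. For
  the pair \<open>x\<close>, \<open>y\<close> only the price of \<open>y\<close> moves, by exactly
  the slack. The argument covers either sign of \<open>\<delta>\<close>, hence also the pricing of a
  new item.\<close>

lemma anchored_lower_prices: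
  assumes st: "\<And>b. b \<le> m \<Longrightarrow> item b \<le> n"
    and an: "anchored m n w item p anchor level R"
    and ls: "least_slack m n w item p level x y"
    and level: "\<And>j. level j \<le> R" and R: "R < R'"
  defines "\<delta> \<equiv> slack w item p x y"
  shows "anchored m n w item (lower_prices n level \<delta> p) (anchor(y := x)) (level(y := R')) R'"
proof -
  have y: "level y = 0" "y \<le> n" "x \<le> m" "0 < level (item x)"
    using ls by (auto simp: least_slack_def)
  have "y \<noteq> 0" "item x \<noteq> y"
    using an y by (auto simp: anchored_def)
  have new: "slack w item (lower_prices n level \<delta> p) x y = 0"
    using y st[of x] by (auto simp: slack_def lower_prices_def \<delta>_def)
  have old: "anchor j \<le> m \<and> slack w item (lower_prices n level \<delta> p) (anchor j) j = 0 \<and>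
      0 < level (item (anchor j)) \<and> level (item (anchor j)) < level j \<and> item (anchor j) \<noteq> y"
    if "j \<le> n" "0 < j" "0 < level j" for j
    using an that level[of j] y unfolding anchored_def
    by (auto simp: slack_def lower_prices_def)
  have "(anchor(y := x)) j \<le> m \<and>
      slack w item (lower_prices n level \<delta> p) ((anchor(y := x)) j) j = 0 \<and>
      0 < (level(y := R')) (item ((anchor(y := x)) j)) \<and>
      (level(y := R')) (item ((anchor(y := x)) j)) < (level(y := R')) j"
    if j: "j \<le> n" "0 < j" "0 < (level(y := R')) j" for j
  proof (cases "j = y")
    case True
    then show ?thesis
      using y new \<open>item x \<noteq> y\<close> level[of "item x"] R by auto
  next
    case False
    then show ?thesis
      using old[of j] j by auto
  qed
  moreover have "0 < (level(y := R')) 0"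
    using an \<open>y \<noteq> 0\<close> by (simp add: anchored_def)
  ultimately show ?thesis
    unfolding anchored_def by blast
qed

text \<open>Only pairs of a buyer on the anchored side and an unanchored item lose slack, and these
  have at least \<open>\<delta>\<close>. The dummy buyer is always on the anchored side, which keeps
  prices nonnegative.\<close>

lemma stable_lower_prices:
  assumes w0: "\<And>j. w 0 j = 0"
    and st: "stable m n w item p 0"
    and r0: "0 < level 0"
    and ls: "least_slack m n w item p level x y"
  defines "\<delta> \<equiv> slack w item p x y"
  shows "stable m n w item (lower_prices n level \<delta> p) 0"
proof -
  let ?p = "lower_prices n level \<delta> p"
  note D = stableD[OF st]
  have y: "level y = 0" "y \<le> n" "x \<le> m" "0 < level (item x)"
    using ls by (auto simp: least_slack_def)
  have "0 \<le> \<delta>"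
    unfolding \<delta>_def by (rule D) (use y in auto)
  have le: "\<delta> \<le> slack w item p b j" if "b \<le> m" "j \<le> n" "level j = 0" "0 < level (item b)" for b j
    using ls that by (auto simp: least_slack_def \<delta>_def)
  have p0: "?p 0 = 0"
    using r0 D(2) by (simp add: lower_prices_def)
  have nonneg: "0 \<le> slack w item ?p b j" if "b \<le> m" "j \<le> n" for b j
    using D(4)[OF that] le[OF that] D(3)[OF that(1)] that \<open>0 \<le> \<delta>\<close>
    by (auto simp: lower_prices_def slack_def)
  \<comment> \<open>An unsold item already costs 0 and can only be lowered; the slack of the dummy
    buyer forbids a negative price.\<close>
  have "?p j = 0" if "j \<le> n" "\<And>b. b \<le> m \<Longrightarrow> item b \<noteq> j" for j
  proof -
    have "j \<noteq> 0"
      using that(2)[of 0] D(1) by auto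
    then have "p j = 0"
      using D(6)[of j] that by auto
    moreover have "0 \<le> ?p j"
      using nonneg[of 0 j] that slack_dummy_buyer[of w item ?p j] w0 D(1) p0 by simp
    ultimately show ?thesis
      using \<open>0 \<le> \<delta>\<close> by (auto simp: lower_prices_def split: if_splits)
  qed
  then show ?thesis
    using D(1,3,5) p0 nonneg by (intro stableI) blast+
qed

text \<open>With all old items anchored, the new one is the only candidate. Its price becomes the
  highest bid, a bid being \<open>w b (Suc n)\<close> minus the present utility of \<open>b\<close>;
  the stored value of \<open>p (Suc n)\<close> cancels. At that price nobody envies it, and as
  nobody owns it, it is the hole.\<close>

lemma stable_insert_item:
  assumes st: "stable m n w item p 0"
    and level: "\<And>j. j \<le> n \<Longrightarrow> 0 < level j" "level (Suc n) = 0"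
    and ls: "least_slack m (Suc n) w item p level x y"
  defines "\<delta> \<equiv> slack w item p x y"
  shows "y = Suc n" "stable m (Suc n) w item (lower_prices (Suc n) level \<delta> p) (Suc n)"
proof -
  let ?p = "lower_prices (Suc n) level \<delta> p"
  note D = stableD[OF st]
  have y: "level y = 0" "y \<le> Suc n" "x \<le> m"
    using ls by (auto simp: least_slack_def)
  then show yn: "y = Suc n"
    using level(1)[of y] by (cases "y = Suc n") auto
  have p: "?p j = p j" if "j \<le> n" for j
    using level(1)[OF that] by (simp add: lower_prices_def)
  have "0 \<le> slack w item ?p b j" if "b \<le> m" "j \<le> Suc n" for b j
  proof (cases "j = Suc n")
    case True
    have "\<delta> \<le> slack w item p b j"
      using ls that True level D(3)[OF that(1)] by (auto simp: least_slack_def \<delta>_def)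
    then show ?thesis
      using p[OF D(3)[OF that(1)]] level(2) True by (simp add: slack_def lower_prices_def)
  next
    case False
    then have "j \<le> n"
      using that by simp
    then show ?thesis
      using D(4)[OF that(1), of j] p[OF D(3)[OF that(1)]] p[of j] by (simp add: slack_def)
  qed
  moreover have "?p j = 0" if "j \<le> Suc n" "\<And>b. b \<le> m \<Longrightarrow> item b \<noteq> j" "j \<noteq> Suc n" for j
  proof -
    have "j \<noteq> 0" "j \<le> n"
      using that(2)[of 0] that D(1) by auto
    then show ?thesis
      using D(6)[of j] that p by auto
  qed
  moreover have "?p 0 = 0"
    using p[of 0] D(2) by simp
  moreover have "item b \<le> Suc n" "item b \<noteq> Suc n" if "b \<le> m" for b
    using D(3)[OF that] by auto
  ultimately show "stable m (Suc n) w item ?p (Suc n)"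
    using D(1,5) by (intro stableI) blast+
qed

text \<open>
  The hole \<open>h\<close> is given to its anchor, which moves the hole to an item of smaller level. The hole
  disappears when it reaches item 0.
\<close>

lemma augment_step:
  assumes w0: "\<And>j. w 0 j = 0"
    and st: "stable m n w item p h"
    and an: "anchored m n w item p anchor level (level h)"
    and h: "h \<le> n" "0 < h" "0 < level h"
  defines "item' \<equiv> (item(anchor h := h))(0 := 0)" and "h' \<equiv> item (anchor h)"
  shows "stable m n w item' p h'" "anchored m n w item' p anchor level (level h')"
    "h' \<le> n" "0 < level h'" "level h' < level h"
proof -
  note D = stableD[OF st]
  define b where "b = anchor h"
  have b: "b \<le> m" "slack w item p b h = 0" "0 < level h'" "level h' < level h"
    using an h unfolding anchored_def b_def h'_def by auto
  show "0 < level h'" "level h' < level h" "h' \<le> n"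
    using b D(3) by (auto simp: h'_def b_def)
  have item': "item' c = (if c = 0 then 0 else if c = b then h else item c)" for c
    using D(1) by (auto simp: item'_def b_def)
  have h': "h' = item b"
    by (simp add: h'_def b_def)
  \<comment> \<open>\<open>b\<close> is indifferent between its old item and \<open>h\<close>, so
    its utility is unchanged and with it every slack.\<close>
  have slack: "slack w item' p c j = slack w item p c j" for c j
    using b D(1) by (auto simp: slack_def item')
  \<comment> \<open>\<open>b\<close> anchors only items of level above that of its old item
    \<open>h'\<close>. The part of the chain still to be followed is therefore unaffected by the
    move.\<close>
  have anc: "anchor j \<noteq> b \<or> j = 0" if "j \<le> n" "0 < level j" "level j \<le> level h'" for j
    using an that b(4) unfolding anchored_def h' by fastforce
  have "anchor j \<le> m \<and> slack w item' p (anchor j) j = 0 \<and>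
      0 < level (item' (anchor j)) \<and> level (item' (anchor j)) < level j"
    if j: "j \<le> n" "0 < j" "0 < level j" "level j \<le> level h'" for j
  proof -
    have "item' (anchor j) = item (anchor j)"
      using anc[of j] j D(1) by (simp add: item')
    then show ?thesis
      using an j b(4) unfolding anchored_def slack by auto
  qed
  moreover have "0 < level 0"
    using an by (simp add: anchored_def)
  ultimately show "anchored m n w item' p anchor level (level h')"
    unfolding anchored_def by blast
  \<comment> \<open>\<open>h\<close> stays unsold only if its anchor is the dummy buyer, whose
    indifference means that \<open>h\<close> costs 0.\<close>
  have p: "p j = 0" if j: "j \<le> n" "\<And>c. c \<le> m \<Longrightarrow> item' c \<noteq> j" "j \<noteq> h'" for j
  proof (cases "j = h")
    case True
    then have "b = 0"
      using j(2)[OF b(1)] by (auto simp: item' split: if_splits)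
    then show ?thesis
      using b(2) slack_dummy_buyer[of w item p h] w0 D(1,2) True by simp
  next
    case False
    have "item c \<noteq> j" if "c \<le> m" for c
      using j(2)[OF that] j(2)[of 0] j(3) D(1) by (auto simp: item' h' split: if_splits)
    then show ?thesis
      using D(6)[of j] j False by auto
  qed
  have inj: "c = c'" if "c \<le> m" "c' \<le> m" "item' c = item' c'" "item' c \<noteq> 0" for c c'
  proof -
    have "item d \<noteq> h" if "d \<le> m" for d
      using D(7) h(2) that by simp
    then show ?thesis
      using that D(5)[OF that(1,2)] by (metis item')
  qed
  have hole: "item' c \<noteq> h'" if "h' \<noteq> 0" "c \<le> m" for c
  proof
    assume "item' c = h'"
    then have "c \<noteq> 0" "c = b \<Longrightarrow> h = item b" "c \<noteq> b \<Longrightarrow> item c = item b"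
      using that(1) \<open>item' c = h'\<close> by (auto simp: item' h' split: if_splits)
    then show False
      using D(5)[OF that(2) b(1)] D(7)[OF _ b(1)] h(2) that(1) h' by metis
  qed
  show "stable m n w item' p h'"
  proof (rule stableI)
    show "item' c \<le> n" if "c \<le> m" for c
      using D(3)[OF that] h(1) by (simp add: item')
    show "0 \<le> slack w item' p c j" if "c \<le> m" "j \<le> n" for c j
      unfolding slack by (rule D(4)[OF that])
    show "item' 0 = 0" by (simp add: item')
  qed (fact D(2) inj p hole)+
qed

text \<open>Along the anchors, \<open>p j\<close> is the price of an item of smaller level plus a
  constant determined by \<open>w\<close>. A competitor \<open>q\<close> obeys the same recursion as
  an inequality, and the recursion ends at item 0, where both are 0.\<close>

lemma anchored_minimal:
  assumes an: "anchored m n w item p anchor level R"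
    and all: "\<And>j. j \<le> n \<Longrightarrow> 0 < level j \<and> level j \<le> R"
    and item: "\<And>b. b \<le> m \<Longrightarrow> item b \<le> n" and p0: "p 0 = 0" "q 0 = 0"
    and q: "\<And>b j. b \<le> m \<Longrightarrow> j \<le> n \<Longrightarrow> 0 \<le> slack w item q b j"
  shows "j \<le> n \<Longrightarrow> p j \<le> q j"
proof (induction "level j" arbitrary: j rule: less_induct)
  case less
  show ?case
  proof (cases "j = 0")
    case False
    then have anchor: "anchor j \<le> m" "slack w item p (anchor j) j = 0" "level (item (anchor j)) < level j"
      using an all[OF less.prems] less.prems unfolding anchored_def by auto
    have "p (item (anchor j)) \<le> q (item (anchor j))"
      using less.hyps[OF anchor(3)] item anchor by simp
    then show ?thesis
      using anchor(2) q[OF anchor(1) less.prems] by (simp add: slack_def)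
  qed (use p0 in simp)
qed

section \<open>Running programs with a time bound\<close>

text \<open>Total correctness with a time budget. Nesting \<open>runs\<close> inside a postcondition
  composes programs, and the budgets add up.\<close>

definition runs :: "com \<Rightarrow> state \<Rightarrow> nat \<Rightarrow> (state \<Rightarrow> bool) \<Rightarrow> bool" where
  "runs c \<sigma> K Q \<longleftrightarrow> (\<exists>k \<sigma>'. exec c \<sigma> k \<sigma>' \<and> k \<le> K \<and> Q \<sigma>')"

lemma runs_mono: "runs c \<sigma> K Q \<Longrightarrow> K \<le> K' \<Longrightarrow> (\<And>\<sigma>'. Q \<sigma>' \<Longrightarrow> Q' \<sigma>') \<Longrightarrow> runs c \<sigma> K' Q'"
  unfolding runs_def by (meson order_trans)

lemma exec_simps:
  "exec Skip \<sigma> k \<sigma>' \<longleftrightarrow> k = 1 \<and> \<sigma>' = \<sigma>"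
  "exec (NSet x i j e) \<sigma> k \<sigma>' \<longleftrightarrow>
     k = 1 \<and> \<sigma>' = ((fst \<sigma>)((x, nval \<sigma> i, nval \<sigma> j) := nval \<sigma> e), snd \<sigma>)"
  "exec (RSet x i j e') \<sigma> k \<sigma>' \<longleftrightarrow>
     k = 1 \<and> \<sigma>' = (fst \<sigma>, (snd \<sigma>)((x, nval \<sigma> i, nval \<sigma> j) := rval \<sigma> e'))"
  "exec (Seq c c') \<sigma> k \<sigma>' \<longleftrightarrow> (\<exists>k1 \<sigma>1 k2. exec c \<sigma> k1 \<sigma>1 \<and> exec c' \<sigma>1 k2 \<sigma>' \<and> k = k1 + k2)"
  "exec (Cond g c c') \<sigma> k \<sigma>' \<longleftrightarrow>
     (\<exists>k'. k = Suc k' \<and> (if bval \<sigma> g then exec c \<sigma> k' \<sigma>' else exec c' \<sigma> k' \<sigma>'))"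
  by (subst exec.simps; auto)+

lemma runs_step:
  assumes "1 \<le> K"
  shows "runs Skip \<sigma> K Q = Q \<sigma>"
    "runs (NSet x i j e) \<sigma> K Q = Q ((fst \<sigma>)((x, nval \<sigma> i, nval \<sigma> j) := nval \<sigma> e), snd \<sigma>)"
    "runs (RSet x i j e') \<sigma> K Q = Q (fst \<sigma>, (snd \<sigma>)((x, nval \<sigma> i, nval \<sigma> j) := rval \<sigma> e'))"
  using assms by (simp_all add: runs_def exec_simps)

lemma ex_Suc_le:
  "(\<exists>k \<sigma>. (\<exists>k'. k = Suc k' \<and> R k' \<sigma>) \<and> k \<le> Suc K \<and> Q \<sigma>) \<longleftrightarrow> (\<exists>k \<sigma>. R k \<sigma> \<and> k \<le> K \<and> Q \<sigma>)"
  by (metis Suc_le_mono)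

lemma runs_Cond:
  assumes "1 \<le> K"
  shows "runs (Cond g c c') \<sigma> K Q = (if bval \<sigma> g then runs c \<sigma> (K - 1) Q else runs c' \<sigma> (K - 1) Q)"
proof -
  obtain K' where "K = Suc K'"
    using assms by (cases K) auto
  then show ?thesis
    unfolding runs_def exec_simps by (simp only: ex_Suc_le split: if_split) simp
qed

lemma runs_Seq:
  "runs c \<sigma> K (\<lambda>\<sigma>'. runs c' \<sigma>' K' Q) \<Longrightarrow> K + K' \<le> L \<Longrightarrow> runs (Seq c c') \<sigma> L Q"
  unfolding runs_def by (meson add_mono exec.Seq order_trans)

lemma exec_Seq_step:
  "exec (Seq (NSet x i j e) c) \<sigma> k \<sigma>' \<longleftrightarrow>
     (\<exists>k'. k = Suc k' \<and> exec c ((fst \<sigma>)((x, nval \<sigma> i, nval \<sigma> j) := nval \<sigma> e), snd \<sigma>) k' \<sigma>')"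
  "exec (Seq (RSet x i j e') c) \<sigma> k \<sigma>' \<longleftrightarrow>
     (\<exists>k'. k = Suc k' \<and> exec c (fst \<sigma>, (snd \<sigma>)((x, nval \<sigma> i, nval \<sigma> j) := rval \<sigma> e')) k' \<sigma>')"
  unfolding exec_simps by auto

lemma runs_Seq_step:
  assumes "1 \<le> K"
  shows "runs (Seq (NSet x i j e) c) \<sigma> K Q =
      runs c ((fst \<sigma>)((x, nval \<sigma> i, nval \<sigma> j) := nval \<sigma> e), snd \<sigma>) (K - 1) Q"
    "runs (Seq (RSet x i j e') c) \<sigma> K Q =
      runs c (fst \<sigma>, (snd \<sigma>)((x, nval \<sigma> i, nval \<sigma> j) := rval \<sigma> e')) (K - 1) Q"
proof -
  obtain K' where K: "K = Suc K'"
    using assms by (cases K) auto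
  show "runs (Seq (NSet x i j e) c) \<sigma> K Q =
      runs c ((fst \<sigma>)((x, nval \<sigma> i, nval \<sigma> j) := nval \<sigma> e), snd \<sigma>) (K - 1) Q"
    "runs (Seq (RSet x i j e') c) \<sigma> K Q =
      runs c (fst \<sigma>, (snd \<sigma>)((x, nval \<sigma> i, nval \<sigma> j) := rval \<sigma> e')) (K - 1) Q"
    unfolding runs_def exec_Seq_step K by (simp_all only: ex_Suc_le diff_Suc_1)
qed

lemma runs_While_False: "\<not> bval \<sigma> g \<Longrightarrow> 1 \<le> K \<Longrightarrow> Q \<sigma> \<Longrightarrow> runs (While g c) \<sigma> K Q"
  unfolding runs_def by (meson exec.WhileFalse)

lemma runs_While_True:
  assumes "bval \<sigma> g" "runs c \<sigma> K (\<lambda>\<sigma>'. runs (While g c) \<sigma>' K' Q)" "Suc (K + K') \<le> L"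
  shows "runs (While g c) \<sigma> L Q"
proof -
  obtain k \<sigma>' k' \<sigma>'' where "exec c \<sigma> k \<sigma>'" "k \<le> K" "exec (While g c) \<sigma>' k' \<sigma>''" "k' \<le> K'" "Q \<sigma>''"
    using assms(2) unfolding runs_def by blast
  then show ?thesis
    using exec.WhileTrue[OF assms(1)] assms(3) unfolding runs_def
    by (intro exI[of _ "Suc (k + k')"] exI[of _ \<sigma>'']) auto
qed

section \<open>Counting loops\<close>

definition cell :: "string \<Rightarrow> nexp" where
  "cell x = NGet x (NConst 0) (NConst 0)"

definition set_cell :: "string \<Rightarrow> nexp \<Rightarrow> com" where
  "set_cell x e = NSet x (NConst 0) (NConst 0) e"

definition count_loop :: "string \<Rightarrow> nexp \<Rightarrow> com \<Rightarrow> com" where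
  "count_loop x e c =
     Seq (set_cell x (NConst 0))
       (While (NLess (cell x) e) (Seq c (set_cell x (NAdd (cell x) (NConst 1)))))"

definition upd_cell :: "string \<Rightarrow> nat \<Rightarrow> state \<Rightarrow> state" where
  "upd_cell x k \<sigma> = ((fst \<sigma>)((x, 0, 0) := k), snd \<sigma>)"

lemma nval_cell [simp]: "nval \<sigma> (cell x) = fst \<sigma> (x, 0, 0)"
  by (simp add: cell_def)

lemma runs_set_cell: "1 \<le> K \<Longrightarrow> runs (set_cell x e) \<sigma> K Q = Q (upd_cell x (nval \<sigma> e) \<sigma>)"
  by (simp add: set_cell_def runs_step upd_cell_def)

lemma fst_upd_cell: "fst (upd_cell x k \<sigma>) = (fst \<sigma>)((x, 0, 0) := k)"
  by (simp add: upd_cell_def)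

text \<open>Test and increment add 2 to the budget of each round; the initialization and the last,
  failing test account for the other 2. The limit \<open>e\<close> is evaluated anew in each round,
  so the invariant has to fix its value.\<close>

lemma runs_count_loop:
  assumes init: "I 0 (upd_cell x 0 \<sigma>)"
    and step: "\<And>k \<sigma>. k < N \<Longrightarrow> I k \<sigma> \<Longrightarrow> fst \<sigma> (x, 0, 0) = k \<Longrightarrow>
      runs c \<sigma> K (\<lambda>\<sigma>'. fst \<sigma>' (x, 0, 0) = k \<and> I (Suc k) (upd_cell x (Suc k) \<sigma>'))"
    and bound: "\<And>k \<sigma>. k \<le> N \<Longrightarrow> I k \<sigma> \<Longrightarrow> nval \<sigma> e = N"
    and final: "\<And>\<sigma>. I N \<sigma> \<Longrightarrow> fst \<sigma> (x, 0, 0) = N \<Longrightarrow> Q \<sigma>"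
    and time: "N * (K + 2) + 2 \<le> L"
  shows "runs (count_loop x e c) \<sigma> L Q"
proof -
  let ?body = "Seq c (set_cell x (NAdd (cell x) (NConst 1)))"
  have loop: "runs (While (NLess (cell x) e) ?body) \<sigma> (d * (K + 2) + 1) Q"
    if "k + d = N" "I k \<sigma>" "fst \<sigma> (x, 0, 0) = k" for d k \<sigma>
    using that
  proof (induction d arbitrary: k \<sigma>)
    case 0
    then show ?case
      using bound[of N \<sigma>] final[of \<sigma>] by (intro runs_While_False) simp_all
  next
    case (Suc d)
    have k: "k < N"
      using Suc.prems(1) by simp
    have "runs ?body \<sigma> (K + 1) (\<lambda>\<sigma>'. I (Suc k) \<sigma>' \<and> fst \<sigma>' (x, 0, 0) = Suc k)"
    proof (rule runs_Seq)
      show "runs c \<sigma> K (\<lambda>\<sigma>'. runs (set_cell x (NAdd (cell x) (NConst 1))) \<sigma>' 1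
          (\<lambda>\<sigma>'. I (Suc k) \<sigma>' \<and> fst \<sigma>' (x, 0, 0) = Suc k))"
        using step[OF k Suc.prems(2,3)]
        by (rule runs_mono) (simp_all add: runs_set_cell fst_upd_cell)
    qed simp
    then have "runs ?body \<sigma> (K + 1) (\<lambda>\<sigma>'. runs (While (NLess (cell x) e) ?body) \<sigma>' (d * (K + 2) + 1) Q)"
      by (rule runs_mono) (use Suc.IH[of "Suc k"] Suc.prems(1) in auto)
    then show ?case
      using bound[OF _ Suc.prems(2)] Suc.prems(3) k by (intro runs_While_True) auto
  qed
  have "runs (While (NLess (cell x) e) ?body) (upd_cell x 0 \<sigma>) (N * (K + 2) + 1) Q"
    by (rule loop[OF _ init]) (simp_all add: fst_upd_cell)
  then show ?thesis
    unfolding count_loop_def using time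
    by (intro runs_Seq[where K = 1 and K' = "N * (K + 2) + 1"]) (simp_all add: runs_set_cell)
qed

section \<open>The program\<close>

definition vec :: "string \<Rightarrow> nexp \<Rightarrow> nexp" where
  "vec x e = NGet x e (NConst 0)"

lemma nval_vec [simp]: "nval \<sigma> (vec x e) = fst \<sigma> (x, nval \<sigma> e, 0)"
  by (simp add: vec_def)

definition set_real :: "string \<Rightarrow> rexp \<Rightarrow> com" where
  "set_real x e = RSet x (NConst 0) (NConst 0) e"

definition upd_real :: "string \<Rightarrow> real \<Rightarrow> state \<Rightarrow> state" where
  "upd_real x z \<sigma> = (fst \<sigma>, (snd \<sigma>)((x, 0, 0) := z))"

definition slack_exp :: "nexp \<Rightarrow> nexp \<Rightarrow> rexp" where
  "slack_exp b j =
     RSub (RSub (RGet ''w'' b (vec ''item'' b)) (RGet ''p'' (vec ''item'' b) (NConst 0)))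
       (RSub (RGet ''w'' b j) (RGet ''p'' j (NConst 0)))"

text \<open>\<open>y = 0\<close> signals that no pair has been found yet; item 0 is always anchored
  and never a candidate. The nested negations encode a disjunction.\<close>

definition scan_cell :: com where
  "scan_cell =
     Cond
       (BAnd (BAnd (NLess (vec ''level'' (cell ''j'')) (NConst 1))
                   (NLess (NConst 0) (vec ''level'' (vec ''item'' (cell ''b'')))))
             (BNot (BAnd (NLess (NConst 0) (cell ''y''))
                         (BNot (RLess (slack_exp (cell ''b'') (cell ''j''))
                                      (RGet ''d'' (NConst 0) (NConst 0)))))))
       (Seq (set_cell ''x'' (cell ''b''))
         (Seq (set_cell ''y'' (cell ''j''))
           (set_real ''d'' (slack_exp (cell ''b'') (cell ''j'')))))
       Skip"

text \<open>The limits cover items 0 to \<open>i + 1\<close>, including the one being inserted when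
  \<open>i\<close> are present, and all passengers together with the dummy.\<close>

definition scan :: com where
  "scan =
     Seq (set_cell ''y'' (NConst 0))
       (count_loop ''j'' (NAdd (cell ''i'') (NConst 2))
         (count_loop ''b'' (NAdd (cell ''passengers'') (NConst 1)) scan_cell))"

definition lower :: com where
  "lower =
     count_loop ''j'' (NAdd (cell ''i'') (NConst 2))
       (Cond (NLess (vec ''level'' (cell ''j'')) (NConst 1))
         (RSet ''p'' (cell ''j'') (NConst 0)
           (RSub (RGet ''p'' (cell ''j'') (NConst 0)) (RGet ''d'' (NConst 0) (NConst 0))))
         Skip)"

text \<open>Item 0 has level 1, so levels are handed out from 2 on while \<open>k\<close> counts from 0.\<close>

definition record_anchor :: com where
  "record_anchor =
     Seq (NSet ''level'' (cell ''y'') (NConst 0) (NAdd (cell ''k'') (NConst 2)))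
       (NSet ''anchor'' (cell ''y'') (NConst 0) (cell ''x''))"

text \<open>One round of Dijkstra's algorithm. When only the new item is unanchored, the same code
  sets its price.\<close>

definition anchor_next :: com where
  "anchor_next =
     Seq scan (Seq lower
       record_anchor)"

text \<open>\<open>\<sigma>0\<close> is the initial state: the input cells that are read late must
  still agree with it. Scratch cells are left unconstrained so that loop counters can change
  freely.\<close>

definition represents ::
  "state \<Rightarrow> (nat \<Rightarrow> nat \<Rightarrow> real) \<Rightarrow> (nat \<Rightarrow> nat) \<Rightarrow> (nat \<Rightarrow> real) \<Rightarrow> (nat \<Rightarrow> nat) \<Rightarrow>
   (nat \<Rightarrow> nat) \<Rightarrow> nat \<Rightarrow> state \<Rightarrow> bool" where
  "represents \<sigma>0 w item p anchor level i \<sigma> \<longleftrightarrow>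
     (\<forall>x\<in>{''passengers'', ''taxis'', ''request'', ''taxi_loc''}. \<forall>a b. fst \<sigma> (x, a, b) = fst \<sigma>0 (x, a, b)) \<and>
     (\<forall>a b. snd \<sigma> (''distance'', a, b) = snd \<sigma>0 (''distance'', a, b)) \<and>
     (\<forall>b j. snd \<sigma> (''w'', b, j) = w b j) \<and>
     (\<forall>b. fst \<sigma> (''item'', b, 0) = item b) \<and>
     (\<forall>j. snd \<sigma> (''p'', j, 0) = p j) \<and>
     (\<forall>j. fst \<sigma> (''anchor'', j, 0) = anchor j) \<and>
     (\<forall>j. fst \<sigma> (''level'', j, 0) = level j) \<and>
     fst \<sigma> (''i'', 0, 0) = i"

lemma representsD:
  assumes "represents \<sigma>0 w item p anchor level i \<sigma>"
  shows "fst \<sigma> (''passengers'', a, b) = fst \<sigma>0 (''passengers'', a, b)"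
    "fst \<sigma> (''taxis'', a, b) = fst \<sigma>0 (''taxis'', a, b)"
    "fst \<sigma> (''request'', a, b) = fst \<sigma>0 (''request'', a, b)"
    "fst \<sigma> (''taxi_loc'', a, b) = fst \<sigma>0 (''taxi_loc'', a, b)"
    "snd \<sigma> (''distance'', a, b) = snd \<sigma>0 (''distance'', a, b)"
    "snd \<sigma> (''w'', a, b) = w a b"
    "fst \<sigma> (''item'', a, 0) = item a"
    "snd \<sigma> (''p'', a, 0) = p a"
    "fst \<sigma> (''anchor'', a, 0) = anchor a"
    "fst \<sigma> (''level'', a, 0) = level a"
    "fst \<sigma> (''i'', 0, 0) = i"
  using assms by (auto simp: represents_def)

lemma represents_upd_cell [simp]:
  "represents \<sigma>0 w item p anchor level i (upd_cell ''j'' a \<sigma>) = represents \<sigma>0 w item p anchor level i \<sigma>"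
  "represents \<sigma>0 w item p anchor level i (upd_cell ''b'' a \<sigma>) = represents \<sigma>0 w item p anchor level i \<sigma>"
  "represents \<sigma>0 w item p anchor level i (upd_cell ''x'' a \<sigma>) = represents \<sigma>0 w item p anchor level i \<sigma>"
  "represents \<sigma>0 w item p anchor level i (upd_cell ''y'' a \<sigma>) = represents \<sigma>0 w item p anchor level i \<sigma>"
  "represents \<sigma>0 w item p anchor level i (upd_cell ''k'' a \<sigma>) = represents \<sigma>0 w item p anchor level i \<sigma>"
  "represents \<sigma>0 w item p anchor level i (upd_cell ''t'' a \<sigma>) = represents \<sigma>0 w item p anchor level i \<sigma>"
  "represents \<sigma>0 w item p anchor level i (upd_cell ''h'' a \<sigma>) = represents \<sigma>0 w item p anchor level i \<sigma>"
  "represents \<sigma>0 w item p anchor level i (upd_real ''d'' z \<sigma>) = represents \<sigma>0 w item p anchor level i \<sigma>"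
  by (auto simp: represents_def upd_cell_def upd_real_def)

lemma upd_cell_simps [simp]:
  "fst (upd_cell x a \<sigma>) (x', b, c) = (if x' = x \<and> b = 0 \<and> c = 0 then a else fst \<sigma> (x', b, c))"
  "snd (upd_cell x a \<sigma>) = snd \<sigma>"
  "snd (upd_real x z \<sigma>) (x', b, c) = (if x' = x \<and> b = 0 \<and> c = 0 then z else snd \<sigma> (x', b, c))"
  "fst (upd_real x z \<sigma>) = fst \<sigma>"
  by (auto simp: upd_cell_def upd_real_def)

lemma runs_Seq_set_cell:
  assumes "1 \<le> K"
  shows "runs (Seq (set_cell x e) c) \<sigma> K Q = runs c (upd_cell x (nval \<sigma> e) \<sigma>) (K - 1) Q"
  using assms by (simp add: set_cell_def runs_Seq_step upd_cell_def)

lemma runs_set_real: "1 \<le> K \<Longrightarrow> runs (set_real x e) \<sigma> K Q = Q (upd_real x (rval \<sigma> e) \<sigma>)"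
  by (simp add: set_real_def runs_step upd_real_def)

lemma runs_Seq_set_real:
  assumes "1 \<le> K"
  shows "runs (Seq (set_real x e) c) \<sigma> K Q = runs c (upd_real x (rval \<sigma> e) \<sigma>) (K - 1) Q"
  using assms by (simp add: set_real_def runs_Seq_step upd_real_def)

lemmas runs_simps = runs_step runs_Cond runs_Seq_step runs_set_cell runs_Seq_set_cell
  runs_set_real runs_Seq_set_real

section \<open>One round of anchoring\<close>

definition scanned ::
  "(nat \<Rightarrow> nat \<Rightarrow> real) \<Rightarrow> (nat \<times> nat) set \<Rightarrow> nat \<Rightarrow> nat \<Rightarrow> real \<Rightarrow> bool" where
  "scanned s A x y d \<longleftrightarrow>
     (if y = 0 then A = {} else (x, y) \<in> A \<and> d = s x y \<and> (\<forall>(b, j)\<in>A. d \<le> s b j))"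

abbreviation scanned_state ::
  "(nat \<Rightarrow> nat \<Rightarrow> real) \<Rightarrow> (nat \<times> nat) set \<Rightarrow> state \<Rightarrow> bool" where
  "scanned_state s A \<sigma> \<equiv>
     scanned s A (fst \<sigma> (''x'', 0, 0)) (fst \<sigma> (''y'', 0, 0)) (snd \<sigma> (''d'', 0, 0))"

lemma scanned_insert:
  assumes "scanned s A x y d" "j \<noteq> 0"
  shows "0 < y \<and> d \<le> s b j \<Longrightarrow> scanned s (insert (b, j) A) x y d"
    "\<not> (0 < y \<and> d \<le> s b j) \<Longrightarrow> scanned s (insert (b, j) A) b j (s b j)"
  using assms unfolding scanned_def by (auto split: if_splits)

lemma runs_scan_cell:
  assumes rep: "represents \<sigma>0 w item p anchor level i \<sigma>" and k: "fst \<sigma> (''k'', 0, 0) = k"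
    and j: "fst \<sigma> (''j'', 0, 0) = j" and b: "fst \<sigma> (''b'', 0, 0) = b" and level0: "0 < level 0"
    and sc: "scanned_state (slack w item p) A \<sigma>"
  shows "runs scan_cell \<sigma> 4 (\<lambda>\<sigma>'. represents \<sigma>0 w item p anchor level i \<sigma>' \<and>
    fst \<sigma>' (''k'', 0, 0) = k \<and> fst \<sigma>' (''j'', 0, 0) = j \<and> fst \<sigma>' (''b'', 0, 0) = b \<and>
    scanned_state (slack w item p) (if level j = 0 \<and> 0 < level (item b) then insert (b, j) A else A) \<sigma>')"
proof -
  note [simp] = representsD[OF rep] j b k
  have s: "rval \<sigma>' (slack_exp (cell ''b'') (cell ''j'')) = slack w item p (fst \<sigma>' (''b'', 0, 0)) (fst \<sigma>' (''j'', 0, 0))"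
    if "represents \<sigma>0 w item p anchor level i \<sigma>'" for \<sigma>'
    by (simp add: slack_exp_def slack_def representsD[OF that])
  have "j \<noteq> 0" if "level j = 0"
    using level0 that by (cases j) auto
  then show ?thesis
    unfolding scan_cell_def
    using rep sc scanned_insert[OF sc, of j b]
    by (auto simp add: runs_simps s not_less)
qed

lemma runs_scan:
  assumes rep: "represents \<sigma>0 w item p anchor level i \<sigma>" and k: "fst \<sigma> (''k'', 0, 0) = k"
    and level0: "0 < level 0" and m: "m = fst \<sigma>0 (''passengers'', 0, 0)"
    and ex: "level j0 = 0" "j0 \<le> Suc i" "0 < level (item 0)"
    and K: "(i + 2) * (6 * (m + 1) + 4) + 3 \<le> K"
  shows "runs scan \<sigma> K (\<lambda>\<sigma>'. represents \<sigma>0 w item p anchor level i \<sigma>' \<and> fst \<sigma>' (''k'', 0, 0) = k \<and>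
    least_slack m (Suc i) w item p level (fst \<sigma>' (''x'', 0, 0)) (fst \<sigma>' (''y'', 0, 0)) \<and>
    snd \<sigma>' (''d'', 0, 0) = slack w item p (fst \<sigma>' (''x'', 0, 0)) (fst \<sigma>' (''y'', 0, 0)))"
    (is "runs _ _ _ ?Q")
proof -
  \<comment> \<open>The pairs visited when the loops stand at item \<open>j\<close> and buyer
    \<open>b\<close>. A finished row coincides with the start of the next, which links the two loop
    invariants.\<close>
  define A where "A j b = {(b', j'). level j' = 0 \<and> 0 < level (item b') \<and> (j' < j \<and> b' \<le> m \<or> j' = j \<and> b' < b)}" for j b
  define I where "I j b \<sigma> \<longleftrightarrow> represents \<sigma>0 w item p anchor level i \<sigma> \<and> fst \<sigma> (''k'', 0, 0) = k \<and>
    scanned_state (slack w item p) (A j b) \<sigma>" for j b \<sigma>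
  have A_Suc: "A j (Suc b) = (if level j = 0 \<and> 0 < level (item b) then insert (b, j) (A j b) else A j b)" for j b
    by (auto simp: A_def less_Suc_eq)
  have A_next: "A (Suc j) 0 = A j (Suc m)" for j
    by (auto simp: A_def less_Suc_eq less_Suc_eq_le)
  have A_last: "A (i + 2) 0 = {(b, j). level j = 0 \<and> 0 < level (item b) \<and> j \<le> Suc i \<and> b \<le> m}"
    by (auto simp: A_def)
  have I_upd: "I j b (upd_cell ''j'' a \<sigma>) = I j b \<sigma>" "I j b (upd_cell ''b'' a \<sigma>) = I j b \<sigma>" for j b a \<sigma>
    by (simp_all add: I_def)
  have bounds: "nval \<sigma> (NAdd (cell ''passengers'') (NConst 1)) = Suc m" "nval \<sigma> (NAdd (cell ''i'') (NConst 2)) = i + 2"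
    if "I j b \<sigma>" for j b \<sigma>
  proof -
    have "represents \<sigma>0 w item p anchor level i \<sigma>"
      using that by (simp add: I_def)
    note representsD[OF this]
    then show "nval \<sigma> (NAdd (cell ''passengers'') (NConst 1)) = Suc m" "nval \<sigma> (NAdd (cell ''i'') (NConst 2)) = i + 2"
      by (simp_all add: m)
  qed
  have row: "runs (count_loop ''b'' (NAdd (cell ''passengers'') (NConst 1)) scan_cell) \<sigma> (6 * (m + 1) + 2)
      (\<lambda>\<sigma>'. fst \<sigma>' (''j'', 0, 0) = j \<and> I (Suc j) 0 (upd_cell ''j'' (Suc j) \<sigma>'))"
    if "I j 0 \<sigma>" "fst \<sigma> (''j'', 0, 0) = j" for j \<sigma>
  proof (rule runs_count_loop[where N = "Suc m" and K = 4 and I = "\<lambda>b \<sigma>. I j b \<sigma> \<and> fst \<sigma> (''j'', 0, 0) = j"])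
    show "I j 0 (upd_cell ''b'' 0 \<sigma>) \<and> fst (upd_cell ''b'' 0 \<sigma>) (''j'', 0, 0) = j"
      using that by (simp add: I_upd)
  next
    fix b \<sigma>
    assume "I j b \<sigma> \<and> fst \<sigma> (''j'', 0, 0) = j" "fst \<sigma> (''b'', 0, 0) = b"
    then show "runs scan_cell \<sigma> 4 (\<lambda>\<sigma>'. fst \<sigma>' (''b'', 0, 0) = b \<and>
        I j (Suc b) (upd_cell ''b'' (Suc b) \<sigma>') \<and> fst (upd_cell ''b'' (Suc b) \<sigma>') (''j'', 0, 0) = j)"
      using level0 unfolding I_def
      by (intro runs_mono[OF runs_scan_cell[where \<sigma> = \<sigma> and A = "A j b"]]) (auto simp: A_Suc)
  qed (use bounds in \<open>auto simp: I_upd I_def A_next simp del: nval.simps\<close>)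
  have post: "?Q \<sigma>'" if I: "I (i + 2) 0 \<sigma>'" for \<sigma>'
  proof -
    \<comment> \<open>The dummy buyer paired with any unanchored item is a candidate, so the scan
      cannot come back empty.\<close>
    have "(0, j0) \<in> A (i + 2) 0"
      unfolding A_last using ex by auto
    then have "fst \<sigma>' (''y'', 0, 0) \<noteq> 0"
      using I unfolding I_def scanned_def by (metis empty_iff)
    then show ?thesis
      using I unfolding I_def scanned_def least_slack_def A_last by (simp split: if_splits) auto
  qed
  have "runs (count_loop ''j'' (NAdd (cell ''i'') (NConst 2))
      (count_loop ''b'' (NAdd (cell ''passengers'') (NConst 1)) scan_cell)) (upd_cell ''y'' 0 \<sigma>)
      ((i + 2) * (6 * (m + 1) + 4) + 2) ?Q"
  proof (rule runs_count_loop[where N = "i + 2" and K = "6 * (m + 1) + 2" and I = "\<lambda>j. I j 0"])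
    show "I 0 0 (upd_cell ''j'' 0 (upd_cell ''y'' 0 \<sigma>))"
      using rep k by (simp add: I_def scanned_def A_def)
  next
    fix j \<sigma>
    assume "I j 0 \<sigma>" "fst \<sigma> (''j'', 0, 0) = j"
    then show "runs (count_loop ''b'' (NAdd (cell ''passengers'') (NConst 1)) scan_cell) \<sigma> (6 * (m + 1) + 2)
        (\<lambda>\<sigma>'. fst \<sigma>' (''j'', 0, 0) = j \<and> I (Suc j) 0 (upd_cell ''j'' (Suc j) \<sigma>'))"
      by (rule row)
  next
    show "nval \<sigma> (NAdd (cell ''i'') (NConst 2)) = i + 2" if "I j 0 \<sigma>" for j \<sigma>
      using that by (rule bounds(2))
  qed (rule post, simp_all)
  then have "runs (Seq (set_cell ''y'' (NConst 0)) (count_loop ''j'' (NAdd (cell ''i'') (NConst 2))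
      (count_loop ''b'' (NAdd (cell ''passengers'') (NConst 1)) scan_cell))) \<sigma>
      ((i + 2) * (6 * (m + 1) + 4) + 3) ?Q"
    by (simp add: runs_Seq_set_cell)
  then show ?thesis
    unfolding scan_def by (rule runs_mono) (use K in auto)
qed

lemma represents_write:
  assumes "represents \<sigma>0 w item p anchor level i \<sigma>"
  shows "represents \<sigma>0 w (item(a := b)) p anchor level i ((fst \<sigma>)((''item'', a, 0) := b), snd \<sigma>)"
    "represents \<sigma>0 w item (p(a := z)) anchor level i (fst \<sigma>, (snd \<sigma>)((''p'', a, 0) := z))"
    "represents \<sigma>0 w item p (anchor(a := b)) level i ((fst \<sigma>)((''anchor'', a, 0) := b), snd \<sigma>)"
    "represents \<sigma>0 w item p anchor (level(a := b)) i ((fst \<sigma>)((''level'', a, 0) := b), snd \<sigma>)"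
  using assms by (auto simp: represents_def)

lemma runs_lower:
  assumes rep: "represents \<sigma>0 w item p anchor level i \<sigma>"
    and frame: "fst \<sigma> (''k'', 0, 0) = k" "fst \<sigma> (''x'', 0, 0) = x" "fst \<sigma> (''y'', 0, 0) = y"
      "snd \<sigma> (''d'', 0, 0) = d"
    and K: "(i + 2) * 4 + 2 \<le> K"
  shows "runs lower \<sigma> K (\<lambda>\<sigma>'. represents \<sigma>0 w item (lower_prices (Suc i) level d p) anchor level i \<sigma>' \<and>
    fst \<sigma>' (''k'', 0, 0) = k \<and> fst \<sigma>' (''x'', 0, 0) = x \<and> fst \<sigma>' (''y'', 0, 0) = y)"
proof -
  define q where "q j = (\<lambda>j'. if j' < j \<and> level j' = 0 then p j' - d else p j')" for j
  define I where "I j \<sigma> \<longleftrightarrow> represents \<sigma>0 w item (q j) anchor level i \<sigma> \<and> fst \<sigma> (''k'', 0, 0) = k \<and>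
    fst \<sigma> (''x'', 0, 0) = x \<and> fst \<sigma> (''y'', 0, 0) = y \<and> snd \<sigma> (''d'', 0, 0) = d" for j \<sigma>
  have q_Suc: "q (Suc j) = (if level j = 0 then (q j)(j := p j - d) else q j)" for j
    by (auto simp: q_def fun_eq_iff less_Suc_eq)
  have q_last: "q (i + 2) = lower_prices (Suc i) level d p"
    by (auto simp: q_def lower_prices_def fun_eq_iff)
  show ?thesis
    unfolding lower_def
  proof (rule runs_count_loop[where N = "i + 2" and K = 2 and I = I])
    show "I 0 (upd_cell ''j'' 0 \<sigma>)"
      using rep frame by (simp add: I_def q_def)
  next
    fix j \<sigma>
    assume I: "I j \<sigma>" and j: "fst \<sigma> (''j'', 0, 0) = j"
    then have "represents \<sigma>0 w item (q j) anchor level i \<sigma>"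
      by (simp add: I_def)
    note R = representsD[OF this] represents_write(2)[OF this]
    have "q j j = p j"
      by (simp add: q_def)
    then show "runs (Cond (NLess (vec ''level'' (cell ''j'')) (NConst 1))
         (RSet ''p'' (cell ''j'') (NConst 0)
           (RSub (RGet ''p'' (cell ''j'') (NConst 0)) (RGet ''d'' (NConst 0) (NConst 0))))
         Skip) \<sigma> 2 (\<lambda>\<sigma>'. fst \<sigma>' (''j'', 0, 0) = j \<and> I (Suc j) (upd_cell ''j'' (Suc j) \<sigma>'))"
      using I j by (simp add: runs_simps R I_def q_Suc)
  next
    fix j \<sigma>
    assume "I j \<sigma>"
    then have "represents \<sigma>0 w item (q j) anchor level i \<sigma>"
      by (simp add: I_def)
    then show "nval \<sigma> (NAdd (cell ''i'') (NConst 2)) = i + 2"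
      by (simp add: representsD)
  next
    fix \<sigma>
    assume "I (i + 2) \<sigma>"
    then show "represents \<sigma>0 w item (lower_prices (Suc i) level d p) anchor level i \<sigma> \<and>
      fst \<sigma> (''k'', 0, 0) = k \<and> fst \<sigma> (''x'', 0, 0) = x \<and> fst \<sigma> (''y'', 0, 0) = y"
      unfolding I_def q_last by simp
  qed (use K in simp)
qed

lemma runs_anchor_next:
  assumes rep: "represents \<sigma>0 w item p anchor level i \<sigma>" and k: "fst \<sigma> (''k'', 0, 0) = k"
    and level0: "0 < level 0" and m: "m = fst \<sigma>0 (''passengers'', 0, 0)"
    and ex: "level j0 = 0" "j0 \<le> Suc i" "0 < level (item 0)"
    and K: "(i + 2) * (6 * m + 14) + 7 \<le> K"
  shows "runs anchor_next \<sigma> K (\<lambda>\<sigma>'. \<exists>x y. least_slack m (Suc i) w item p level x y \<and>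
    represents \<sigma>0 w item (lower_prices (Suc i) level (slack w item p x y) p)
      (anchor(y := x)) (level(y := k + 2)) i \<sigma>' \<and> fst \<sigma>' (''k'', 0, 0) = k)" (is "runs _ _ _ ?Q")
  unfolding anchor_next_def
proof (rule runs_Seq)
  show "runs scan \<sigma> ((i + 2) * (6 * (m + 1) + 4) + 3) 
      (\<lambda>\<sigma>'. runs (Seq lower record_anchor) \<sigma>' ((i + 2) * 4 + 4) ?Q)"
  proof (rule runs_mono[OF runs_scan[OF rep k level0 m ex order_refl] order_refl], elim conjE)
    fix \<sigma>' :: state
    let ?x = "fst \<sigma>' (''x'', 0, 0)" and ?y = "fst \<sigma>' (''y'', 0, 0)"
    assume \<sigma>': "represents \<sigma>0 w item p anchor level i \<sigma>'" "fst \<sigma>' (''k'', 0, 0) = k"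
      "least_slack m (Suc i) w item p level ?x ?y" "snd \<sigma>' (''d'', 0, 0) = slack w item p ?x ?y"
    show "runs (Seq lower record_anchor) \<sigma>' ((i + 2) * 4 + 4) ?Q"
    proof (rule runs_Seq)
      show "runs lower \<sigma>' ((i + 2) * 4 + 2) (\<lambda>\<sigma>'. runs record_anchor \<sigma>' 2 ?Q)"
      proof (rule runs_mono[OF runs_lower[OF \<sigma>'(1,2) refl refl \<sigma>'(4) order_refl] order_refl], elim conjE)
        fix \<sigma>''
        assume "represents \<sigma>0 w item (lower_prices (Suc i) level (slack w item p ?x ?y) p) anchor level i \<sigma>''"
          and "fst \<sigma>'' (''k'', 0, 0) = k" "fst \<sigma>'' (''x'', 0, 0) = ?x" "fst \<sigma>'' (''y'', 0, 0) = ?y"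
        then show "runs record_anchor \<sigma>'' 2 ?Q"
          using \<sigma>'(3) represents_write(3)[OF represents_write(4), of \<sigma>0 w item _ anchor level i \<sigma>'' ?y ?x ?y "k + 2"]
          by (auto simp: record_anchor_def runs_simps)
      qed
    qed simp
  qed
qed (use K in \<open>simp add: algebra_simps\<close>)

text \<open>Resetting entry 0 of \<open>item\<close> after each move keeps the dummy at item 0 when
  it is itself the anchor, without a case distinction.\<close>

definition augment :: com where
  "augment =
     While (NLess (NConst 0) (cell ''h''))
       (Seq (set_cell ''b'' (vec ''anchor'' (cell ''h'')))
         (Seq (set_cell ''t'' (vec ''item'' (cell ''b'')))
           (Seq (NSet ''item'' (cell ''b'') (NConst 0) (cell ''h''))
             (Seq (NSet ''item'' (NConst 0) (NConst 0) (NConst 0))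
               (set_cell ''h'' (cell ''t''))))))"

definition reset_levels :: com where
  "reset_levels =
     Seq (count_loop ''j'' (NAdd (cell ''i'') (NConst 2)) (NSet ''level'' (cell ''j'') (NConst 0) (NConst 0)))
       (NSet ''level'' (NConst 0) (NConst 0) (NConst 1))"

text \<open>The first \<open>anchor_next\<close> runs with \<open>k = i\<close> and gives the new
  item level \<open>i + 2\<close>, above all others. Augmenting changes who owns what and thereby
  invalidates anchors, so they are rebuilt from scratch.\<close>

definition insert_item :: com where
  "insert_item =
     Seq (set_cell ''k'' (cell ''i''))
       (Seq anchor_next
         (Seq (set_cell ''h'' (NAdd (cell ''i'') (NConst 1)))
           (Seq augment
             (Seq reset_levels
               (count_loop ''k'' (NAdd (cell ''i'') (NConst 1)) anchor_next)))))"

text \<open>The level of the hole strictly decreases, which gives termination and at most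
  \<open>level h\<close> rounds, each of five assignments and one test.\<close>

lemma runs_augment:
  assumes w0: "\<And>j. w 0 j = 0"
  shows "represents \<sigma>0 w item p anchor level i \<sigma> \<Longrightarrow> fst \<sigma> (''h'', 0, 0) = h \<Longrightarrow>
    stable m n w item p h \<Longrightarrow> anchored m n w item p anchor level (level h) \<Longrightarrow> h \<le> n \<Longrightarrow> 0 < level h \<Longrightarrow>
    6 * level h + 1 \<le> K \<Longrightarrow>
    runs augment \<sigma> K (\<lambda>\<sigma>'. \<exists>item'. represents \<sigma>0 w item' p anchor level i \<sigma>' \<and> stable m n w item' p 0)"
proof (induction "level h" arbitrary: h item \<sigma> K rule: less_induct)
  case less
  note R = representsD[OF less.prems(1)]
  show ?case
  proof (cases "h = 0")
    case True
    then show ?thesis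
      unfolding augment_def using less.prems by (intro runs_While_False) auto
  next
    case False
    let ?item = "(item(anchor h := h))(0 := 0)" and ?h = "item (anchor h)"
    let ?c = "Seq (set_cell ''b'' (vec ''anchor'' (cell ''h'')))
         (Seq (set_cell ''t'' (vec ''item'' (cell ''b'')))
           (Seq (NSet ''item'' (cell ''b'') (NConst 0) (cell ''h''))
             (Seq (NSet ''item'' (NConst 0) (NConst 0) (NConst 0))
               (set_cell ''h'' (cell ''t'')))))"
    let ?Q = "\<lambda>\<sigma>'. \<exists>item'. represents \<sigma>0 w item' p anchor level i \<sigma>' \<and> stable m n w item' p 0"
    have h: "0 < h"
      using False by simp
    note S = augment_step[OF w0 less.prems(3,4,5) h less.prems(6)]
    have "runs ?c \<sigma> 5 (\<lambda>\<sigma>'. represents \<sigma>0 w ?item p anchor level i \<sigma>' \<and> fst \<sigma>' (''h'', 0, 0) = ?h)"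
      using less.prems(1,2) by (simp add: runs_simps R represents_def upd_cell_def)
    then have "runs ?c \<sigma> 5 (\<lambda>\<sigma>'. runs augment \<sigma>' (6 * level ?h + 1) ?Q)"
      by (rule runs_mono) (auto intro!: less.hyps S)
    then show ?thesis
      unfolding augment_def using h less.prems(2,7) S(5)
      by (intro runs_While_True[where K = 5 and K' = "6 * level ?h + 1"]) auto
  qed
qed

lemma runs_reset_levels:
  assumes rep: "represents \<sigma>0 w item p anchor level i \<sigma>" and level: "\<And>j. Suc i < j \<Longrightarrow> level j = 0"
    and K: "(i + 2) * 3 + 3 \<le> K"
  shows "runs reset_levels \<sigma> K (represents \<sigma>0 w item p anchor ((\<lambda>_. 0)(0 := 1)) i)"
  unfolding reset_levels_def
proof (rule runs_Seq[where K' = 1])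
  define q where "q j = (\<lambda>j'. if j' < j then 0 else level j')" for j
  have q_Suc: "q (Suc j) = (q j)(j := 0)" for j
    by (auto simp: q_def fun_eq_iff less_Suc_eq)
  have q_last: "q (i + 2) = (\<lambda>_. 0)"
    using level by (auto simp: q_def fun_eq_iff)
  show "runs (count_loop ''j'' (NAdd (cell ''i'') (NConst 2)) (NSet ''level'' (cell ''j'') (NConst 0) (NConst 0))) \<sigma>
     ((i + 2) * 3 + 2) (\<lambda>\<sigma>'. runs (NSet ''level'' (NConst 0) (NConst 0) (NConst 1)) \<sigma>' 1
       (represents \<sigma>0 w item p anchor ((\<lambda>_. 0)(0 := 1)) i))"
  proof (rule runs_count_loop[where N = "i + 2" and K = 1 and I = "\<lambda>j. represents \<sigma>0 w item p anchor (q j) i"])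
    show "represents \<sigma>0 w item p anchor (q 0) i (upd_cell ''j'' 0 \<sigma>)"
      using rep by (simp add: q_def)
  next
    fix j \<sigma>
    assume "represents \<sigma>0 w item p anchor (q j) i \<sigma>" "fst \<sigma> (''j'', 0, 0) = j"
    then show "runs (NSet ''level'' (cell ''j'') (NConst 0) (NConst 0)) \<sigma> 1 (\<lambda>\<sigma>'. fst \<sigma>' (''j'', 0, 0) = j \<and>
        represents \<sigma>0 w item p anchor (q (Suc j)) i (upd_cell ''j'' (Suc j) \<sigma>'))"
      using represents_write(4)[of \<sigma>0 w item p anchor "q j" i \<sigma> j 0] by (simp add: runs_simps q_Suc)
  next
    fix j \<sigma>
    assume "represents \<sigma>0 w item p anchor (q j) i \<sigma>"
    then show "nval \<sigma> (NAdd (cell ''i'') (NConst 2)) = i + 2"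
      by (simp add: representsD)
  next
    fix \<sigma>
    assume "represents \<sigma>0 w item p anchor (q (i + 2)) i \<sigma>"
    then show "runs (NSet ''level'' (NConst 0) (NConst 0) (NConst 1)) \<sigma> 1
       (represents \<sigma>0 w item p anchor ((\<lambda>_. 0)(0 := 1)) i)"
      unfolding q_last using represents_write(4)[of \<sigma>0 w item p anchor _ i \<sigma> 0 1] by (simp add: runs_simps)
  qed simp
qed (use K in simp)

text \<open>The exact range of positive levels also says that item \<open>Suc i\<close> is
  unanchored, which makes it the only candidate for the next scan.\<close>

definition prices_found ::
  "state \<Rightarrow> (nat \<Rightarrow> nat \<Rightarrow> real) \<Rightarrow> nat \<Rightarrow> nat \<Rightarrow> state \<Rightarrow> bool" where
  "prices_found \<sigma>0 w m i \<sigma> \<longleftrightarrow>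
     (\<exists>item p anchor level. represents \<sigma>0 w item p anchor level i \<sigma> \<and> stable m i w item p 0 \<and>
        anchored m i w item p anchor level (i + 1) \<and> (\<forall>j. level j \<le> i + 1) \<and> (\<forall>j. 0 < level j \<longleftrightarrow> j \<le> i))"

lemma represents_next: "represents \<sigma>0 w item p anchor level i \<sigma> \<Longrightarrow>
    represents \<sigma>0 w item p anchor level i' (upd_cell ''i'' i' \<sigma>)"
  by (simp add: represents_def)

text \<open>Each round anchors exactly one more item. The cardinality in \<open>J\<close> counts
  them, starting with item 0, so after \<open>i + 1\<close> rounds all \<open>i + 2\<close> items
  are anchored.\<close>

lemma runs_anchor_all:
  assumes w0: "\<And>j. w 0 j = 0"
    and rep: "represents \<sigma>0 w item p anchor ((\<lambda>_. 0)(0 := 1)) i \<sigma>" and m: "m = fst \<sigma>0 (''passengers'', 0, 0)"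
    and st: "stable m (Suc i) w item p 0"
    and K: "(i + 1) * ((i + 2) * (6 * m + 14) + 9) + 2 \<le> K"
  shows "runs (count_loop ''k'' (NAdd (cell ''i'') (NConst 1)) anchor_next) \<sigma> K
    (\<lambda>\<sigma>'. fst \<sigma>' (''i'', 0, 0) = i \<and> prices_found \<sigma>0 w m (Suc i) (upd_cell ''i'' (Suc i) \<sigma>'))"
proof -
  define J where "J k p anchor level \<longleftrightarrow> stable m (Suc i) w item p 0 \<and>
    anchored m (Suc i) w item p anchor level (k + 1) \<and> (\<forall>j. level j \<le> k + 1) \<and> (\<forall>j. 0 < level j \<longrightarrow> j \<le> Suc i) \<and>
    card {j. 0 < level j} = k + 1" for k p anchor and level :: "nat \<Rightarrow> nat"
  define I where "I k \<sigma> \<longleftrightarrow> (\<exists>p anchor level. represents \<sigma>0 w item p anchor level i \<sigma> \<and> J k p anchor level)" for k \<sigma>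
  show ?thesis
  proof (rule runs_count_loop[where N = "i + 1" and K = "(i + 2) * (6 * m + 14) + 7" and I = I])
    have "{j. 0 < ((\<lambda>_. 0)(0 := 1 :: nat)) j} = {0 :: nat}"
      by auto
    then have "J 0 p anchor ((\<lambda>_. 0)(0 := 1))"
      using st by (auto simp: J_def anchored_def)
    then show "I 0 (upd_cell ''k'' 0 \<sigma>)"
      using rep unfolding I_def by auto
  next
    fix k \<sigma>
    assume "I k \<sigma>" and k: "fst \<sigma> (''k'', 0, 0) = k" "k < i + 1"
    then obtain p anchor level where rep: "represents \<sigma>0 w item p anchor level i \<sigma>" and J: "J k p anchor level"
      by (auto simp: I_def)
    have st: "stable m (Suc i) w item p 0" and an: "anchored m (Suc i) w item p anchor level (k + 1)"
      and level: "\<And>j. level j \<le> k + 1" "\<And>j. 0 < level j \<Longrightarrow> j \<le> Suc i" and card: "card {j. 0 < level j} = k + 1"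
      using J by (auto simp: J_def)
    have fin: "finite {j. 0 < level j}"
      by (rule finite_subset[of _ "{..Suc i}"]) (use level in auto)
    have "\<exists>j\<le>Suc i. level j = 0"
    proof (rule ccontr)
      assume "\<not> ?thesis"
      then have "{..Suc i} \<subseteq> {j. 0 < level j}"
        by auto
      from card_mono[OF fin this] show False
        using card k(2) by simp
    qed
    then obtain j0 where j0: "level j0 = 0" "j0 \<le> Suc i"
      by auto
    have level0: "0 < level 0"
      using an by (simp add: anchored_def)
    then have item0: "0 < level (item 0)"
      using stableD(1)[OF st] by simp
    have "I (Suc k) (upd_cell ''k'' (Suc k) \<sigma>')"
      if ls: "least_slack m (Suc i) w item p level x y"
        and rep': "represents \<sigma>0 w item (lower_prices (Suc i) level (slack w item p x y) p)
          (anchor(y := x)) (level(y := k + 2)) i \<sigma>'" for x y \<sigma>'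
    proof -
      have y: "level y = 0" "y \<le> Suc i"
        using ls by (auto simp: least_slack_def)
      have "{j. 0 < (level(y := k + 2)) j} = insert y {j. 0 < level j}"
        by auto
      then have "card {j. 0 < (level(y := k + 2)) j} = k + 2"
        using fin y card by simp
      moreover have "anchored m (Suc i) w item (lower_prices (Suc i) level (slack w item p x y) p)
          (anchor(y := x)) (level(y := k + 2)) (k + 2)"
        using stableD(3)[OF st] an ls level(1) by (rule anchored_lower_prices) auto
      moreover have "stable m (Suc i) w item (lower_prices (Suc i) level (slack w item p x y) p) 0"
        using w0 st level0 ls by (rule stable_lower_prices)
      moreover have "(level(y := k + 2)) j \<le> k + 2" "0 < (level(y := k + 2)) j \<Longrightarrow> j \<le> Suc i" for j
        using level(1)[of j] level(2)[of j] y by (auto split: if_splits)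
      ultimately have "J (Suc k) (lower_prices (Suc i) level (slack w item p x y) p)
          (anchor(y := x)) (level(y := k + 2))"
        unfolding J_def by simp
      then show ?thesis
        using rep' unfolding I_def by auto
    qed
    then show "runs anchor_next \<sigma> ((i + 2) * (6 * m + 14) + 7)
       (\<lambda>\<sigma>'. fst \<sigma>' (''k'', 0, 0) = k \<and> I (Suc k) (upd_cell ''k'' (Suc k) \<sigma>'))"
      by (intro runs_mono[OF runs_anchor_next[OF rep k(1) level0 m j0 item0 order_refl]]) auto
  next
    fix k \<sigma>
    assume "I k \<sigma>"
    then show "nval \<sigma> (NAdd (cell ''i'') (NConst 1)) = i + 1"
      by (auto simp: I_def dest: representsD(11))
  next
    fix \<sigma>
    assume "I (i + 1) \<sigma>"
    then obtain p anchor level where rep: "represents \<sigma>0 w item p anchor level i \<sigma>" and J: "J (i + 1) p anchor level"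
      by (auto simp: I_def)
    have level: "\<And>j. 0 < level j \<Longrightarrow> j \<le> Suc i" and card: "card {j. 0 < level j} = Suc (Suc i)"
      using J by (auto simp: J_def)
    have "{j. 0 < level j} = {..Suc i}"
      using level card by (intro card_subset_eq) auto
    then have "0 < level j \<longleftrightarrow> j \<le> Suc i" for j
      by blast
    then show "fst \<sigma> (''i'', 0, 0) = i \<and> prices_found \<sigma>0 w m (Suc i) (upd_cell ''i'' (Suc i) \<sigma>)"
      using J represents_next[OF rep, of "Suc i"] representsD(11)[OF rep] unfolding prices_found_def J_def
      by fastforce
  qed (use K in simp)
qed

lemma runs_insert_item:
  assumes w0: "\<And>j. w 0 j = 0"
    and found: "prices_found \<sigma>0 w m i \<sigma>" and m: "m = fst \<sigma>0 (''passengers'', 0, 0)"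
    and K: "(i + 2) * ((i + 2) * (6 * m + 14) + 18) + 7 \<le> K"
  shows "runs insert_item \<sigma> K
    (\<lambda>\<sigma>'. fst \<sigma>' (''i'', 0, 0) = i \<and> prices_found \<sigma>0 w m (Suc i) (upd_cell ''i'' (Suc i) \<sigma>'))" (is "runs _ _ _ ?Q")
proof -
  obtain item p anchor level where rep: "represents \<sigma>0 w item p anchor level i \<sigma>" and st: "stable m i w item p 0"
    and an: "anchored m i w item p anchor level (i + 1)" and level: "\<And>j. level j \<le> i + 1" "\<And>j. 0 < level j \<longleftrightarrow> j \<le> i"
    using found by (auto simp: prices_found_def)
  have level0: "0 < level 0" and item0: "0 < level (item 0)" and next_free: "level (Suc i) = 0"
    using level(2)[of 0] level(2)[of "Suc i"] stableD(1)[OF st] by auto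
  let ?\<sigma> = "upd_cell ''k'' i \<sigma>"
  let ?rest = "Seq (set_cell ''h'' (NAdd (cell ''i'') (NConst 1)))
           (Seq augment
             (Seq reset_levels
               (count_loop ''k'' (NAdd (cell ''i'') (NConst 1)) anchor_next)))"
  let ?A = "(i + 2) * (6 * m + 14) + 7" and ?B = "6 * (i + 2) + 1" and ?C = "(i + 2) * 3 + 3"
    and ?D = "(i + 1) * ((i + 2) * (6 * m + 14) + 9) + 2"
  have rest: "runs ?rest \<sigma>' (?B + ?C + ?D + 1) ?Q"
    if ls: "least_slack m (Suc i) w item p level x y"
      and rep': "represents \<sigma>0 w item (lower_prices (Suc i) level (slack w item p x y) p)
          (anchor(y := x)) (level(y := i + 2)) i \<sigma>'" for x y \<sigma>'
  proof -
    let ?p = "lower_prices (Suc i) level (slack w item p x y) p" and ?anchor = "anchor(y := x)"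
      and ?level = "level(y := i + 2)"
    have y: "y = Suc i" and st': "stable m (Suc i) w item ?p (Suc i)"
      using stable_insert_item[OF st _ next_free ls] level(2) by auto
    \<comment> \<open>Level 0 exempts the new item from the anchoring condition, so the range of
      items can be extended.\<close>
    have "anchored m (Suc i) w item p anchor level (i + 1)"
      using an next_free unfolding anchored_def by (auto simp: le_Suc_eq)
    then have an': "anchored m (Suc i) w item ?p ?anchor ?level (i + 2)"
      using stableD(3)[OF st] ls level(1) by (intro anchored_lower_prices) (auto intro: le_SucI)
    have "runs augment (upd_cell ''h'' (Suc i) \<sigma>') ?B
        (\<lambda>\<sigma>'. \<exists>item'. represents \<sigma>0 w item' ?p ?anchor ?level i \<sigma>' \<and> stable m (Suc i) w item' ?p 0)"
      by (rule runs_augment[where h = "Suc i", OF w0 _ _ st']) (use rep' an' y in auto)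
    then have "runs augment (upd_cell ''h'' (Suc i) \<sigma>') ?B (\<lambda>\<sigma>'. runs (Seq reset_levels
               (count_loop ''k'' (NAdd (cell ''i'') (NConst 1)) anchor_next)) \<sigma>' (?C + ?D) ?Q)"
    proof (rule runs_mono)
      fix \<sigma>''
      assume "\<exists>item'. represents \<sigma>0 w item' ?p ?anchor ?level i \<sigma>'' \<and> stable m (Suc i) w item' ?p 0"
      then obtain item' where item': "represents \<sigma>0 w item' ?p ?anchor ?level i \<sigma>''" "stable m (Suc i) w item' ?p 0"
        by auto
      have "?level j = 0" if "Suc i < j" for j
        using that level(2)[of j] y by auto
      then have "runs reset_levels \<sigma>'' ?C (represents \<sigma>0 w item' ?p ?anchor ((\<lambda>_. 0)(0 := 1)) i)"
        by (intro runs_reset_levels[OF item'(1)]) auto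
      then have "runs reset_levels \<sigma>'' ?C
          (\<lambda>\<sigma>'. runs (count_loop ''k'' (NAdd (cell ''i'') (NConst 1)) anchor_next) \<sigma>' ?D ?Q)"
        by (rule runs_mono) (rule order_refl, erule runs_anchor_all[OF w0 _ m item'(2) order_refl])
      then show "runs (Seq reset_levels
               (count_loop ''k'' (NAdd (cell ''i'') (NConst 1)) anchor_next)) \<sigma>'' (?C + ?D) ?Q"
        by (rule runs_Seq) simp
    qed simp
    then have "runs (Seq augment (Seq reset_levels
               (count_loop ''k'' (NAdd (cell ''i'') (NConst 1)) anchor_next))) (upd_cell ''h'' (Suc i) \<sigma>') (?B + ?C + ?D) ?Q"
      by (rule runs_Seq) simp
    then show ?thesis
      using representsD(11)[OF rep'] by (simp add: runs_simps)
  qed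
  have rep_k: "represents \<sigma>0 w item p anchor level i ?\<sigma>" and k: "fst ?\<sigma> (''k'', 0, 0) = i"
    using rep by simp_all
  have "runs anchor_next ?\<sigma> ?A (\<lambda>\<sigma>'. runs ?rest \<sigma>' (?B + ?C + ?D + 1) ?Q)"
    by (rule runs_mono[OF runs_anchor_next[OF rep_k k level0 m next_free order_refl item0 order_refl]])
      (use rest in auto)
  then have "runs (Seq anchor_next ?rest) ?\<sigma> (?A + (?B + ?C + ?D + 1)) ?Q"
    by (rule runs_Seq) simp
  then have "runs insert_item \<sigma> (?A + (?B + ?C + ?D + 1) + 1) ?Q"
    unfolding insert_item_def using representsD(11)[OF rep] by (simp add: runs_simps)
  then show ?thesis
    by (rule runs_mono) (use K in \<open>simp_all add: algebra_simps\<close>)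
qed

text \<open>Shifted by one to make room for buyer 0 and item 0. The value 0 out of range matches the
  cells that are never written, so the whole array is described by one function.\<close>

definition market_matrix :: "state \<Rightarrow> nat \<Rightarrow> nat \<Rightarrow> real" where
  "market_matrix \<sigma> b j =
     (if b = 0 \<or> j = 0 \<or> fst \<sigma> (''passengers'', 0, 0) < b \<or> fst \<sigma> (''taxis'', 0, 0) < j then 0
      else snd \<sigma> (''value'', b - 1, 0) -
        snd \<sigma> (''distance'', fst \<sigma> (''passenger_loc'', b - 1, 0), fst \<sigma> (''taxi_loc'', j - 1, 0)))"

definition load_entry :: com where
  "load_entry =
     RSet ''w'' (NAdd (cell ''b'') (NConst 1)) (NAdd (cell ''j'') (NConst 1))
       (RSub (RGet ''value'' (cell ''b'') (NConst 0))
         (RGet ''distance'' (vec ''passenger_loc'' (cell ''b'')) (vec ''taxi_loc'' (cell ''j''))))"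

definition load_matrix :: com where
  "load_matrix = count_loop ''b'' (cell ''passengers'') (count_loop ''j'' (cell ''taxis'') load_entry)"

definition taxi_offer :: rexp where
  "taxi_offer =
     RAdd (RGet ''distance'' (vec ''taxi_loc'' (cell ''j'')) (cell ''request''))
       (RGet ''p'' (NAdd (cell ''j'') (NConst 1)) (NConst 0))"

text \<open>The minimum starts from the offer of taxicab 0, since no constant can serve as
  infinity.\<close>

definition find_price :: com where
  "find_price =
     Seq (set_cell ''j'' (NConst 0))
       (Seq (set_real ''price'' taxi_offer)
         (count_loop ''j'' (cell ''taxis'')
           (Cond (RLess taxi_offer (RGet ''price'' (NConst 0) (NConst 0))) (set_real ''price'' taxi_offer) Skip)))"

text \<open>The explicit assignment anchors item 0. The cells without input are 0 and thus already
  hold the empty matching with all prices 0.\<close>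

definition surge_program :: com where
  "surge_program =
     Seq load_matrix
       (Seq (NSet ''level'' (NConst 0) (NConst 0) (NConst 1))
         (Seq (count_loop ''i'' (cell ''taxis'') insert_item) find_price))"

lemma represents_upd_price:
  "represents \<sigma>0 w item p anchor level i (upd_real ''price'' z \<sigma>) = represents \<sigma>0 w item p anchor level i \<sigma>"
  by (simp add: represents_def)

lemma represents_write_w:
  assumes "represents \<sigma>0 w item p anchor level i \<sigma>"
  shows "represents \<sigma>0 (\<lambda>b j. if b = b0 \<and> j = j0 then z else w b j) item p anchor level i
    (fst \<sigma>, (snd \<sigma>)((''w'', b0, j0) := z))"
  using assms by (auto simp: represents_def)

lemma runs_load_matrix:
  assumes rep: "represents \<sigma>0 (\<lambda>_ _. 0) item p anchor level i \<sigma>0"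
    and mn: "fst \<sigma>0 (''passengers'', 0, 0) = m" "fst \<sigma>0 (''taxis'', 0, 0) = n"
    and K: "m * (n * 3 + 4) + 2 \<le> K"
  shows "runs load_matrix \<sigma>0 K (represents \<sigma>0 (market_matrix \<sigma>0) item p anchor level i)"
proof -
  define W where "W b j = (\<lambda>b' j'. if b' \<le> b \<or> b' = Suc b \<and> j' \<le> j then market_matrix \<sigma>0 b' j' else 0)" for b j
  \<comment> \<open>\<open>represents\<close> leaves out the cells \<open>passenger_loc\<close> and
    \<open>value\<close>, which are read only while loading, so the invariant preserves them
    separately.\<close>
  define I where "I b j \<sigma> \<longleftrightarrow> represents \<sigma>0 (W b j) item p anchor level i \<sigma> \<and>
      (\<forall>a. fst \<sigma> (''passenger_loc'', a, 0) = fst \<sigma>0 (''passenger_loc'', a, 0)) \<and>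
      (\<forall>a. snd \<sigma> (''value'', a, 0) = snd \<sigma>0 (''value'', a, 0))" for b j \<sigma>
  have W_init: "W 0 0 = (\<lambda>_ _. 0)"
    by (auto simp: W_def market_matrix_def fun_eq_iff)
  have W_row: "W b n = W (Suc b) 0" for b
    by (auto simp: W_def market_matrix_def fun_eq_iff mn le_Suc_eq)
  have W_last: "W m 0 = market_matrix \<sigma>0"
    by (auto simp: W_def market_matrix_def fun_eq_iff mn)
  have W_Suc: "W b (Suc j) = (\<lambda>b' j'. if b' = Suc b \<and> j' = Suc j then market_matrix \<sigma>0 (Suc b) (Suc j) else W b j b' j')" for b j
    by (auto simp: W_def fun_eq_iff le_Suc_eq)
  have I_rep: "represents \<sigma>0 (W b j) item p anchor level i \<sigma>" if "I b j \<sigma>" for b j \<sigma>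
    using that by (simp add: I_def)
  have upd: "I b j (upd_cell ''j'' a \<sigma>) = I b j \<sigma>" "I b j (upd_cell ''b'' a \<sigma>) = I b j \<sigma>" for b j a \<sigma>
    by (simp_all add: I_def)
  have row: "runs (count_loop ''j'' (cell ''taxis'') load_entry) \<sigma> (n * 3 + 2)
      (\<lambda>\<sigma>'. fst \<sigma>' (''b'', 0, 0) = b \<and> I (Suc b) 0 (upd_cell ''b'' (Suc b) \<sigma>'))"
    if "I b 0 \<sigma>" "fst \<sigma> (''b'', 0, 0) = b" "b < m" for b \<sigma>
  proof (rule runs_count_loop[where N = n and K = 1 and I = "\<lambda>j \<sigma>. I b j \<sigma> \<and> fst \<sigma> (''b'', 0, 0) = b"])
    show "I b 0 (upd_cell ''j'' 0 \<sigma>) \<and> fst (upd_cell ''j'' 0 \<sigma>) (''b'', 0, 0) = b"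
      using that by (simp add: upd)
  next
    fix j \<sigma>
    assume j: "j < n" "fst \<sigma> (''j'', 0, 0) = j" and I: "I b j \<sigma> \<and> fst \<sigma> (''b'', 0, 0) = b"
    have rep: "represents \<sigma>0 (W b j) item p anchor level i \<sigma>"
      using I I_rep by auto
    have eq: "market_matrix \<sigma>0 (Suc b) (Suc j) = snd \<sigma>0 (''value'', b, 0) -
        snd \<sigma>0 (''distance'', fst \<sigma>0 (''passenger_loc'', b, 0), fst \<sigma>0 (''taxi_loc'', j, 0))"
      using j(1) that(3) mn by (simp add: market_matrix_def)
    show "runs load_entry \<sigma> 1 (\<lambda>\<sigma>'. fst \<sigma>' (''j'', 0, 0) = j \<and> I b (Suc j) (upd_cell ''j'' (Suc j) \<sigma>') \<and>
        fst (upd_cell ''j'' (Suc j) \<sigma>') (''b'', 0, 0) = b)"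
      using I j(2) represents_write_w[OF rep, of "Suc b" "Suc j" "market_matrix \<sigma>0 (Suc b) (Suc j)"]
      by (simp add: eq[symmetric] load_entry_def runs_step upd I_def W_Suc representsD[OF rep])
  next
    fix j \<sigma>
    assume "I b j \<sigma> \<and> fst \<sigma> (''b'', 0, 0) = b"
    then have "I b j \<sigma>"
      by simp
    from representsD(2)[OF I_rep[OF this]] show "nval \<sigma> (cell ''taxis'') = n"
      using mn by simp
  qed (simp_all add: upd W_row[symmetric] I_def)
  show ?thesis
    unfolding load_matrix_def
  proof (rule runs_count_loop[where N = m and K = "n * 3 + 2" and I = "\<lambda>b. I b 0"])
    show "I 0 0 (upd_cell ''b'' 0 \<sigma>0)"
      unfolding upd using rep by (simp add: I_def W_init)
  next
    fix b \<sigma>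
    assume "b < m" "I b 0 \<sigma>" "fst \<sigma> (''b'', 0, 0) = b"
    then show "runs (count_loop ''j'' (cell ''taxis'') load_entry) \<sigma> (n * 3 + 2)
        (\<lambda>\<sigma>'. fst \<sigma>' (''b'', 0, 0) = b \<and> I (Suc b) 0 (upd_cell ''b'' (Suc b) \<sigma>'))"
      by (intro row)
  next
    fix b \<sigma>
    assume "I b 0 \<sigma>"
    then show "nval \<sigma> (cell ''passengers'') = m"
      using representsD(1)[OF I_rep] mn by simp
  next
    fix \<sigma>
    assume "I m 0 \<sigma>"
    then show "represents \<sigma>0 (market_matrix \<sigma>0) item p anchor level i \<sigma>"
      using I_rep W_last by metis
  qed (use K in \<open>simp add: algebra_simps\<close>)
qed

lemma runs_find_price:
  assumes rep: "represents \<sigma>0 w item p anchor level i \<sigma>" and n: "fst \<sigma>0 (''taxis'', 0, 0) = n" "0 < n"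
    and K: "n * 4 + 4 \<le> K"
  defines "f \<equiv> \<lambda>j. snd \<sigma>0 (''distance'', fst \<sigma>0 (''taxi_loc'', j, 0), fst \<sigma>0 (''request'', 0, 0)) + p (Suc j)"
  shows "runs find_price \<sigma> K (\<lambda>\<sigma>'. snd \<sigma>' (''price'', 0, 0) = Min (f ` {..<n}))"
proof -
  define I where "I k \<sigma> \<longleftrightarrow> represents \<sigma>0 w item p anchor level i \<sigma> \<and> snd \<sigma> (''price'', 0, 0) \<in> f ` {..<n} \<and>
    (\<forall>j<k. snd \<sigma> (''price'', 0, 0) \<le> f j)" for k \<sigma>
  have offer: "rval \<sigma>' taxi_offer = f (fst \<sigma>' (''j'', 0, 0))" if "represents \<sigma>0 w item p anchor level i \<sigma>'" for \<sigma>'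
    by (simp add: taxi_offer_def f_def representsD[OF that])
  let ?\<sigma> = "upd_real ''price'' (f 0) (upd_cell ''j'' 0 \<sigma>)"
  have "runs (count_loop ''j'' (cell ''taxis'')
           (Cond (RLess taxi_offer (RGet ''price'' (NConst 0) (NConst 0))) (set_real ''price'' taxi_offer) Skip))
         ?\<sigma> (n * 4 + 2) (\<lambda>\<sigma>'. snd \<sigma>' (''price'', 0, 0) = Min (f ` {..<n}))"
  proof (rule runs_count_loop[where N = n and K = 2 and I = I])
    show "I 0 (upd_cell ''j'' 0 ?\<sigma>)"
      using rep n(2) by (auto simp: I_def represents_upd_price)
  next
    fix j \<sigma>
    assume "j < n" "I j \<sigma>" "fst \<sigma> (''j'', 0, 0) = j"
    then show "runs (Cond (RLess taxi_offer (RGet ''price'' (NConst 0) (NConst 0))) (set_real ''price'' taxi_offer) Skip)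
        \<sigma> 2 (\<lambda>\<sigma>'. fst \<sigma>' (''j'', 0, 0) = j \<and> I (Suc j) (upd_cell ''j'' (Suc j) \<sigma>'))"
      by (auto simp: runs_simps I_def offer represents_upd_price less_Suc_eq intro: less_imp_le order_trans)
  next
    fix k \<sigma>
    assume "I k \<sigma>"
    then show "nval \<sigma> (cell ''taxis'') = n"
      using n(1) by (auto simp: I_def dest: representsD(2)[where a = 0 and b = 0])
  next
    fix \<sigma>
    assume "I n \<sigma>"
    then show "snd \<sigma> (''price'', 0, 0) = Min (f ` {..<n})"
      unfolding I_def by (intro Min_eqI[symmetric]) auto
  qed simp
  moreover have "rval (upd_cell ''j'' 0 \<sigma>) taxi_offer = f 0"
    using offer[of "upd_cell ''j'' 0 \<sigma>"] rep by simp
  ultimately have "runs find_price \<sigma> (n * 4 + 2 + 1 + 1) (\<lambda>\<sigma>'. snd \<sigma>' (''price'', 0, 0) = Min (f ` {..<n}))"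
    unfolding find_price_def by (simp add: runs_simps)
  then show ?thesis
    by (rule runs_mono) (use K in auto)
qed

text \<open>There are \<open>n\<close> insertions, at most \<open>n + 1\<close> anchoring rounds in
  each, and at most \<open>(m + 1) * (n + 1)\<close> pairs scanned per round. This gives degree 4;
  the factor 100 is a generous bound for the constants.\<close>

lemma runs_surge_program:
  assumes rep: "represents \<sigma>0 (\<lambda>_ _. 0) (\<lambda>_. 0) (\<lambda>_. 0) anchor (\<lambda>_. 0) i \<sigma>0"
    and m: "fst \<sigma>0 (''passengers'', 0, 0) = m" and n: "fst \<sigma>0 (''taxis'', 0, 0) = n" "0 < n"
    and K: "100 * (m + n + 2) ^ 4 \<le> K"
  shows "runs surge_program \<sigma>0 K (\<lambda>\<sigma>. \<exists>item p.
    stable m n (market_matrix \<sigma>0) item p 0 \<and>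
    (\<forall>q. q 0 = 0 \<longrightarrow> (\<forall>b\<le>m. \<forall>j\<le>n. 0 \<le> slack (market_matrix \<sigma>0) item q b j) \<longrightarrow> (\<forall>j\<le>n. p j \<le> q j)) \<and>
    snd \<sigma> (''price'', 0, 0) = (MIN j\<in>{..<n}.
      snd \<sigma>0 (''distance'', fst \<sigma>0 (''taxi_loc'', j, 0), fst \<sigma>0 (''request'', 0, 0)) + p (Suc j)))"
    (is "runs _ _ _ ?Q")
proof -
  let ?w = "market_matrix \<sigma>0"
  have w0: "?w 0 j = 0" for j
    by (simp add: market_matrix_def)
  let ?insert = "count_loop ''i'' (cell ''taxis'') insert_item"
  let ?R = "(n + 1) * ((n + 1) * (6 * m + 14) + 18) + 7"
  let ?A = "m * (n * 3 + 4) + 2" and ?B = "n * (?R + 2) + 2" and ?C = "n * 4 + 4"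
  have loop: "runs ?insert \<sigma> ?B (prices_found \<sigma>0 ?w m n)"
    if "represents \<sigma>0 ?w (\<lambda>_. 0) (\<lambda>_. 0) anchor ((\<lambda>_. 0)(0 := 1)) i \<sigma>" for \<sigma>
  proof (rule runs_count_loop[where N = n and K = ?R and I = "prices_found \<sigma>0 ?w m"])
    have "stable m 0 ?w (\<lambda>_. 0) (\<lambda>_. 0) 0"
      by (rule stableI) (auto simp: slack_def)
    moreover have "anchored m 0 ?w (\<lambda>_. 0) (\<lambda>_. 0) anchor ((\<lambda>_. 0)(0 := 1)) 1"
      by (simp add: anchored_def)
    ultimately show "prices_found \<sigma>0 ?w m 0 (upd_cell ''i'' 0 \<sigma>)"
      using represents_next[OF that] unfolding prices_found_def
      by (intro exI conjI) (auto split: if_splits)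
  next
    fix k \<sigma>
    assume "k < n" and found: "prices_found \<sigma>0 ?w m k \<sigma>"
    have kn: "k + 2 \<le> n + 1"
      using \<open>k < n\<close> by simp
    have "(k + 2) * ((k + 2) * (6 * m + 14) + 18) + 7 \<le> ?R"
      by (intro add_le_mono1 mult_le_mono kn order_refl)
    then show "runs insert_item \<sigma> ?R
        (\<lambda>\<sigma>'. fst \<sigma>' (''i'', 0, 0) = k \<and> prices_found \<sigma>0 ?w m (Suc k) (upd_cell ''i'' (Suc k) \<sigma>'))"
      by (intro runs_insert_item w0 found) (auto simp: m)
  next
    fix k \<sigma>
    assume "prices_found \<sigma>0 ?w m k \<sigma>"
    then show "nval \<sigma> (cell ''taxis'') = n"
      using n(1) by (auto simp: prices_found_def dest: representsD(2)[where a = 0 and b = 0])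
  qed simp_all
  have price: "runs find_price \<sigma> ?C ?Q" if found: "prices_found \<sigma>0 ?w m n \<sigma>" for \<sigma>
  proof -
    obtain item p anchor level where rep: "represents \<sigma>0 ?w item p anchor level n \<sigma>" and st: "stable m n ?w item p 0"
      and an: "anchored m n ?w item p anchor level (n + 1)" and level: "\<And>j. level j \<le> n + 1" "\<And>j. 0 < level j \<longleftrightarrow> j \<le> n"
      using found by (auto simp: prices_found_def)
    have "p j \<le> q j"
      if "q 0 = 0" "\<forall>b\<le>m. \<forall>j\<le>n. 0 \<le> slack ?w item q b j" "j \<le> n" for q j
      using an _ stableD(3)[OF st] stableD(2)[OF st] that(1) _ that(3)
      by (rule anchored_minimal) (use that level in auto)
    then show ?thesis
      using st by (intro runs_mono[OF runs_find_price[OF rep n order_refl]]) blast+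
  qed
  have seq: "runs (Seq ?insert find_price) \<sigma> (?B + ?C) ?Q"
    if "represents \<sigma>0 ?w (\<lambda>_. 0) (\<lambda>_. 0) anchor ((\<lambda>_. 0)(0 := 1)) i \<sigma>" for \<sigma>
    by (rule runs_Seq[OF runs_mono[OF loop[OF that] order_refl price] order_refl])
  have "runs (NSet ''level'' (NConst 0) (NConst 0) (NConst 1)) \<sigma> 1 (\<lambda>\<sigma>. runs (Seq ?insert find_price) \<sigma> (?B + ?C) ?Q)"
    if "represents \<sigma>0 ?w (\<lambda>_. 0) (\<lambda>_. 0) anchor (\<lambda>_. 0) i \<sigma>" for \<sigma>
    unfolding runs_step(2)[OF order_refl]
    by (rule seq) (use represents_write(4)[OF that, of 0 1] in simp)
  then have "runs (Seq (NSet ''level'' (NConst 0) (NConst 0) (NConst 1)) (Seq ?insert find_price)) \<sigma> (?B + ?C + 1) ?Q"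
    if "represents \<sigma>0 ?w (\<lambda>_. 0) (\<lambda>_. 0) anchor (\<lambda>_. 0) i \<sigma>" for \<sigma>
    using that by (intro runs_Seq[where K = 1 and K' = "?B + ?C"]) auto
  then have "runs load_matrix \<sigma>0 ?A (\<lambda>\<sigma>. runs (Seq (NSet ''level'' (NConst 0) (NConst 0) (NConst 1))
      (Seq ?insert find_price)) \<sigma> (?B + ?C + 1) ?Q)"
    by (intro runs_mono[OF runs_load_matrix[OF rep m n(1) order_refl]]) auto
  then have "runs surge_program \<sigma>0 (?A + (?B + ?C + 1)) ?Q"
    unfolding surge_program_def by (rule runs_Seq) simp
  moreover have "?A + (?B + ?C + 1) \<le> 100 * (m + n + 2) ^ 4"
    by (simp add: algebra_simps power4_eq_xxxx)
  ultimately show ?thesis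
    using K by (elim runs_mono) auto
qed

section \<open>Correctness of the computed prices\<close>

definition item_option :: "(nat \<Rightarrow> 't) \<Rightarrow> nat \<Rightarrow> 't option" where
  "item_option eT j = (case j of 0 \<Rightarrow> None | Suc i \<Rightarrow> Some (eT i))"

lemma item_option_image:
  assumes "bij_betw eT {..<n} T"
  shows "insert None (Some ` T) = item_option eT ` {..n}"
proof -
  have T: "T = eT ` {..<n}"
    using assms by (simp add: bij_betw_def)
  have "{..n} = insert 0 (Suc ` {..<n})"
    by (simp add: lessThan_Suc_atMost[symmetric] lessThan_Suc_eq_insert_0)
  then show ?thesis
    by (simp add: T item_option_def image_image)
qed

text \<open>Minimality carries over because prices \<open>q\<close> that support \<open>a\<close>,
  extended by 0 at item 0, have nonnegative slacks for the same \<open>item\<close> and so are among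
  the competitors in the hypothesis on \<open>p\<close>.\<close>

lemma minimal_walrasian_of_stable:
  fixes eB :: "nat \<Rightarrow> 'b" and eT :: "nat \<Rightarrow> 't"
  assumes eB: "bij_betw eB {..<m} B" and eT: "bij_betw eT {..<n} T"
    and w: "\<And>b j. b < m \<Longrightarrow> j < n \<Longrightarrow> w (Suc b) (Suc j) = val (eB b) (eT j)"
    and w0: "\<And>j. w 0 j = 0" "\<And>b. w b 0 = 0"
    and st: "stable m n w item p 0"
    and least: "\<forall>q. q 0 = 0 \<longrightarrow> (\<forall>b\<le>m. \<forall>j\<le>n. 0 \<le> slack w item q b j) \<longrightarrow> (\<forall>j\<le>n. p j \<le> q j)"
  defines "a \<equiv> \<lambda>b. item_option eT (item (Suc (inv_into {..<m} eB b)))"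
    and "pr \<equiv> \<lambda>t. p (Suc (inv_into {..<n} eT t))"
  shows "minimal_walrasian_prices B T val a pr"
proof -
  note D = stableD[OF st]
  have B: "\<And>b. b < m \<Longrightarrow> eB b \<in> B" "\<And>x. x \<in> B \<Longrightarrow> \<exists>b<m. x = eB b"
    and T: "\<And>j. j < n \<Longrightarrow> eT j \<in> T" "\<And>t. t \<in> T \<Longrightarrow> \<exists>j<n. t = eT j"
    using eB eT unfolding bij_betw_def by auto
  have invB: "inv_into {..<m} eB (eB b) = b" if "b < m" for b
    using eB that by (simp add: bij_betw_def inv_into_f_f)
  have invT: "inv_into {..<n} eT (eT j) = j" if "j < n" for j
    using eT that by (simp add: bij_betw_def inv_into_f_f)
  have a: "a (eB b) = item_option eT (item (Suc b))" if "b < m" for b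
    using invB[OF that] by (simp add: a_def)
  have pr: "pr (eT j) = p (Suc j)" if "j < n" for j
    using invT[OF that] by (simp add: pr_def)
  have option_inj: "i = j" if "item_option eT i = item_option eT j" "i \<le> n" "j \<le> n" for i j
  proof (cases i; cases j)
    fix i' j' assume "i = Suc i'" "j = Suc j'"
    then show ?thesis
      using that eT by (auto simp: item_option_def bij_betw_def inj_on_def)
  qed (use that in \<open>auto simp: item_option_def\<close>)
  have util: "buyer_utility val q (eB b) (item_option eT j) = w (Suc b) j - q' j"
    if "b < m" "j \<le> n" "q' 0 = 0" "\<And>i. i < n \<Longrightarrow> q' (Suc i) = q (eT i)" for q q' b j
    using that w w0(2) by (cases j) (auto simp: item_option_def buyer_utility_def)
  have al: "allocation B T a"
    unfolding allocation_def
  proof (intro conjI ballI allI impI)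
    fix x t assume "x \<in> B" and t: "a x = Some t"
    then obtain b where b: "b < m" "x = eB b"
      using B(2) by auto
    then show "t \<in> T"
      using t a[OF b(1)] D(3)[of "Suc b"] T(1) by (auto simp: item_option_def split: nat.splits)
  next
    fix x x' t assume "x \<in> B" "x' \<in> B" and t: "a x = Some t \<and> a x' = Some t"
    then obtain b b' where b: "b < m" "x = eB b" and b': "b' < m" "x' = eB b'"
      using B(2) by metis
    then have "item (Suc b) = item (Suc b')"
      using t a[OF b(1)] a[OF b'(1)] D(3)[of "Suc b"] D(3)[of "Suc b'"] by (intro option_inj) auto
    moreover have "item (Suc b) \<noteq> 0"
      using t a[OF b(1)] b by (auto simp: item_option_def split: nat.splits)
    ultimately show "x = x'"
      using D(5)[of "Suc b" "Suc b'"] b b' by simp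
  qed
  have own: "p 0 = 0" "\<And>i. i < n \<Longrightarrow> p (Suc i) = pr (eT i)"
    using D(2) pr by auto
  have "walrasian_prices B T val a pr"
    unfolding walrasian_prices_def
  proof (intro conjI ballI impI)
    fix t assume "t \<in> T"
    then obtain j where j: "j < n" "t = eT j"
      using T(2) by auto
    have "0 \<le> slack w item p 0 (Suc j)"
      using D(4) j by simp
    then show "0 \<le> pr t"
      using slack_dummy_buyer[of w item p] w0(1) D(1,2) pr[OF j(1)] j(2) by simp
    assume unsold: "\<forall>b\<in>B. a b \<noteq> Some t"
    have "item b \<noteq> Suc j" if "b \<le> m" for b
    proof (cases b)
      case 0
      then show ?thesis
        using D(1) by simp
    next
      case (Suc b')
      then have "a (eB b') \<noteq> Some t" "b' < m"
        using unsold B(1)[of b'] that by auto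
      then show ?thesis
        using a[of b'] Suc j(2) by (auto simp: item_option_def)
    qed
    then have "p (Suc j) = 0"
      using j(1) by (intro D(6)) auto
    then show "pr t = 0"
      using pr[OF j(1)] j(2) by simp
  next
    fix x y assume "x \<in> B" "y \<in> insert None (Some ` T)"
    obtain b where b: "b < m" "x = eB b"
      using B(2)[OF \<open>x \<in> B\<close>] by auto
    obtain j where j: "j \<le> n" "y = item_option eT j"
      using \<open>y \<in> insert None (Some ` T)\<close> unfolding item_option_image[OF eT] by auto
    have "0 \<le> slack w item p (Suc b) j"
      using D(4) b(1) j(1) by simp
    then show "buyer_utility val pr x y \<le> buyer_utility val pr x (a x)"
      using util[OF b(1) j(1) own] util[OF b(1) D(3)[of "Suc b"] own] b(1)
      unfolding b(2) j(2) a[OF b(1)] by (simp add: slack_def)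
  qed (fact al)
  moreover have "pr t \<le> q t" if q: "walrasian_prices B T val a q" and t: "t \<in> T" for q t
  proof -
    define q' where "q' j = (case j of 0 \<Rightarrow> 0 | Suc i \<Rightarrow> q (eT i))" for j
    have q': "q' 0 = 0" "\<And>i. i < n \<Longrightarrow> q' (Suc i) = q (eT i)"
      by (auto simp: q'_def)
    have "0 \<le> slack w item q' b j" if "b \<le> m" "j \<le> n" for b j
    proof (cases b)
      case 0
      then show ?thesis
        using slack_dummy_buyer[of w item q'] w0(1) D(1) q'(1) q T(1) that(2)
        by (cases j) (auto simp: walrasian_prices_def q'(2))
    next
      case (Suc b')
      then have b': "b' < m"
        using that(1) by simp
      have "item_option eT j \<in> insert None (Some ` T)"
        using that(2) unfolding item_option_image[OF eT] by simp
      then have "buyer_utility val q (eB b') (item_option eT j) \<le> buyer_utility val q (eB b') (a (eB b'))"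
        using q B(1)[OF b'] unfolding walrasian_prices_def by blast
      then show ?thesis
        using util[OF b' that(2) q'] util[OF b' D(3)[OF that(1)] q'] Suc
        unfolding a[OF b'] by (simp add: slack_def)
    qed
    then have le: "\<forall>j\<le>n. p j \<le> q' j"
      using least q'(1) by blast
    obtain j where j: "j < n" "t = eT j"
      using T(2)[OF t] by auto
    then show ?thesis
      using le[rule_format, of "Suc j"] q'(2)[OF j(1)] pr[OF j(1)] by simp
  qed
  ultimately show ?thesis
    unfolding minimal_walrasian_prices_def by blast
qed

text \<open>Besides correctness, this supplies the existence of minimal Walrasian prices. The
  allocation and the prices may still depend on the enumerations and on \<open>v\<close>.\<close>

lemma program_computes_minimal_prices:
  assumes setting: "taxi_setting V l B T val P s"
    and eV: "bij_betw eV {..<card V} V" and eB: "bij_betw eB {..<card B} B" and eT: "bij_betw eT {..<card T} T"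
    and v: "v \<in> V"
  obtains k \<sigma> a p where "exec surge_program (input_state eV eB eT V l B T val P s v) k \<sigma>"
    "k \<le> 100 * (card B + card T + 2) ^ 4"
    "minimal_walrasian_prices B T (taxi_market_value V l val P s) a p"
    "snd \<sigma> (''price'', 0, 0) = (MIN t\<in>T. l (loc V s t) v + p t)"
proof -
  have fin: "finite V" "finite T" "T \<noteq> {}" and dist: "distribution V B P" "distribution V T s"
    using setting by (auto simp: taxi_setting_def)
  define m n where "m = card B" and "n = card T"
  have n: "0 < n"
    using fin by (simp add: n_def card_gt_0_iff)
  have eB': "bij_betw eB {..<m} B" and eT': "bij_betw eT {..<n} T"
    using eB eT by (simp_all add: m_def n_def)
  let ?\<sigma> = "input_state eV eB eT V l B T val P s v" and ?number = "inv_into {..<card V} eV"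
  have number: "?number u < card V" "eV (?number u) = u" if "u \<in> V" for u
    using eV that inv_into_into[of u eV "{..<card V}"] f_inv_into_f[of u eV "{..<card V}"]
    by (auto simp: bij_betw_def)
  have B: "loc V P (eB b) \<in> V" if "b < m" for b
    using loc_props(1)[OF dist(1)] eB' that by (auto simp: bij_betw_def)
  have T: "loc V s (eT j) \<in> V" if "j < n" for j
    using loc_props(1)[OF dist(2)] eT' that by (auto simp: bij_betw_def)
  have input: "fst ?\<sigma> (''passengers'', 0, 0) = m" "fst ?\<sigma> (''taxis'', 0, 0) = n"
    "fst ?\<sigma> (''request'', 0, 0) = ?number v"
    "b < m \<Longrightarrow> fst ?\<sigma> (''passenger_loc'', b, 0) = ?number (loc V P (eB b))"
    "j < n \<Longrightarrow> fst ?\<sigma> (''taxi_loc'', j, 0) = ?number (loc V s (eT j))"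
    "b < m \<Longrightarrow> snd ?\<sigma> (''value'', b, 0) = val (eB b)" for b j
    by (simp_all add: input_state_def Let_def m_def n_def)
  have distance: "snd ?\<sigma> (''distance'', ?number u, ?number u') = l u u'" if "u \<in> V" "u' \<in> V" for u u'
    using number that by (simp add: input_state_def Let_def)
  have rep: "represents ?\<sigma> (\<lambda>_ _. 0) (\<lambda>_. 0) (\<lambda>_. 0) (\<lambda>_. 0) (\<lambda>_. 0) 0 ?\<sigma>"
    by (simp add: represents_def input_state_def Let_def)
  let ?w = "market_matrix ?\<sigma>"
  have w: "?w (Suc b) (Suc j) = taxi_market_value V l val P s (eB b) (eT j)" if "b < m" "j < n" for b j
    using that input distance[OF B T] by (simp add: market_matrix_def taxi_market_value_def)
  have w0: "?w 0 j = 0" "?w b 0 = 0" for b j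
    by (simp_all add: market_matrix_def)
  obtain k \<sigma> item p where run: "exec surge_program ?\<sigma> k \<sigma>" "k \<le> 100 * (m + n + 2) ^ 4"
    and st: "stable m n ?w item p 0"
    and least: "\<forall>q. q 0 = 0 \<longrightarrow> (\<forall>b\<le>m. \<forall>j\<le>n. 0 \<le> slack ?w item q b j) \<longrightarrow> (\<forall>j\<le>n. p j \<le> q j)"
    and price: "snd \<sigma> (''price'', 0, 0) = (MIN j\<in>{..<n}.
      snd ?\<sigma> (''distance'', fst ?\<sigma> (''taxi_loc'', j, 0), fst ?\<sigma> (''request'', 0, 0)) + p (Suc j))"
    using runs_surge_program[OF rep input(1,2) n order_refl] unfolding runs_def by blast
  define a where "a b = item_option eT (item (Suc (inv_into {..<m} eB b)))" for b
  define pr where "pr t = p (Suc (inv_into {..<n} eT t))" for t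
  have "minimal_walrasian_prices B T (taxi_market_value V l val P s) a pr"
    unfolding a_def pr_def
    by (rule minimal_walrasian_of_stable[where w = ?w and val = "taxi_market_value V l val P s",
          OF eB' eT' w w0 st least])
  moreover have "snd \<sigma> (''price'', 0, 0) = (MIN t\<in>T. l (loc V s t) v + pr t)"
  proof -
    have "(\<lambda>j. snd ?\<sigma> (''distance'', fst ?\<sigma> (''taxi_loc'', j, 0), fst ?\<sigma> (''request'', 0, 0)) + p (Suc j)) ` {..<n} =
        (\<lambda>j. l (loc V s (eT j)) v + pr (eT j)) ` {..<n}"
      using eT' by (intro image_cong) (simp_all add: input distance[OF T v] pr_def bij_betw_def inv_into_f_f)
    also have "\<dots> = (\<lambda>t. l (loc V s t) v + pr t) ` T"
      using eT' by (auto simp: bij_betw_def)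
    finally show ?thesis
      using price by simp
  qed
  ultimately show thesis
    using that run unfolding m_def n_def by blast
qed

section \<open>Independence of the prices from the enumerations\<close>

lemma enumeration_exists: "finite X \<Longrightarrow> \<exists>e. bij_betw e {..<card X} X"
  using ex_bij_betw_nat_finite[of X] by (simp add: lessThan_atLeast0)

definition step_bound :: "nat poly" where
  "step_bound = [:100:] * [:2, 1:] ^ 4"

lemma poly_step_bound: "poly step_bound x = 100 * (x + 2) ^ 4"
  by (simp add: step_bound_def poly_power add.commute)

theorem theorem4p7:
  shows "\<exists>prog q. \<forall>(V :: 'v set) l (B :: 'b set) (T :: 't set) value P s.
    taxi_setting V l B T value P s \<longrightarrow>
    (\<exists>r d s'.
       d = demand P value \<and> (\<forall>v\<in>V. 0 \<le> r v) \<and> distribution V T s' \<and>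
       surge_outcome V l B T value P s r s' \<and>
       (\<forall>\<kappa>. (\<forall>v\<in>V. 0 \<le> \<kappa> v \<and> \<kappa> v \<le> 1) \<longrightarrow>
          passenger_taxi_equilibrium \<kappa> V l B value P s s' d r) \<and>
       welfare_maximizing_supply V l T value s s' r d \<and>
       computes_prices prog q V l B T value P s r \<and>
       truthful_dominant V l B T value P s)"
proof (intro exI[of _ surge_program] exI[of _ step_bound] allI impI)
  fix V :: "'v set" and l and B :: "'b set" and T :: "'t set" and val P s
  assume setting: "taxi_setting V l B T val P s"
  let ?val = "taxi_market_value V l val P s"
  have fin: "finite V" "finite B" "finite T" and "T \<noteq> {}" "distribution V T s"
    using setting by (auto simp: taxi_setting_def)
  then obtain t where "t \<in> T"
    by auto
  \<comment> \<open>A run needs a requested location, and that of any taxicab will do; the run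
    serves only to produce \<open>a\<close> and \<open>p\<close>.\<close>
  then have "loc V s t \<in> V"
    using loc_props(1)[OF \<open>distribution V T s\<close>] by simp
  moreover obtain eV :: "nat \<Rightarrow> 'v" and eB :: "nat \<Rightarrow> 'b" and eT :: "nat \<Rightarrow> 't"
    where "bij_betw eV {..<card V} V" "bij_betw eB {..<card B} B" "bij_betw eT {..<card T} T"
    using fin enumeration_exists by metis
  ultimately obtain a p where min: "minimal_walrasian_prices B T ?val a p"
    using program_computes_minimal_prices[OF setting] by metis
  define r where "r v = (MIN t\<in>T. l (loc V s t) v + p t)" for v
  define s' where "s' = moved_supply B T P s a"
  have wal: "walrasian_prices B T ?val a p"
    using min by (simp add: minimal_walrasian_prices_def)
  interpret priced_taxi_market V l B T val P s a p r s'
    by unfold_locales (use setting wal in \<open>auto simp: r_def s'_def\<close>)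
  have opt: "welfare_maximizing_allocation B T ?val a"
    using fin(2,3) wal by (rule walrasian_welfare_maximizing)
  have outcome: "surge_outcome V l B T val P s r s'"
    unfolding surge_outcome_def using opt min by (intro exI[of _ a] exI[of _ p]) (simp add: r_def s'_def)
  \<comment> \<open>Each enumeration may lead to its own allocation \<open>a'\<close>, while
    \<open>r\<close> has to be the same for all. Both price vectors support both optimal
    allocations, so by minimality each lies below the other.\<close>
  have unique: "p' t = p t" if min': "minimal_walrasian_prices B T ?val a' p'" and "t \<in> T" for a' p' t
  proof -
    have wal': "walrasian_prices B T ?val a' p'"
      using min' by (simp add: minimal_walrasian_prices_def)
    have "walrasian_prices B T ?val a p'" "walrasian_prices B T ?val a' p"
      using walrasian_change_allocation[OF fin(2,3)] wal wal' opt walrasian_welfare_maximizing[OF fin(2,3) wal'] by blast+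
    then show ?thesis
      using min min' that(2) unfolding minimal_walrasian_prices_def by (meson order_antisym)
  qed
  have "computes_prices surge_program step_bound V l B T val P s r"
    unfolding computes_prices_def
  proof (intro allI impI ballI; elim conjE)
    fix eV eB eT v
    assume e: "bij_betw eV {..<card V} V" "bij_betw eB {..<card B} B" "bij_betw eT {..<card T} T" and "v \<in> V"
    obtain k \<sigma> a' p' where run: "exec surge_program (input_state eV eB eT V l B T val P s v) k \<sigma>"
      "k \<le> 100 * (card B + card T + 2) ^ 4"
      and min': "minimal_walrasian_prices B T ?val a' p'"
      and price: "snd \<sigma> (''price'', 0, 0) = (MIN t\<in>T. l (loc V s t) v + p' t)"
      using program_computes_minimal_prices[OF setting e \<open>v \<in> V\<close>] .
    have same: "l (loc V s t) v + p' t = l (loc V s t) v + p t" if "t \<in> T" for t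
      using unique[OF min' that] by (simp only:)
    have "(\<lambda>t. l (loc V s t) v + p' t) ` T = (\<lambda>t. l (loc V s t) v + p t) ` T"
      by (rule image_cong[OF refl same])
    then have "snd \<sigma> (''price'', 0, 0) = r v"
      unfolding price r_def by (rule arg_cong)
    then show "\<exists>k \<sigma>. exec surge_program (input_state eV eB eT V l B T val P s v) k \<sigma> \<and>
        k \<le> poly step_bound (card B + card T) \<and> snd \<sigma> (''price'', 0, 0) = r v"
      using run unfolding poly_step_bound by (intro exI[of _ k] exI[of _ \<sigma>] conjI)
  qed
  then show "\<exists>r d s'.
       d = demand P val \<and> (\<forall>v\<in>V. 0 \<le> r v) \<and> distribution V T s' \<and>
       surge_outcome V l B T val P s r s' \<and>
       (\<forall>\<kappa>. (\<forall>v\<in>V. 0 \<le> \<kappa> v \<and> \<kappa> v \<le> 1) \<longrightarrow>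
          passenger_taxi_equilibrium \<kappa> V l B val P s s' d r) \<and>
       welfare_maximizing_supply V l T val s s' r d \<and>
       computes_prices surge_program step_bound V l B T val P s r \<and>
       truthful_dominant V l B T val P s"
    using surge_nonneg distribution_moved outcome equilibrium welfare_maximizing truthful_dominant_surge[OF setting]
    by (intro exI[of _ r] exI[of _ "demand P val"] exI[of _ s']) auto
qed

end
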